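(* Let $b$ be an angular collision kernel as in the context, $\mu_0$ a probability measure on $\mathscr{B}(\mathbb{R}^3)$ and $\mu(\cdot,t)$ the measure solution of the homogeneous Boltzmann equation with kernel $b$ and initial datum $\mu_0$. Then $\mu(\cdot,t)$ converges weakly as $t\to+\infty$ if and only if $\int_{\mathbb{R}^3}|x|^2\mu_0(dx)<+\infty$. When this condition holds, the limit is the Maxwellian distribution $\gamma_{v_0,\sigma}$ with $v_0=\int_{\mathbb{R}^3}v\,\mu_0(dv)$ and $\sigma^2=\frac13\int_{\mathbb{R}^3}|v-v_0|^2\mu_0(dv)$.
   Context: Let $b:(-1,1)\to[0,+\infty)$ be measurable with $b(x)=b(\sqrt{1-x^2})\frac{|x|}{\sqrt{1-x^2}}=b(-x)$ on $(-1,1)$ and $\int_0^1 b(x)dx=1$. For $v,w\in\mathbb{R}^3$, $\omega\in S^2$ put $v_*=v+[(w-v)\cdot\omega]\omega$; $u_{S^2}$ is the uniform probability on $S^2$. Given a probability measure $\mu_0$, the measure solution with initial datum $\mu_0$ is the unique map $t\mapsto\mu(\cdot,t)$ into probability measures on $\mathbb{R}^3$, continuous on $[0,\infty)$ and $C^1$ on $(0,\infty)$ for the total variation distance, with $\mu(\cdot,0)=\mu_0$ and, for all $t>0$ and bounded continuous $\phi$, $\frac{d}{dt}\int\phi\,d\mu(\cdot,t)=\int\int\int_{S^2}\phi(v_* )\,b(\frac{w-v}{|w-v|}\cdot\omega)\,u_{S^2}(d\omega)\mu(dv,t)\mu(dw,t)-\int\phi\,d\mu(\cdot,t)$. For $(v_0,\sigma)\in\mathbb{R}^3\times[0,\infty)$,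 the Maxwellian $\gamma_{v_0,\sigma}$ is the probability measure with density $(2\pi\sigma^2)^{-3/2}\exp\{-|v-v_0|^2/(2\sigma^2)\}$ if $\sigma>0$, and $\gamma_{v_0,0}=\delta_{v_0}$. *)

theory Defs
  imports "HOL-Probability.Probability"
begin

type_synonym vec3 = "real ^ 3"

text \<open>Uniform probability on the unit sphere S^2 (normalized surface measure), realised
  as the cone measure: the image of the uniform distribution on the unit ball under
  radial projection x \<mapsto> x / |x|.\<close>
definition usphere :: "vec3 measure" where
  "usphere = distr (uniform_measure lborel (ball 0 1)) borel (\<lambda>x. x /\<^sub>R norm x)"

text \<open>Unit direction of w - v; for w = v (no collision) a fixed unit vector is used,
  so that the angular integral of b still equals 1.\<close>
definition coll_dir :: "vec3 \<Rightarrow> vec3 \<Rightarrow> vec3" where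
  "coll_dir v w = (if w = v then axis 1 1 else (w - v) /\<^sub>R norm (w - v))"

definition post_vel :: "vec3 \<Rightarrow> vec3 \<Rightarrow> vec3 \<Rightarrow> vec3" where
  "post_vel v w \<omega> = v + ((w - v) \<bullet> \<omega>) *\<^sub>R \<omega>"

definition angular_kernel :: "(real \<Rightarrow> real) \<Rightarrow> bool" where
  "angular_kernel b \<longleftrightarrow>
     b \<in> borel_measurable (restrict_space borel {-1<..<1}) \<and>
     (\<forall>x\<in>{-1<..<1}. 0 \<le> b x) \<and>
     (\<forall>x\<in>{-1<..<1}. b x = b (sqrt (1 - x\<^sup>2)) * \<bar>x\<bar> / sqrt (1 - x\<^sup>2) \<and> b x = b (- x)) \<and>
     (\<integral>\<^sup>+ x. ennreal (b x) * indicator {0<..<1} x \<partial>lborel) = 1"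

text \<open>Total variation norm of a (difference of finite measures given as a) set function,
  taken as the supremum over Borel sets (equivalent to the usual norm up to a factor 2).\<close>
definition tv_norm :: "(vec3 set \<Rightarrow> real) \<Rightarrow> real" where
  "tv_norm f = (SUP A \<in> sets (borel :: vec3 measure). \<bar>f A\<bar>)"

definition tv_dist :: "vec3 measure \<Rightarrow> vec3 measure \<Rightarrow> real" where
  "tv_dist M N = tv_norm (\<lambda>A. measure M A - measure N A)"

definition bounded_continuous :: "(vec3 \<Rightarrow> real) \<Rightarrow> bool" where
  "bounded_continuous \<phi> \<longleftrightarrow> continuous_on UNIV \<phi> \<and> bounded (range \<phi>)"

definition is_prob_borel :: "vec3 measure \<Rightarrow> bool" where
  "is_prob_borel M \<longleftrightarrow> prob_space M \<and> sets M = sets borel"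

definition measure_solution :: "(real \<Rightarrow> real) \<Rightarrow> vec3 measure \<Rightarrow> (real \<Rightarrow> vec3 measure) \<Rightarrow> bool" where
  "measure_solution b \<mu>0 \<mu> \<longleftrightarrow>
     (\<forall>t\<ge>0. is_prob_borel (\<mu> t)) \<and> \<mu> 0 = \<mu>0 \<and>
     \<comment> \<open>continuity on [0,\<infinity>) in total variation\<close>
     (\<forall>t\<ge>0. ((\<lambda>s. tv_dist (\<mu> s) (\<mu> t)) \<longlongrightarrow> 0) (at t within {0..})) \<and>
     \<comment> \<open>C^1 on (0,\<infinity>) in total variation: derivative is the signed measure P t - N t\<close>
     (\<exists>P N :: real \<Rightarrow> vec3 measure.
        (\<forall>t>0. finite_measure (P t) \<and> finite_measure (N t) \<and>
               sets (P t) = sets borel \<and> sets (N t) = sets borel) \<and>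
        (\<forall>t>0. ((\<lambda>h. tv_norm (\<lambda>A. (measure (\<mu> (t + h)) A - measure (\<mu> t) A) / h
                                   - (measure (P t) A - measure (N t) A))) \<longlongrightarrow> 0) (at 0)) \<and>
        (\<forall>t>0. ((\<lambda>s. tv_norm (\<lambda>A. (measure (P s) A - measure (N s) A)
                                   - (measure (P t) A - measure (N t) A))) \<longlongrightarrow> 0) (at t))) \<and>
     \<comment> \<open>the weak form of the equation\<close>
     (\<forall>\<phi> t. bounded_continuous \<phi> \<and> t > 0 \<longrightarrow>
        ((\<lambda>s. \<integral>x. \<phi> x \<partial>\<mu> s) has_real_derivative
           ((\<integral>v. \<integral>w. \<integral>\<omega>. \<phi> (post_vel v w \<omega>) * b (coll_dir v w \<bullet> \<omega>) \<partial>usphere \<partial>\<mu> t \<partial>\<mu> t)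
            - (\<integral>x. \<phi> x \<partial>\<mu> t))) (at t))"

definition maxwellian :: "vec3 \<Rightarrow> real \<Rightarrow> vec3 measure" where
  "maxwellian v0 \<sigma> = (if \<sigma> > 0 then
     density lborel (\<lambda>v. ennreal ((2 * pi * \<sigma>\<^sup>2) powr (-3/2) * exp (- (norm (v - v0))\<^sup>2 / (2 * \<sigma>\<^sup>2))))
   else return borel v0)"

definition weak_conv_at_top :: "(real \<Rightarrow> vec3 measure) \<Rightarrow> vec3 measure \<Rightarrow> bool" where
  "weak_conv_at_top \<mu> \<nu> \<longleftrightarrow>
     (\<forall>\<phi>. bounded_continuous \<phi> \<longrightarrow> ((\<lambda>t. \<integral>x. \<phi> x \<partial>\<mu> t) \<longlongrightarrow> (\<integral>x. \<phi> x \<partial>\<nu>)) at_top)"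

end

theory Submission
  imports Defs
begin

text \<open>
On the Fourier side the equation becomes \<open>\<partial>\<^sub>t f + f = Q(f)\<close> with
\<open>Q(f)(\<xi>) = \<integral> f(\<xi> - (\<xi>\<cdot>\<omega>)\<omega>) f((\<xi>\<cdot>\<omega>)\<omega>) b(\<xi>\<cdot>\<omega>/|\<xi>|) d\<omega>\<close> (Bobylev), because a reflection
exchanges the directions of \<open>w - v\<close> and \<open>\<xi>\<close>. The two arguments are orthogonal and add up to \<open>\<xi>\<close>.
Hence the averaging operator \<open>L h(\<xi>) = \<integral> h(\<xi>\<^sub>1) + h(\<xi>\<^sub>2)\<close> fixes \<open>|\<xi>|\<^sup>2\<close>, contracts \<open>|\<xi>|\<^sup>4\<close> by the factor
\<open>1 - 2\<kappa>\<close> and traceless quadratic forms by \<open>1 - 3\<kappa>\<close>, where \<open>\<kappa> = \<integral> x\<^sup>2(1 - x\<^sup>2) b > 0\<close>.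

So if \<open>p\<close> is a nonnegative quadratic form of trace \<open>3s\<close> and \<open>p\<^sub>t\<close> relaxes exponentially to \<open>s|\<xi>|\<^sup>2\<close>, then
\<open>N = exp(-p\<^sub>t/2)\<close> solves the equation up to \<open>O(e\<^bsup>-\<kappa>t\<^esup> |\<xi>|\<^sup>4)\<close>, and \<open>\<epsilon>|\<xi>|\<^sup>2 + C e\<^bsup>-\<kappa>t\<^esup> |\<xi>|\<^sup>4\<close> is a supersolution
of the linear comparison equation for \<open>|f - N|\<close> as well as for \<open>|f| - N\<close>. With finite energy, the second
order expansion of the centred initial characteristic function gives \<open>f \<rightarrow> exp(-\<sigma>\<^sup>2|\<xi>|\<^sup>2/2)\<close>, and the
continuity theorem applies. For arbitrary data, truncating \<open>1 - |f\<^sub>0|\<^sup>2 = \<integral>\<integral> 1 - cos(\<xi>\<cdot>(v - w))\<close> at \<open>|v - w| \<le> n\<close>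
bounds \<open>|f\<^sub>0|\<close> by \<open>exp(-p\<^sub>n/2) + O(|\<xi>|\<^sup>4)\<close>, so every limit is dominated by a Gaussian of variance equal to the
truncated variance; if the energy is infinite, the limit vanishes off the origin and is no
characteristic function.
\<close>

section \<open>Gaussian smoothing and the continuity theorem in Euclidean space\<close>

lemma
  fixes f :: "'a::euclidean_space \<Rightarrow> real \<Rightarrow> complex"
  assumes f: "\<And>b. b \<in> Basis \<Longrightarrow> integrable lborel (f b)"
  shows integrable_lborel_prod: "integrable lborel (\<lambda>x::'a. \<Prod>b\<in>Basis. f b (x \<bullet> b))"
    and integral_lborel_prod:
      "(\<integral>x. (\<Prod>b\<in>Basis. f b (x \<bullet> b)) \<partial>(lborel::'a measure)) = (\<Prod>b\<in>Basis. \<integral>x. f b x \<partial>lborel)"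
proof -
  interpret product_sigma_finite "\<lambda>b::'a. lborel :: real measure" ..
  have [measurable]: "f b \<in> borel_measurable borel" if "b \<in> Basis" for b
    using borel_measurable_integrable[OF f[OF that]] by simp
  have m: "(\<lambda>x::'a. \<Prod>b\<in>Basis. f b (x \<bullet> b)) \<in> borel_measurable borel" by measurable
  have *: "(\<Prod>b\<in>Basis. f b ((\<Sum>c\<in>Basis. x c *\<^sub>R c) \<bullet> b)) = (\<Prod>b\<in>Basis. f b (x b))" for x :: "'a \<Rightarrow> real"
    by (intro prod.cong) auto
  have s: "(\<lambda>f. \<Sum>b\<in>Basis. f b *\<^sub>R b) \<in> (\<Pi>\<^sub>M b\<in>(Basis::'a set). lborel) \<rightarrow>\<^sub>M (borel::'a measure)"
    by measurable
  show "integrable lborel (\<lambda>x::'a. \<Prod>b\<in>Basis. f b (x \<bullet> b))"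
    using product_integrable_prod[of "Basis::'a set" f] f
    by (subst lborel_eq, subst integrable_distr_eq[OF s m]) (simp add: *)
  show "(\<integral>x. (\<Prod>b\<in>Basis. f b (x \<bullet> b)) \<partial>(lborel::'a measure)) = (\<Prod>b\<in>Basis. \<integral>x. f b x \<partial>lborel)"
    using product_integral_prod[of "Basis::'a set" f] f
    by (subst lborel_eq, subst integral_distr[OF s m]) (simp add: *)
qed

lemma normal_density_char:
  fixes \<sigma> t :: real
  assumes \<sigma>: "\<sigma> > 0"
  shows "integrable lborel (\<lambda>x. complex_of_real (normal_density 0 \<sigma> x) * iexp (t * x))"
    and "(\<integral>x. complex_of_real (normal_density 0 \<sigma> x) * iexp (t * x) \<partial>lborel) = complex_of_real (exp (- (\<sigma>\<^sup>2 * t\<^sup>2) / 2))"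
proof -
  have i: "integrable lborel (\<lambda>x. complex_of_real (normal_density 0 \<sigma> x))"
    using integrable_normal_density[OF \<sigma>] by simp
  show "integrable lborel (\<lambda>x. complex_of_real (normal_density 0 \<sigma> x) * iexp (t * x))"
    by (rule Bochner_Integration.integrable_bound[OF i]) (auto simp: norm_mult)
  have "(\<integral>x. complex_of_real (normal_density 0 \<sigma> x) * iexp (t * x) \<partial>lborel)
      = \<sigma> *\<^sub>R (\<integral>x. complex_of_real (normal_density 0 \<sigma> (\<sigma> * x)) * iexp (t * (\<sigma> * x)) \<partial>lborel)"
    using lborel_integral_real_affine[of \<sigma> "\<lambda>x. complex_of_real (normal_density 0 \<sigma> x) * iexp (t * x)" 0] \<sigma>
    by simp
  also have "\<dots> = (\<integral>x. std_normal_density x *\<^sub>R iexp ((t * \<sigma>) * x) \<partial>lborel)"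
    unfolding Bochner_Integration.integral_scaleR_right[symmetric]
  proof (rule Bochner_Integration.integral_cong, simp)
    fix x :: real
    have "\<sigma> * normal_density 0 \<sigma> (\<sigma> * x) = std_normal_density x"
      using \<sigma> by (simp add: normal_density_def power_mult_distrib real_sqrt_mult)
    then show "\<sigma> *\<^sub>R (complex_of_real (normal_density 0 \<sigma> (\<sigma> * x)) * iexp (t * (\<sigma> * x)))
       = std_normal_density x *\<^sub>R iexp ((t * \<sigma>) * x)"
      by (simp add: scaleR_conv_of_real ac_simps flip: of_real_mult)
  qed
  also have "\<dots> = char std_normal_distribution (t * \<sigma>)"
    unfolding char_def by (subst integral_density) (auto)
  also have "\<dots> = complex_of_real (exp (- (\<sigma>\<^sup>2 * t\<^sup>2) / 2))"
    unfolding char_std_normal_distribution by (simp add: power_mult_distrib mult.commute)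
  finally show "(\<integral>x. complex_of_real (normal_density 0 \<sigma> x) * iexp (t * x) \<partial>lborel) = complex_of_real (exp (- (\<sigma>\<^sup>2 * t\<^sup>2) / 2))" .
qed

definition gauss_density :: "real \<Rightarrow> 'a::euclidean_space \<Rightarrow> real" where
  "gauss_density \<sigma> x = (\<Prod>b\<in>Basis. normal_density 0 \<sigma> (x \<bullet> b))"

lemma gauss_density_nonneg [simp]: "0 \<le> gauss_density \<sigma> x"
  unfolding gauss_density_def by (intro prod_nonneg) auto

lemma gauss_density_measurable [measurable]: "gauss_density \<sigma> \<in> borel_measurable borel"
  unfolding gauss_density_def by measurable

lemma gauss_density_eq:
  assumes "\<sigma> > 0"
  shows "gauss_density \<sigma> (x::'a::euclidean_space) =
    (1 / sqrt (2 * pi * \<sigma>\<^sup>2)) ^ DIM('a) * exp (- (norm x)\<^sup>2 / (2 * \<sigma>\<^sup>2))"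
proof -
  have "(norm x)\<^sup>2 = (\<Sum>b\<in>Basis. (x \<bullet> b)\<^sup>2)"
    unfolding power2_norm_eq_inner by (subst euclidean_inner) (simp add: power2_eq_square)
  then have "exp (- (norm x)\<^sup>2 / (2 * \<sigma>\<^sup>2)) = (\<Prod>b\<in>Basis. exp (- (x \<bullet> b)\<^sup>2 / (2 * \<sigma>\<^sup>2)))"
    by (simp add: exp_sum[symmetric] sum_divide_distrib[symmetric] sum_negf)
  then show ?thesis
    unfolding gauss_density_def normal_density_def prod.distrib by simp
qed

lemma
  fixes \<xi> :: "'a::euclidean_space"
  assumes \<sigma>: "\<sigma> > 0"
  shows integrable_gauss_iexp: "integrable lborel (\<lambda>x::'a. complex_of_real (gauss_density \<sigma> x) * iexp (\<xi> \<bullet> x))"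
    and integral_gauss_iexp: "(\<integral>x. complex_of_real (gauss_density \<sigma> x) * iexp (\<xi> \<bullet> x) \<partial>lborel) =
       complex_of_real (exp (- (\<sigma>\<^sup>2 * (norm \<xi>)\<^sup>2) / 2))"
proof -
  let ?f = "\<lambda>b y. complex_of_real (normal_density 0 \<sigma> y) * iexp ((\<xi> \<bullet> b) * y)"
  have eq: "complex_of_real (gauss_density \<sigma> x) * iexp (\<xi> \<bullet> x) = (\<Prod>b\<in>Basis. ?f b (x \<bullet> b))" for x
    by (simp add: gauss_density_def prod.distrib exp_sum euclidean_inner[of \<xi> x] sum_distrib_left)
  show "integrable lborel (\<lambda>x::'a. complex_of_real (gauss_density \<sigma> x) * iexp (\<xi> \<bullet> x))"
    unfolding eq by (intro integrable_lborel_prod normal_density_char \<sigma>)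
  have "(norm \<xi>)\<^sup>2 = (\<Sum>b\<in>Basis. (\<xi> \<bullet> b)\<^sup>2)"
    unfolding power2_norm_eq_inner by (subst euclidean_inner) (simp add: power2_eq_square)
  then have e: "exp (- (\<sigma>\<^sup>2 * (norm \<xi>)\<^sup>2) / 2) = (\<Prod>b\<in>Basis. exp (- (\<sigma>\<^sup>2 * (\<xi> \<bullet> b)\<^sup>2) / 2))"
    by (simp add: exp_sum[symmetric] sum_divide_distrib[symmetric] sum_negf sum_distrib_left)
  show "(\<integral>x. complex_of_real (gauss_density \<sigma> x) * iexp (\<xi> \<bullet> x) \<partial>lborel) =
       complex_of_real (exp (- (\<sigma>\<^sup>2 * (norm \<xi>)\<^sup>2) / 2))"
    unfolding eq by (subst integral_lborel_prod[of ?f])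
      (auto simp only: normal_density_char[OF \<sigma>] e of_real_prod)
qed

lemma integrable_gauss_density: "\<sigma> > 0 \<Longrightarrow> integrable lborel (gauss_density \<sigma> :: 'a::euclidean_space \<Rightarrow> real)"
  using integrable_gauss_iexp[of \<sigma> "0::'a"] by (simp add: complex_of_real_integrable_eq)

lemma integral_gauss_density: 
  assumes "\<sigma> > 0" shows "(\<integral>x. gauss_density \<sigma> x \<partial>(lborel::'a::euclidean_space measure)) = 1"
proof -
  have "complex_of_real (\<integral>x. gauss_density \<sigma> x \<partial>(lborel::'a::euclidean_space measure)) = 1"
    using integral_gauss_iexp[OF assms, of "0::'a"] by simp
  then show ?thesis by (metis of_real_eq_1_iff)
qed

lemma prob_space_gauss:
  assumes "\<sigma> > 0" shows "prob_space (density lborel (\<lambda>x::'a::euclidean_space. ennreal (gauss_density \<sigma> x)))"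
  by (rule prob_spaceI) (simp add: emeasure_density nn_integral_eq_integral
      integrable_gauss_density integral_gauss_density assms)


lemma (in prob_space) cmod_char_le_1: "cmod (\<integral>x. iexp (g x) \<partial>M) \<le> 1"
proof -
  have "cmod (\<integral>x. iexp (g x) \<partial>M) \<le> (\<integral>x. cmod (iexp (g x)) \<partial>M)"
    by (rule integral_norm_bound)
  also have "\<dots> = 1" using prob_space by simp
  finally show ?thesis .
qed

lemma cmod_fourier_le:
  fixes g :: "'a::euclidean_space \<Rightarrow> real"
  shows "cmod (\<integral>x. g x * iexp (\<xi> \<bullet> x) \<partial>lborel) \<le> (\<integral>x. \<bar>g x\<bar> \<partial>lborel)"
  using integral_norm_bound[of lborel "\<lambda>x. g x * iexp (\<xi> \<bullet> x)"] by (simp add: norm_mult)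

lemma gauss_smoothing_fourier:
  fixes g :: "'a::euclidean_space \<Rightarrow> real"
  assumes M: "prob_space M" "sets M = sets borel" and g: "integrable lborel g" and e: "\<epsilon> > 0"
  shows "complex_of_real (\<integral>v. \<integral>x. g x * gauss_density \<epsilon> (x - v) \<partial>lborel \<partial>M) =
     (1 / sqrt (2 * pi * \<epsilon>\<^sup>2)) ^ DIM('a) *
     (\<integral>\<xi>. (gauss_density (1 / \<epsilon>) \<xi> * (\<integral>x. g x * iexp (\<xi> \<bullet> x) \<partial>lborel)) * (\<integral>v. iexp ((-\<xi>) \<bullet> v) \<partial>M) \<partial>lborel)"
    (is "_ = ?C * ?R")
proof -
  interpret M: prob_space M by fact
  interpret P: pair_sigma_finite lborel M ..
  have [measurable_cong]: "sets M = sets borel" by fact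
  have gm[measurable]: "g \<in> borel_measurable borel" using borel_measurable_integrable[OF g] by simp
  let ?G = "gauss_density (1 / \<epsilon>) :: 'a \<Rightarrow> real"
  have e1: "1 / \<epsilon> > 0" using e by simp
  have Gi: "integrable lborel ?G" by (rule integrable_gauss_density[OF e1])
  have dens: "complex_of_real (gauss_density \<epsilon> y) = ?C * (\<integral>\<xi>. ?G \<xi> * iexp (\<xi> \<bullet> y) \<partial>lborel)" for y :: 'a
  proof -
    have "(\<integral>\<xi>. ?G \<xi> * iexp (\<xi> \<bullet> y) \<partial>lborel) = exp (- (norm y)\<^sup>2 / (2 * \<epsilon>\<^sup>2))"
      using integral_gauss_iexp[OF e1, of y] by (simp add: inner_commute power_divide)
    then show ?thesis using gauss_density_eq[OF e, of y] by simp
  qed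
  define ghat where "ghat \<xi> = (\<integral>x. g x * iexp (\<xi> \<bullet> x) \<partial>lborel)" for \<xi> :: 'a
  have ghatm[measurable]: "ghat \<in> borel_measurable borel" unfolding ghat_def by measurable
  have ghatb: "cmod (ghat \<xi>) \<le> (\<integral>x. \<bar>g x\<bar> \<partial>lborel)" for \<xi>
    unfolding ghat_def by (rule cmod_fourier_le)
  have 1: "(\<integral>x. g x * (\<integral>\<xi>. ?G \<xi> * iexp (\<xi> \<bullet> (x - v)) \<partial>lborel) \<partial>lborel)
     = (\<integral>\<xi>. ?G \<xi> * ghat \<xi> * iexp ((-\<xi>) \<bullet> v) \<partial>lborel)" for v
  proof -
    let ?f = "\<lambda>x \<xi>. g x * (?G \<xi> * iexp (\<xi> \<bullet> (x - v)))"
    have "integrable (lborel \<Otimes>\<^sub>M lborel) (case_prod ?f)"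
    proof (rule lborel_pair.Fubini_integrable)
      show "integrable lborel (\<lambda>x. \<integral>y. cmod (case (x, y) of (x, xa) \<Rightarrow> ?f x xa) \<partial>lborel)"
        using g Gi by (simp add: norm_mult)
      show "AE x in lborel. integrable lborel (\<lambda>y. case (x, y) of (x, xa) \<Rightarrow> ?f x xa)"
        using integrable_gauss_iexp[OF e1, of "x - v" for x] by (simp add: inner_commute)
    qed measurable
    then have "(\<integral>\<xi>. \<integral>x. ?f x \<xi> \<partial>lborel \<partial>lborel) = (\<integral>x. \<integral>\<xi>. ?f x \<xi> \<partial>lborel \<partial>lborel)"
      by (rule lborel_pair.Fubini_integral)
    also have "(\<lambda>\<xi>. \<integral>x. ?f x \<xi> \<partial>lborel) = (\<lambda>\<xi>. ?G \<xi> * ghat \<xi> * iexp ((-\<xi>) \<bullet> v))"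
    proof
      fix \<xi>
      have "(\<integral>x. ?f x \<xi> \<partial>lborel) = (\<integral>x. (?G \<xi> * iexp ((-\<xi>) \<bullet> v)) * (g x * iexp (\<xi> \<bullet> x)) \<partial>lborel)"
        by (rule Bochner_Integration.integral_cong)
           (auto simp: inner_diff_right algebra_simps exp_diff exp_minus field_simps)
      then show "(\<integral>x. ?f x \<xi> \<partial>lborel) = ?G \<xi> * ghat \<xi> * iexp ((-\<xi>) \<bullet> v)"
        by (simp add: ghat_def)
    qed
    finally show ?thesis by simp
  qed
  have Ggi: "integrable lborel (\<lambda>\<xi>. ?G \<xi> * ghat \<xi>)"
    by (rule Bochner_Integration.integrable_bound[OF integrable_mult_left[OF Gi, of "\<integral>x. \<bar>g x\<bar> \<partial>lborel"]])
       (auto simp: norm_mult abs_mult intro!: mult_left_mono order_trans[OF ghatb])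
  have "(\<integral>v. \<integral>x. g x * gauss_density \<epsilon> (x - v) \<partial>lborel \<partial>M)
     = (\<integral>v. \<integral>x. complex_of_real (g x * gauss_density \<epsilon> (x - v)) \<partial>lborel \<partial>M)"
    by (simp del: of_real_mult)
  also have "\<dots> = (\<integral>v. ?C * (\<integral>x. g x * (\<integral>\<xi>. ?G \<xi> * iexp (\<xi> \<bullet> (x - v)) \<partial>lborel) \<partial>lborel) \<partial>M)"
    by (simp add: dens mult.left_commute flip: Bochner_Integration.integral_mult_right_zero)
  also have "\<dots> = ?C * (\<integral>v. \<integral>\<xi>. ?G \<xi> * ghat \<xi> * iexp ((-\<xi>) \<bullet> v) \<partial>lborel \<partial>M)"
    by (simp add: 1)
  also have "(\<integral>v. \<integral>\<xi>. ?G \<xi> * ghat \<xi> * iexp ((-\<xi>) \<bullet> v) \<partial>lborel \<partial>M)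
     = (\<integral>\<xi>. \<integral>v. ?G \<xi> * ghat \<xi> * iexp ((-\<xi>) \<bullet> v) \<partial>M \<partial>lborel)"
  proof (rule P.Fubini_integral, rule P.Fubini_integrable)
    show "integrable lborel (\<lambda>x. \<integral>y. cmod (case (x, y) of (\<xi>, v) \<Rightarrow> ?G \<xi> * ghat \<xi> * iexp ((-\<xi>) \<bullet> v)) \<partial>M)"
      using integrable_norm[OF Ggi] by (simp add: norm_mult M.prob_space)
    show "AE x in lborel. integrable M (\<lambda>y. case (x, y) of (\<xi>, v) \<Rightarrow> ?G \<xi> * ghat \<xi> * iexp ((-\<xi>) \<bullet> v))"
      by (intro AE_I2 M.integrable_const_bound[where B="cmod (?G _ * ghat _)"]) (auto simp: norm_mult)
  qed measurable
  also have "\<dots> = ?R"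
    by (simp add: ghat_def)
  finally show ?thesis .
qed

lemma gauss_smoothing_uniform:
  fixes g :: "'a::euclidean_space \<Rightarrow> real"
  assumes uc: "uniformly_continuous_on UNIV g" and B: "\<And>x. \<bar>g x\<bar> \<le> B" and \<eta>: "\<eta> > 0"
  obtains \<epsilon> where "\<epsilon> > 0" "\<And>v. \<bar>(\<integral>x. g x * gauss_density \<epsilon> (x - v) \<partial>lborel) - g v\<bar> \<le> \<eta>"
proof -
  let ?G = "density lborel (\<lambda>x::'a. ennreal (gauss_density 1 x))"
  interpret G: prob_space ?G by (rule prob_space_gauss) simp
  have [measurable]: "g \<in> borel_measurable borel"
    using uc by (intro borel_measurable_continuous_onI uniformly_continuous_imp_continuous)
  have B0: "B \<ge> 0" using B[of 0] by linarith
  have "(\<lambda>n. measure ?G (ball 0 (real n))) \<longlonglongrightarrow> measure ?G (\<Union>n. ball 0 (real n))"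
    by (rule G.finite_Lim_measure_incseq) (auto simp: incseq_def)
  moreover have "(\<Union>n. ball (0::'a) (real n)) = UNIV"
    by (auto intro: reals_Archimedean2)
  ultimately have "(\<lambda>n. measure ?G (ball 0 (real n))) \<longlonglongrightarrow> 1"
    using G.prob_space by simp
  moreover have "1 - \<eta> / (4 * B + 1) < 1" using \<eta> B0 by simp
  ultimately have "eventually (\<lambda>n. 1 - \<eta> / (4 * B + 1) < measure ?G (ball 0 (real n))) sequentially"
    by (rule order_tendstoD)
  then obtain R :: nat where R: "1 - \<eta> / (4 * B + 1) < measure ?G (ball 0 (real R))"
    by (auto simp: eventually_sequentially)
  have "\<eta> / 2 > 0" using \<eta> by simp
  then obtain d where d: "d > 0" "\<And>x y. dist y x < d \<Longrightarrow> dist (g y) (g x) < \<eta> / 2"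
    using uc unfolding uniformly_continuous_on_def by (metis UNIV_I)
  define \<epsilon> where "\<epsilon> = d / (R + 1)"
  have e: "\<epsilon> > 0" using d by (simp add: \<epsilon>_def)
  have eR: "\<epsilon> * R < d" using d by (simp add: \<epsilon>_def field_simps)
  show ?thesis
  proof
    show "\<epsilon> > 0" by fact
    fix v
    have "(\<integral>x. g x * gauss_density \<epsilon> (x - v) \<partial>lborel) = (\<integral>z. \<epsilon> ^ DIM('a) * (g (v + \<epsilon> *\<^sub>R z) * gauss_density \<epsilon> (\<epsilon> *\<^sub>R z)) \<partial>lborel)"
      using e by (subst lborel_affine[of \<epsilon> v]) (auto simp: integral_density integral_distr ennreal_power)
    also have "\<dots> = (\<integral>z. g (v + \<epsilon> *\<^sub>R z) \<partial>?G)"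
    proof -
      have "\<epsilon> ^ DIM('a) * gauss_density \<epsilon> (\<epsilon> *\<^sub>R z) = gauss_density 1 z" for z :: 'a
        using e by (simp add: gauss_density_eq power_mult_distrib real_sqrt_mult power_divide)
      then have "\<epsilon> ^ DIM('a) * (g (v + \<epsilon> *\<^sub>R z) * gauss_density \<epsilon> (\<epsilon> *\<^sub>R z)) = gauss_density 1 z * g (v + \<epsilon> *\<^sub>R z)" for z :: 'a
        by (metis mult.assoc mult.commute)
      then show ?thesis by (subst integral_density) (simp_all only:, auto)
    qed
    finally have eq: "(\<integral>x. g x * gauss_density \<epsilon> (x - v) \<partial>lborel) = (\<integral>z. g (v + \<epsilon> *\<^sub>R z) \<partial>?G)" .
    have i: "integrable ?G (\<lambda>z. g (v + \<epsilon> *\<^sub>R z))"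
      by (rule G.integrable_const_bound[where B=B]) (auto simp: B)
    have "(\<integral>z. g (v + \<epsilon> *\<^sub>R z) \<partial>?G) - g v = (\<integral>z. g (v + \<epsilon> *\<^sub>R z) - g v \<partial>?G)"
      using i G.prob_space by (simp add: Bochner_Integration.integral_diff)
    also have "\<bar>\<dots>\<bar> \<le> (\<integral>z. \<eta> / 2 + 2 * B * indicator (- ball 0 (real R)) z \<partial>?G)"
    proof (rule integral_abs_bound_integral)
      show "\<bar>g (v + \<epsilon> *\<^sub>R z) - g v\<bar> \<le> \<eta> / 2 + 2 * B * indicator (- ball 0 (real R)) z" for z
      proof (cases "z \<in> ball 0 (real R)")
        case True
        then have "\<epsilon> * norm z \<le> \<epsilon> * R" using e by simp
        also note eR
        finally have "dist (v + \<epsilon> *\<^sub>R z) v < d" using e by (simp add: dist_norm)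
        from d(2)[OF this] True show ?thesis by (simp add: dist_real_def)
      next
        case False
        then show ?thesis using B[of v] B[of "v + \<epsilon> *\<^sub>R z"] \<eta> by simp
      qed
    qed (use i in \<open>auto intro!: integrable_real_indicator simp: G.emeasure_finite less_top[symmetric]\<close>)
    also have "\<dots> = \<eta> / 2 + 2 * B * measure ?G (- ball 0 (real R))"
      using G.prob_space by (subst Bochner_Integration.integral_add) (auto intro!: integrable_real_indicator simp: G.emeasure_finite less_top[symmetric])
    also have "measure ?G (- ball 0 (real R)) = 1 - measure ?G (ball 0 (real R))"
      using G.prob_compl[of "ball 0 (real R)"] by (simp add: Compl_eq_Diff_UNIV)
    also have "\<eta> / 2 + 2 * B * (1 - measure ?G (ball 0 (real R))) \<le> \<eta> / 2 + 2 * B * (\<eta> / (4 * B + 1))"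
      using R B0 by (intro add_left_mono mult_left_mono) auto
    also have "\<dots> \<le> \<eta>"
      using \<eta> B0 by (simp add: field_simps)
    finally show "\<bar>(\<integral>x. g x * gauss_density \<epsilon> (x - v) \<partial>lborel) - g v\<bar> \<le> \<eta>"
      unfolding eq by simp
  qed
qed

lemma char_tendsto_imp_compactly_supported_tendsto:
  fixes g :: "'a::euclidean_space \<Rightarrow> real"
  assumes M: "\<And>n. prob_space (M n)" "\<And>n. sets (M n) = sets borel"
    and N: "prob_space N" "sets N = sets borel"
    and lim: "\<And>\<xi>. (\<lambda>n. \<integral>x. iexp (\<xi> \<bullet> x) \<partial>M n) \<longlonglongrightarrow> (\<integral>x. iexp (\<xi> \<bullet> x) \<partial>N)"
    and g: "continuous_on UNIV g" "\<And>x. norm x > r \<Longrightarrow> g x = 0"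
  shows "(\<lambda>n. \<integral>x. g x \<partial>M n) \<longlonglongrightarrow> (\<integral>x. g x \<partial>N)"
proof -
  have [measurable]: "g \<in> borel_measurable borel" by (rule borel_measurable_continuous_onI[OF g(1)])
  have "compact (g ` cball 0 r)" using g(1) by (intro compact_continuous_image) (auto intro: continuous_on_subset)
  then obtain B0 where B0: "\<And>x. x \<in> cball 0 r \<Longrightarrow> \<bar>g x\<bar> \<le> B0"
    by (force dest!: compact_imp_bounded simp: bounded_iff)
  define B where "B = max B0 0"
  have B: "\<bar>g x\<bar> \<le> B" for x
    using B0[of x] g(2)[of x] by (cases "norm x \<le> r") (auto simp: B_def)
  have gi: "integrable lborel g"
  proof (rule Bochner_Integration.integrable_bound)
    show "integrable lborel (\<lambda>x::'a. B * indicator (cball 0 r) x)"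
      using emeasure_lborel_cball_finite[of "0::'a" r]
      by (intro integrable_mult_right integrable_real_indicator) auto
    show "AE x in lborel. norm (g x) \<le> norm (B * indicator (cball 0 r) x)"
      using B g(2) by (auto split: split_indicator simp: B_def)
  qed simp
  have uc: "uniformly_continuous_on UNIV g"
    unfolding uniformly_continuous_on_def
  proof (intro allI impI)
    fix e :: real assume "e > 0"
    have "uniformly_continuous_on (cball 0 (r + 1)) g"
      using g(1) by (intro compact_uniformly_continuous) (auto intro: continuous_on_subset)
    then obtain d where d: "d > 0" "\<And>x y. x \<in> cball 0 (r+1) \<Longrightarrow> y \<in> cball 0 (r+1) \<Longrightarrow> dist y x < d \<Longrightarrow> dist (g y) (g x) < e"
      using \<open>e > 0\<close> unfolding uniformly_continuous_on_def by meson
    have "dist (g y) (g x) < e" if "dist y x < min d 1" for x y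
    proof (cases "x \<in> cball 0 (r+1) \<and> y \<in> cball 0 (r+1)")
      case True
      then show ?thesis using d that by auto
    next
      case False
      have "\<bar>norm y - norm x\<bar> < 1" using that norm_triangle_ineq3[of y x] by (simp add: dist_norm)
      then have "norm x > r" "norm y > r" using False by auto
      then show ?thesis using g(2) \<open>e > 0\<close> by simp
    qed
    then show "\<exists>d>0. \<forall>x\<in>UNIV. \<forall>x'\<in>UNIV. dist x' x < d \<longrightarrow> dist (g x') (g x) < e"
      using d(1) by (intro exI[of _ "min d 1"]) auto
  qed
  define S where "S \<epsilon> v = (\<integral>x. g x * gauss_density \<epsilon> (x - v) \<partial>lborel)" for \<epsilon> and v :: 'a
  have Slim: "(\<lambda>n. \<integral>v. S \<epsilon> v \<partial>M n) \<longlonglongrightarrow> (\<integral>v. S \<epsilon> v \<partial>N)" if e: "\<epsilon> > 0" for \<epsilon>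
  proof -
    have e1: "1 / \<epsilon> > 0" using e by simp
    let ?gh = "\<lambda>\<xi>. \<integral>x. g x * iexp (\<xi> \<bullet> x) \<partial>lborel"
    let ?G = "gauss_density (1 / \<epsilon>) :: 'a \<Rightarrow> real"
    have meas: "(\<lambda>\<xi>. ?G \<xi> * ?gh \<xi> * (\<integral>v. iexp ((-\<xi>) \<bullet> v) \<partial>L)) \<in> borel_measurable lborel"
      if L: "prob_space L" "sets L = sets borel" for L
    proof -
      interpret prob_space L by fact
      have [measurable_cong]: "sets L = sets borel" by fact
      show ?thesis by measurable
    qed
    have "(\<lambda>n. \<integral>\<xi>. ?G \<xi> * ?gh \<xi> * (\<integral>v. iexp ((-\<xi>) \<bullet> v) \<partial>M n) \<partial>lborel) \<longlonglongrightarrow>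
          (\<integral>\<xi>. ?G \<xi> * ?gh \<xi> * (\<integral>v. iexp ((-\<xi>) \<bullet> v) \<partial>N) \<partial>lborel)"
    proof (rule integral_dominated_convergence)
      show "integrable lborel (\<lambda>\<xi>. ?G \<xi> * (\<integral>x. \<bar>g x\<bar> \<partial>lborel))"
        by (intro integrable_mult_left integrable_gauss_density e1)
      show "AE \<xi> in lborel. (\<lambda>n. ?G \<xi> * ?gh \<xi> * (\<integral>v. iexp ((-\<xi>) \<bullet> v) \<partial>M n)) \<longlonglongrightarrow> ?G \<xi> * ?gh \<xi> * (\<integral>v. iexp ((-\<xi>) \<bullet> v) \<partial>N)"
        by (intro AE_I2 tendsto_mult_left lim)
      show "AE \<xi> in lborel. cmod (?G \<xi> * ?gh \<xi> * (\<integral>v. iexp ((-\<xi>) \<bullet> v) \<partial>M n)) \<le> ?G \<xi> * (\<integral>x. \<bar>g x\<bar> \<partial>lborel)" for n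
      proof (rule AE_I2)
        fix \<xi> :: 'a
        have "cmod (?gh \<xi>) * cmod (\<integral>v. iexp ((-\<xi>) \<bullet> v) \<partial>M n) \<le> (\<integral>x. \<bar>g x\<bar> \<partial>lborel) * 1"
          by (intro mult_mono cmod_fourier_le prob_space.cmod_char_le_1 M) auto
        then show "cmod (?G \<xi> * ?gh \<xi> * (\<integral>v. iexp ((-\<xi>) \<bullet> v) \<partial>M n)) \<le> ?G \<xi> * (\<integral>x. \<bar>g x\<bar> \<partial>lborel)"
          by (simp add: norm_mult mult.assoc mult_left_mono)
      qed
    qed (intro meas M N)+
    then have "(\<lambda>n. complex_of_real (\<integral>v. S \<epsilon> v \<partial>M n)) \<longlonglongrightarrow> complex_of_real (\<integral>v. S \<epsilon> v \<partial>N)"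
      unfolding S_def gauss_smoothing_fourier[OF M gi e] gauss_smoothing_fourier[OF N gi e]
      by (intro tendsto_mult_left)
    then show ?thesis by (simp only: tendsto_of_real_iff)
  qed
  show ?thesis
  proof (rule metric_LIMSEQ_I)
    fix e :: real assume "e > 0"
    then have "e / 4 > 0" by simp
    then obtain \<epsilon> where \<epsilon>: "\<epsilon> > 0" "\<And>v. \<bar>S \<epsilon> v - g v\<bar> \<le> e / 4"
      using gauss_smoothing_uniform[OF uc B] unfolding S_def by blast
    have close: "\<bar>(\<integral>v. S \<epsilon> v \<partial>L) - (\<integral>v. g v \<partial>L)\<bar> \<le> e / 4" if L: "prob_space L" "sets L = sets borel" for L
    proof -
      interpret prob_space L by fact
      have [measurable_cong]: "sets L = sets borel" by fact
      have [measurable]: "S \<epsilon> \<in> borel_measurable borel" unfolding S_def by measurable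
      have ig: "integrable L g" by (rule integrable_const_bound[where B=B]) (auto simp: B)
      have "\<bar>S \<epsilon> v\<bar> \<le> B + e / 4" for v using \<epsilon>(2)[of v] B[of v] by linarith
      then have iS: "integrable L (S \<epsilon>)" by (intro integrable_const_bound[where B="B + e / 4"]) auto
      have "\<bar>\<integral>v. S \<epsilon> v - g v \<partial>L\<bar> \<le> (\<integral>v. e / 4 \<partial>L)"
        by (rule integral_abs_bound_integral)
           (use ig iS \<epsilon> in auto)
      then show ?thesis using ig iS prob_space by simp
    qed
    obtain n0 where n0: "\<And>n. n \<ge> n0 \<Longrightarrow> dist (\<integral>v. S \<epsilon> v \<partial>M n) (\<integral>v. S \<epsilon> v \<partial>N) < e / 4"
      using metric_LIMSEQ_D[OF Slim[OF \<epsilon>(1)] \<open>e / 4 > 0\<close>] by auto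
    show "\<exists>n0. \<forall>n\<ge>n0. dist (\<integral>x. g x \<partial>M n) (\<integral>x. g x \<partial>N) < e"
    proof (intro exI[of _ n0] allI impI)
      fix n assume "n \<ge> n0"
      from n0[OF this] close[OF M, of n] close[OF N] \<open>e > 0\<close>
      show "dist (\<integral>x. g x \<partial>M n) (\<integral>x. g x \<partial>N) < e"
        unfolding dist_real_def abs_le_iff abs_less_iff by linarith
    qed
  qed
qed

theorem levy_continuity_euclidean:
  fixes g :: "'a::euclidean_space \<Rightarrow> real"
  assumes M: "\<And>n. prob_space (M n)" "\<And>n. sets (M n) = sets borel"
    and N: "prob_space N" "sets N = sets borel"
    and lim: "\<And>\<xi>. (\<lambda>n. \<integral>x. iexp (\<xi> \<bullet> x) \<partial>M n) \<longlonglongrightarrow> (\<integral>x. iexp (\<xi> \<bullet> x) \<partial>N)"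
    and g: "continuous_on UNIV g" "bounded (range g)"
  shows "(\<lambda>n. \<integral>x. g x \<partial>M n) \<longlonglongrightarrow> (\<integral>x. g x \<partial>N)"
proof (rule metric_LIMSEQ_I)
  fix e :: real assume e: "e > 0"
  interpret N: prob_space N by fact
  have [measurable]: "g \<in> borel_measurable borel" by (rule borel_measurable_continuous_onI[OF g(1)])
  have [measurable_cong]: "sets N = sets borel" by fact
  obtain B0 where "\<And>x. \<bar>g x\<bar> \<le> B0" using g(2) by (auto simp: bounded_iff)
  then have B1: "\<bar>g x\<bar> \<le> \<bar>B0\<bar> + 1" for x by (rule order_trans) simp
  define B where "B = \<bar>B0\<bar> + 1"
  have B: "\<bar>g x\<bar> \<le> B" for x using B1 by (simp add: B_def)
  have Bpos: "B > 0" by (simp add: B_def)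
  define cut where "cut k x = max 0 (min 1 (real k + 1 - norm x))" for k and x :: 'a
  have cutc: "continuous_on UNIV (cut k)" for k unfolding cut_def by (intro continuous_intros)
  have cutm[measurable]: "cut k \<in> borel_measurable borel" for k by (rule borel_measurable_continuous_onI[OF cutc])
  have cut01: "0 \<le> cut k x" "cut k x \<le> 1" for k x by (auto simp: cut_def)
  have cut0: "cut k x = 0" if "norm x > real k + 1" for k x using that by (auto simp: cut_def)
  have "(\<lambda>k. \<integral>x. cut k x \<partial>N) \<longlonglongrightarrow> (\<integral>x. 1 \<partial>N)"
  proof (rule integral_dominated_convergence[where w="\<lambda>_. 1"])
    show "AE x in N. (\<lambda>k. cut k x) \<longlonglongrightarrow> 1"
    proof (intro AE_I2 tendsto_eventually)
      fix x :: 'a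
      obtain k0 :: nat where "norm x \<le> k0" using real_arch_simple by blast
      then have "cut k x = 1" if "k \<ge> k0" for k using that by (auto simp: cut_def)
      then show "\<forall>\<^sub>F k in sequentially. cut k x = 1" by (auto simp: eventually_sequentially)
    qed
  qed (use cut01 in auto)
  moreover have "1 - e / (8 * B) < (\<integral>x. 1 \<partial>N)" using e Bpos N.prob_space by simp
  ultimately have "\<forall>\<^sub>F k in sequentially. 1 - e / (8 * B) < (\<integral>x. cut k x \<partial>N)"
    by (rule order_tendstoD)
  then obtain k where k: "1 - e / (8 * B) < (\<integral>x. cut k x \<partial>N)" by (auto simp: eventually_sequentially)
  have cs: "(\<lambda>n. \<integral>x. cut k x \<partial>M n) \<longlonglongrightarrow> (\<integral>x. cut k x \<partial>N)"
    by (rule char_tendsto_imp_compactly_supported_tendsto[OF M N lim cutc, of "real k + 1"]) (auto simp: cut0)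
  have cg: "(\<lambda>n. \<integral>x. g x * cut k x \<partial>M n) \<longlonglongrightarrow> (\<integral>x. g x * cut k x \<partial>N)"
    by (rule char_tendsto_imp_compactly_supported_tendsto[OF M N lim, of _ "real k + 1"])
       (auto simp: cut0 intro!: continuous_intros g(1) cutc)
  have "\<forall>\<^sub>F n in sequentially. 1 - e / (8 * B) < (\<integral>x. cut k x \<partial>M n)"
    using cs k by (rule order_tendstoD)
  moreover have "\<forall>\<^sub>F n in sequentially. dist (\<integral>x. g x * cut k x \<partial>M n) (\<integral>x. g x * cut k x \<partial>N) < e / 4"
    using cg e by (intro tendstoD) auto
  ultimately have "\<forall>\<^sub>F n in sequentially. dist (\<integral>x. g x \<partial>M n) (\<integral>x. g x \<partial>N) < e"
  proof eventually_elim
    case (elim n)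
    have close: "\<bar>(\<integral>x. g x \<partial>L) - (\<integral>x. g x * cut k x \<partial>L)\<bar> \<le> e / 8"
      if L: "prob_space L" "sets L = sets borel" and k: "1 - e / (8 * B) < (\<integral>x. cut k x \<partial>L)" for L
    proof -
      interpret prob_space L by fact
      have [measurable_cong]: "sets L = sets borel" by fact
      have ig: "integrable L g" by (rule integrable_const_bound[where B=B]) (auto simp: B)
      have ic: "integrable L (cut k)" by (rule integrable_const_bound[where B=1]) (auto simp: cut01)
      have igc: "integrable L (\<lambda>x. g x * cut k x)"
        by (rule Bochner_Integration.integrable_bound[OF ig]) (auto simp: abs_mult cut01 mult_left_le)
      have "\<bar>\<integral>x. g x - g x * cut k x \<partial>L\<bar> \<le> (\<integral>x. B * (1 - cut k x) \<partial>L)"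
      proof (rule integral_abs_bound_integral)
        show "\<bar>g x - g x * cut k x\<bar> \<le> B * (1 - cut k x)" for x
        proof -
          have "g x - g x * cut k x = g x * (1 - cut k x)" by (simp add: algebra_simps)
          then show ?thesis using cut01[of k x] B[of x] by (simp add: abs_mult mult_right_mono)
        qed
      qed (use ig ic igc in auto)
      also have "\<dots> = B * (1 - (\<integral>x. cut k x \<partial>L))" using ic prob_space by simp
      also have "\<dots> \<le> B * (e / (8 * B))" using k Bpos by (intro mult_left_mono) auto
      also have "\<dots> = e / 8" using Bpos by simp
      finally show ?thesis using ig igc by simp
    qed
    from close[OF M elim(1)] close[OF N k] elim(2) e show ?case
      unfolding dist_real_def abs_le_iff abs_less_iff by linarith
  qed
  then show "\<exists>n0. \<forall>n\<ge>n0. dist (\<integral>x. g x \<partial>M n) (\<integral>x. g x \<partial>N) < e"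
    by (auto simp: eventually_sequentially)
qed

section \<open>Invariance of the uniform measure on the sphere\<close>

lemma orthogonal_transformation_measurable:
  fixes T :: "'a::euclidean_space \<Rightarrow> 'a"
  assumes "orthogonal_transformation T"
  shows "T \<in> borel_measurable borel"
  using orthogonal_transformation_linear[OF assms]
  by (intro borel_measurable_continuous_onI linear_continuous_on) (simp only: linear_conv_bounded_linear)

lemma distr_lborel_orthogonal:
  fixes T :: "real^'n::{finite,wellorder} \<Rightarrow> real^'n::_"
  assumes T: "orthogonal_transformation T"
  shows "distr lborel borel T = lborel"
proof (rule lborel_eqI[symmetric])
  have [measurable]: "T \<in> borel_measurable borel"
    using T by (rule orthogonal_transformation_measurable)
  fix l u :: "real^'n::_" assume lu: "\<And>b. b \<in> Basis \<Longrightarrow> l \<bullet> b \<le> u \<bullet> b"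
  have iT: "orthogonal_transformation (inv T)" using T by (rule orthogonal_transformation_inv)
  have vi: "T -` box l u = inv T ` box l u"
    using T by (simp add: bij_vimage_eq_inv_image orthogonal_transformation_bij)
  have m: "T -` box l u \<in> lmeasurable"
    unfolding vi by (rule measurable_orthogonal_image[OF iT]) simp
  have s: "T -` box l u \<in> sets borel"
    using measurable_sets[OF \<open>T \<in> borel_measurable borel\<close>, of "box l u"] by simp
  have "emeasure (distr lborel borel T) (box l u) = emeasure lebesgue (T -` box l u)"
    using s by (simp add: emeasure_distr)
  also have "\<dots> = ennreal (measure lebesgue (T -` box l u))"
    using m by (intro emeasure_eq_measure2) (auto simp: fmeasurable_def)
  also have "measure lebesgue (T -` box l u) = measure lebesgue (box l u)"
    unfolding vi by (rule measure_orthogonal_image[OF iT]) simp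
  also have "\<dots> = (\<Prod>b\<in>Basis. (u - l) \<bullet> b)" using lu by (simp add: measure_lborel_box_eq)
  finally show "emeasure (distr lborel borel T) (box l u) = ennreal (\<Prod>b\<in>Basis. (u - l) \<bullet> b)" .
qed simp

definition reflect :: "'a::real_inner \<Rightarrow> 'a \<Rightarrow> 'a" where
  "reflect a x = x - (2 * (a \<bullet> x) / (a \<bullet> a)) *\<^sub>R a"

lemma orthogonal_transformation_reflect: "orthogonal_transformation (reflect a)"
proof -
  have "linear (reflect a)"
    by (rule linearI) (auto simp: reflect_def inner_simps algebra_simps add_divide_distrib)
  moreover have "reflect a v \<bullet> reflect a w = v \<bullet> w" for v w
    by (cases "a = 0") (auto simp: reflect_def inner_simps inner_commute field_simps)
  ultimately show ?thesis by (simp add: orthogonal_transformation_def)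
qed

lemma reflect_adjoint: "reflect a x \<bullet> y = x \<bullet> reflect a y"
  by (simp add: reflect_def inner_simps inner_commute)

lemma reflect_orthogonal: "a \<bullet> x = 0 \<Longrightarrow> reflect a x = x"
  by (simp add: reflect_def)

lemma reflect_self: "reflect a a = - a"
  by (cases "a = 0") (auto simp: reflect_def scaleR_2)

lemma reflect_minus: "reflect (- a) x = reflect a x"
  by (simp add: reflect_def)

lemma reflect_diff:
  assumes "norm u = norm v"
  shows "reflect (u - v) u = v"
proof (cases "u = v")
  case False
  have "(u - v) \<bullet> (u - v) = 2 * ((u - v) \<bullet> u)"
    using assms by (simp add: inner_simps inner_commute norm_eq_sqrt_inner)
  moreover have "(u - v) \<bullet> (u - v) \<noteq> 0" using False by simp
  ultimately have c: "2 * ((u - v) \<bullet> u) / ((u - v) \<bullet> (u - v)) = 1" by (metis divide_self)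
  show ?thesis unfolding reflect_def c by simp
qed (simp add: reflect_def)

lemma reflect_diff': "norm u = norm v \<Longrightarrow> reflect (u - v) v = u"
  using reflect_diff[of v u] reflect_minus[of "u - v" v] by simp

lemma sets_usphere [measurable_cong, simp]: "sets usphere = sets borel"
  and space_usphere [simp]: "space usphere = UNIV"
  by (simp_all add: usphere_def)

lemma emeasure_unit_ball: "emeasure lborel (ball (0::vec3) 1) \<noteq> 0" "emeasure lborel (ball (0::vec3) 1) \<noteq> \<infinity>"
proof -
  show "emeasure lborel (ball (0::vec3) 1) \<noteq> \<infinity>"
    using emeasure_lborel_ball_finite[of "0::vec3" 1] by auto
  have "\<not> negligible (ball (0::vec3) 1)" by (intro open_not_negligible) auto
  then show "emeasure lborel (ball (0::vec3) 1) \<noteq> 0"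
    by (simp add: negligible_iff_null_sets null_sets_def)
qed

lemma distr_usphere_orthogonal:
  assumes T: "orthogonal_transformation T"
  shows "distr usphere borel T = usphere"
proof -
  let ?U = "uniform_measure lborel (ball (0::vec3) 1)"
  have [measurable]: "T \<in> borel_measurable borel" using T by (rule orthogonal_transformation_measurable)
  have nT: "norm (T x) = norm x" for x using T by (rule orthogonal_transformation_norm)
  have U: "distr ?U borel T = ?U"
  proof (rule measure_eqI)
    fix A assume "A \<in> sets (distr ?U borel T)"
    then have A[measurable]: "A \<in> sets borel" by simp
    have "ball 0 1 \<inter> T -` A = T -` (ball 0 1 \<inter> A)" by (auto simp: nT)
    moreover have "emeasure lborel (T -` (ball 0 1 \<inter> A)) = emeasure (distr lborel borel T) (ball 0 1 \<inter> A)"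
      by (subst emeasure_distr) auto
    moreover have "T -` A \<in> sets borel"
      using measurable_sets[OF \<open>T \<in> borel_measurable borel\<close> A] by simp
    ultimately show "emeasure (distr ?U borel T) A = emeasure ?U A"
      by (simp add: emeasure_distr emeasure_uniform_measure distr_lborel_orthogonal[OF T])
  qed simp
  have eq: "T (x /\<^sub>R norm x) = T x /\<^sub>R norm (T x)" for x
    using orthogonal_transformation_linear[OF T] by (simp add: linear_scale nT)
  have "distr usphere borel T = distr ?U borel (\<lambda>x. T x /\<^sub>R norm (T x))"
    unfolding usphere_def by (subst distr_distr) (auto simp: comp_def eq)
  also have "\<dots> = distr (distr ?U borel T) borel (\<lambda>x. x /\<^sub>R norm x)"
    by (subst distr_distr) (auto simp: comp_def)
  also have "\<dots> = usphere" by (simp add: U usphere_def)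
  finally show ?thesis .
qed

lemma AE_usphere:
  assumes u: "norm u = 1"
  shows "AE \<omega> in usphere. norm \<omega> = 1 \<and> \<bar>u \<bullet> \<omega>\<bar> < 1"
proof -
  obtain e where e: "e \<noteq> 0" "orthogonal u e"
    using orthogonal_to_vector_exists[of u] by auto
  have "negligible {x. e \<bullet> x = 0}" using e by (intro negligible_hyperplane) auto
  moreover have "{x::vec3. e \<bullet> x = 0} \<in> sets borel" by measurable
  ultimately have "{x. e \<bullet> x = 0} \<in> null_sets lborel"
    by (simp add: negligible_iff_null_sets null_sets_def)
  then have "AE x in lborel. x \<notin> {x. e \<bullet> x = 0}" by (rule AE_not_in)
  then have "AE x in lborel. x \<in> ball 0 1 \<longrightarrow> norm (x /\<^sub>R norm x) = 1 \<and> \<bar>u \<bullet> (x /\<^sub>R norm x)\<bar> < 1"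
  proof (rule AE_mp, intro AE_I2 impI)
    fix x assume "x \<notin> {x. e \<bullet> x = 0}"
    then have ex: "e \<bullet> x \<noteq> 0" by simp
    then have x0: "norm x > 0" by auto
    have "x \<noteq> (u \<bullet> x) *\<^sub>R u"
      using ex e(2) by (metis inner_scaleR_right mult_zero_right orthogonal_def orthogonal_commute)
    then have "(x - (u \<bullet> x) *\<^sub>R u) \<bullet> (x - (u \<bullet> x) *\<^sub>R u) > 0" by simp
    moreover have "u \<bullet> u = 1" using u by (simp add: norm_eq_1)
    ultimately have "(u \<bullet> x)\<^sup>2 < (norm x)\<^sup>2"
      unfolding power2_norm_eq_inner by (simp add: inner_simps inner_commute power2_eq_square)
    then have "\<bar>u \<bullet> x\<bar> < norm x" by (metis abs_norm_cancel power2_less_imp_less power2_abs norm_ge_zero)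
    then show "norm (x /\<^sub>R norm x) = 1 \<and> \<bar>u \<bullet> (x /\<^sub>R norm x)\<bar> < 1"
      using x0 by (simp add: abs_mult field_simps)
  qed
  then show ?thesis
    unfolding usphere_def using emeasure_unit_ball
    by (subst AE_distr_iff) (auto simp: AE_uniform_measure less_top)
qed

locale normalized_kernel =
  fixes c :: "real \<Rightarrow> real"
  assumes c_measurable [measurable]: "c \<in> borel_measurable borel"
    and c_nonneg: "0 \<le> c x"
    and c_zero: "x = 0 \<or> \<bar>x\<bar> \<ge> 1 \<Longrightarrow> c x = 0"
    and c_integral: "norm u = 1 \<Longrightarrow> (\<integral>\<omega>. c (u \<bullet> \<omega>) \<partial>usphere) = 1"
begin

definition K :: "vec3 \<Rightarrow> vec3 measure" where
  "K u = density usphere (\<lambda>\<omega>. ennreal (c (u \<bullet> \<omega>)))"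

lemma sets_K [measurable_cong, simp]: "sets (K u) = sets borel"
  and space_K [simp]: "space (K u) = UNIV"
  by (simp_all add: K_def)

lemma c_integrable: "norm u = 1 \<Longrightarrow> integrable usphere (\<lambda>\<omega>. c (u \<bullet> \<omega>))"
  using c_integral[of u] not_integrable_integral_eq by fastforce

lemma prob_space_K: "norm u = 1 \<Longrightarrow> prob_space (K u)"
  by (rule prob_spaceI)
     (simp add: K_def emeasure_density nn_integral_eq_integral c_integrable c_integral c_nonneg)

lemma integral_K:
  fixes g :: "vec3 \<Rightarrow> 'b::{banach, second_countable_topology}"
  assumes [measurable]: "g \<in> borel_measurable borel"
  shows "(\<integral>\<omega>. g \<omega> \<partial>K u) = (\<integral>\<omega>. c (u \<bullet> \<omega>) *\<^sub>R g \<omega> \<partial>usphere)"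
  unfolding K_def by (rule integral_density) (auto simp: c_nonneg)

lemma integral_K_orthogonal:
  fixes g :: "vec3 \<Rightarrow> 'b::{banach, second_countable_topology}"
  assumes [measurable]: "g \<in> borel_measurable borel" and T: "orthogonal_transformation T"
  shows "(\<integral>\<omega>. g (T \<omega>) \<partial>K u) = (\<integral>\<omega>. g \<omega> \<partial>K (T u))"
proof -
  have [measurable]: "T \<in> borel_measurable borel" using T by (rule orthogonal_transformation_measurable)
  have TT: "T u \<bullet> T \<omega> = u \<bullet> \<omega>" for \<omega> using T by (simp add: orthogonal_transformation_def)
  have "(\<integral>\<omega>. g (T \<omega>) \<partial>K u) = (\<integral>\<omega>. c (T u \<bullet> T \<omega>) *\<^sub>R g (T \<omega>) \<partial>usphere)"
    by (subst integral_K) (auto simp: TT)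
  also have "\<dots> = (\<integral>\<omega>. c (T u \<bullet> \<omega>) *\<^sub>R g \<omega> \<partial>distr usphere borel T)"
    by (subst integral_distr) auto
  also have "\<dots> = (\<integral>\<omega>. g \<omega> \<partial>K (T u))"
    by (simp add: distr_usphere_orthogonal[OF T] integral_K)
  finally show ?thesis .
qed

lemma AE_K:
  assumes u: "norm u = 1"
  shows "AE \<omega> in K u. norm \<omega> = 1 \<and> u \<bullet> \<omega> \<noteq> 0 \<and> \<bar>u \<bullet> \<omega>\<bar> < 1"
proof -
  have "AE \<omega> in usphere. 0 < ennreal (c (u \<bullet> \<omega>)) \<longrightarrow> norm \<omega> = 1 \<and> u \<bullet> \<omega> \<noteq> 0 \<and> \<bar>u \<bullet> \<omega>\<bar> < 1"
    using AE_usphere[OF u]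
  proof eventually_elim
    case (elim \<omega>)
    then show ?case using c_zero[of 0] by (cases "u \<bullet> \<omega> = 0") auto
  qed
  then show ?thesis unfolding K_def by (subst AE_density) auto
qed

lemma integral_K_zonal:
  fixes h :: "real \<Rightarrow> real"
  assumes [measurable]: "h \<in> borel_measurable borel" and "norm u = 1" "norm v = 1"
  shows "(\<integral>\<omega>. h (u \<bullet> \<omega>) \<partial>K u) = (\<integral>\<omega>. h (v \<bullet> \<omega>) \<partial>K v)"
proof -
  let ?T = "reflect (v - u)"
  have Tv: "?T v = u" using assms by (simp add: reflect_diff)
  have Tu: "?T u = v" using assms by (simp add: reflect_diff')
  have "(\<integral>\<omega>. h (v \<bullet> ?T \<omega>) \<partial>K u) = (\<integral>\<omega>. h (v \<bullet> \<omega>) \<partial>K (?T u))"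
    by (rule integral_K_orthogonal) (auto intro: orthogonal_transformation_reflect)
  moreover have "v \<bullet> ?T \<omega> = u \<bullet> \<omega>" for \<omega> by (metis reflect_adjoint Tv)
  ultimately show ?thesis by (simp add: Tu)
qed

lemma integrable_K_bounded:
  fixes g :: "vec3 \<Rightarrow> 'b::{banach, second_countable_topology}"
  assumes "norm u = 1" "g \<in> borel_measurable borel" "\<And>\<omega>. norm \<omega> = 1 \<Longrightarrow> norm (g \<omega>) \<le> B"
  shows "integrable (K u) g"
proof -
  interpret prob_space "K u" using assms(1) by (rule prob_space_K)
  show ?thesis
    using AE_K[OF assms(1)] assms by (intro integrable_const_bound[where B=B]) (auto elim!: eventually_mono)
qed

lemma integral_K_odd:
  assumes [measurable]: "h \<in> borel_measurable borel" and "u \<bullet> v = 0"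
  shows "(\<integral>\<omega>. (v \<bullet> \<omega>) * h (u \<bullet> \<omega>) \<partial>K u) = (0::real)"
proof -
  let ?T = "reflect v"
  have Tu: "?T u = u" using assms by (intro reflect_orthogonal) (simp add: inner_commute)
  have "(\<integral>\<omega>. (v \<bullet> ?T \<omega>) * h (u \<bullet> ?T \<omega>) \<partial>K u) = (\<integral>\<omega>. (v \<bullet> \<omega>) * h (u \<bullet> \<omega>) \<partial>K (?T u))"
    by (rule integral_K_orthogonal) (auto intro: orthogonal_transformation_reflect)
  moreover have "v \<bullet> ?T \<omega> = - (v \<bullet> \<omega>)" "u \<bullet> ?T \<omega> = u \<bullet> \<omega>" for \<omega>
    by (metis reflect_adjoint reflect_self inner_minus_left) (metis reflect_adjoint Tu)
  ultimately show ?thesis by (simp add: Tu)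
qed

lemma integral_K_square:
  assumes h[measurable]: "h \<in> borel_measurable borel" and hB: "\<And>x. \<bar>x\<bar> \<le> 1 \<Longrightarrow> \<bar>h x\<bar> \<le> B"
    and u: "norm u = 1" and uv: "u \<bullet> v = 0"
  shows "(\<integral>\<omega>. (v \<bullet> \<omega>)\<^sup>2 * h (u \<bullet> \<omega>) \<partial>K u) = (norm v)\<^sup>2 / 2 * (\<integral>\<omega>. (1 - (u \<bullet> \<omega>)\<^sup>2) * h (u \<bullet> \<omega>) \<partial>K u)"
proof (cases "v = 0")
  case False
  define e where "e = v /\<^sub>R norm v"
  have e: "norm e = 1" "u \<bullet> e = 0" and v: "v = norm v *\<^sub>R e"
    using False uv by (auto simp: e_def)
  obtain f0 where f0: "f0 \<noteq> 0" "\<And>y. y \<in> span {u, e} \<Longrightarrow> orthogonal f0 y"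
  proof -
    have "dim {u, e} \<le> card {u, e}" by (rule dim_le_card) (auto intro: span_base)
    also have "\<dots> \<le> 2" by (simp add: card_insert_if)
    finally have "dim {u, e} < DIM(vec3)" by simp
    then show ?thesis using orthogonal_to_subspace_exists that by blast
  qed
  define f where "f = f0 /\<^sub>R norm f0"
  have f: "norm f = 1" "u \<bullet> f = 0" "e \<bullet> f = 0"
    using f0(1) f0(2)[OF span_base, of u] f0(2)[OF span_base, of e]
    by (auto simp: f_def orthogonal_def inner_commute)
  have pyth: "(u \<bullet> \<omega>)\<^sup>2 + (e \<bullet> \<omega>)\<^sup>2 + (f \<bullet> \<omega>)\<^sup>2 = (norm \<omega>)\<^sup>2" for \<omega>
  proof -
    have uu: "u \<bullet> u = 1" "e \<bullet> e = 1" "f \<bullet> f = 1" using u e f by (auto simp: norm_eq_1)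
    then have dis: "u \<noteq> e" "u \<noteq> f" "e \<noteq> f" using e f by auto
    have po: "pairwise orthogonal {u, e, f}"
      using e f by (auto simp: pairwise_def orthogonal_def inner_commute)
    have "independent {u, e, f}"
      using po uu by (intro pairwise_orthogonal_independent) auto
    moreover have "card {u, e, f} = DIM(vec3)" using dis by simp
    ultimately have "span {u, e, f} = UNIV"
      by (metis card_ge_dim_independent dim_UNIV order_refl subset_UNIV subset_antisym top.extremum_unique)
    then have "\<omega> \<in> span {u, e, f}" by simp
    then obtain a b d where "\<omega> = a *\<^sub>R u + b *\<^sub>R e + d *\<^sub>R f"
      by (auto simp: span_insert span_singleton algebra_simps eq_diff_eq)
    then show ?thesis
      unfolding power2_norm_eq_inner using uu e f
      by (simp add: inner_simps inner_commute power2_eq_square)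
  qed
  let ?T = "reflect (e - f)"
  have Tu: "?T u = u" using e f by (intro reflect_orthogonal) (simp add: inner_simps inner_commute)
  have Te: "?T e = f" using e f by (simp add: reflect_diff)
  have "(\<integral>\<omega>. (e \<bullet> ?T \<omega>)\<^sup>2 * h (u \<bullet> ?T \<omega>) \<partial>K u) = (\<integral>\<omega>. (e \<bullet> \<omega>)\<^sup>2 * h (u \<bullet> \<omega>) \<partial>K (?T u))"
    by (rule integral_K_orthogonal) (auto intro: orthogonal_transformation_reflect)
  moreover have "e \<bullet> ?T \<omega> = f \<bullet> \<omega>" "u \<bullet> ?T \<omega> = u \<bullet> \<omega>" for \<omega>
    by (metis reflect_adjoint Te) (metis reflect_adjoint Tu)
  ultimately have ef: "(\<integral>\<omega>. (f \<bullet> \<omega>)\<^sup>2 * h (u \<bullet> \<omega>) \<partial>K u) = (\<integral>\<omega>. (e \<bullet> \<omega>)\<^sup>2 * h (u \<bullet> \<omega>) \<partial>K u)"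
    by (simp add: Tu)
  have int: "integrable (K u) (\<lambda>\<omega>. (g \<bullet> \<omega>)\<^sup>2 * h (u \<bullet> \<omega>))" if "norm g = 1" for g
  proof (rule integrable_K_bounded[OF u, where B=B])
    fix \<omega> :: vec3 assume w: "norm \<omega> = 1"
    have "\<bar>g \<bullet> \<omega>\<bar> \<le> 1" "\<bar>u \<bullet> \<omega>\<bar> \<le> 1"
      using Cauchy_Schwarz_ineq2[of g \<omega>] Cauchy_Schwarz_ineq2[of u \<omega>] that u w by auto
    then have "(g \<bullet> \<omega>)\<^sup>2 \<le> 1" "\<bar>h (u \<bullet> \<omega>)\<bar> \<le> B" using hB by (auto simp: abs_square_le_1)
    then have "(g \<bullet> \<omega>)\<^sup>2 * \<bar>h (u \<bullet> \<omega>)\<bar> \<le> 1 * B" by (intro mult_mono) auto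
    then show "norm ((g \<bullet> \<omega>)\<^sup>2 * h (u \<bullet> \<omega>)) \<le> B" by (simp add: abs_mult)
  qed measurable
  have "(\<integral>\<omega>. (1 - (u \<bullet> \<omega>)\<^sup>2) * h (u \<bullet> \<omega>) \<partial>K u)
      = (\<integral>\<omega>. (e \<bullet> \<omega>)\<^sup>2 * h (u \<bullet> \<omega>) + (f \<bullet> \<omega>)\<^sup>2 * h (u \<bullet> \<omega>) \<partial>K u)"
  proof (rule integral_cong_AE)
    show "AE \<omega> in K u. (1 - (u \<bullet> \<omega>)\<^sup>2) * h (u \<bullet> \<omega>) = (e \<bullet> \<omega>)\<^sup>2 * h (u \<bullet> \<omega>) + (f \<bullet> \<omega>)\<^sup>2 * h (u \<bullet> \<omega>)"
      using AE_K[OF u]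
    proof eventually_elim
      case (elim \<omega>)
      then have "1 - (u \<bullet> \<omega>)\<^sup>2 = (e \<bullet> \<omega>)\<^sup>2 + (f \<bullet> \<omega>)\<^sup>2" using pyth[of \<omega>] by simp
      then show ?case by (simp add: distrib_right)
    qed
  qed measurable
  also have "\<dots> = 2 * (\<integral>\<omega>. (e \<bullet> \<omega>)\<^sup>2 * h (u \<bullet> \<omega>) \<partial>K u)"
    by (simp add: int e f ef)
  finally have "(\<integral>\<omega>. (e \<bullet> \<omega>)\<^sup>2 * h (u \<bullet> \<omega>) \<partial>K u) = (\<integral>\<omega>. (1 - (u \<bullet> \<omega>)\<^sup>2) * h (u \<bullet> \<omega>) \<partial>K u) / 2" by simp
  moreover have "(\<integral>\<omega>. (v \<bullet> \<omega>)\<^sup>2 * h (u \<bullet> \<omega>) \<partial>K u) = (norm v)\<^sup>2 * (\<integral>\<omega>. (e \<bullet> \<omega>)\<^sup>2 * h (u \<bullet> \<omega>) \<partial>K u)"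
    by (subst v) (simp add: power_mult_distrib mult.assoc)
  ultimately show ?thesis by simp
qed simp

definition \<kappa> :: real where
  "\<kappa> = (\<integral>\<omega>. (axis 1 1 \<bullet> \<omega>)\<^sup>2 * (1 - (axis 1 1 \<bullet> \<omega>)\<^sup>2) \<partial>K (axis 1 1))"

lemma \<kappa>_eq:
  assumes "norm u = 1"
  shows "(\<integral>\<omega>. (u \<bullet> \<omega>)\<^sup>2 * (1 - (u \<bullet> \<omega>)\<^sup>2) \<partial>K u) = \<kappa>"
  unfolding \<kappa>_def using assms
  by (rule integral_K_zonal[where h="\<lambda>x. x\<^sup>2 * (1 - x\<^sup>2)", rotated]) auto

lemma integrable_K_polynomial:
  assumes "norm u = 1" "continuous_on UNIV (h :: real \<Rightarrow> real)"
  shows "integrable (K u) (\<lambda>\<omega>. h (u \<bullet> \<omega>))"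
proof -
  have "compact (h ` {-1..1})" using assms by (intro compact_continuous_image) (auto intro: continuous_on_subset)
  then obtain B where B: "\<forall>x\<in>{-1..1}. \<bar>h x\<bar> \<le> B"
    by (force dest!: compact_imp_bounded simp: bounded_iff)
  show ?thesis
  proof (rule integrable_K_bounded[OF assms(1), where B=B])
    show "(\<lambda>\<omega>. h (u \<bullet> \<omega>)) \<in> borel_measurable borel"
      using borel_measurable_continuous_onI[OF assms(2)] by measurable
    fix \<omega> :: vec3 assume w: "norm \<omega> = 1"
    then have "\<bar>u \<bullet> \<omega>\<bar> \<le> 1" using Cauchy_Schwarz_ineq2[of u \<omega>] assms by auto
    then show "norm (h (u \<bullet> \<omega>)) \<le> B" using B by (auto simp: abs_le_iff)
  qed
qed

lemma \<kappa>_pos: "\<kappa> > 0"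
proof -
  let ?u = "axis 1 1 :: vec3"
  have u: "norm ?u = 1" by simp
  interpret prob_space "K ?u" using u by (rule prob_space_K)
  have i: "integrable (K ?u) (\<lambda>\<omega>. (?u \<bullet> \<omega>)\<^sup>2 * (1 - (?u \<bullet> \<omega>)\<^sup>2))"
    by (rule integrable_K_polynomial[OF u, where h="\<lambda>x. x\<^sup>2 * (1 - x\<^sup>2)"]) (intro continuous_intros)
  have pos: "AE \<omega> in K ?u. 0 < (?u \<bullet> \<omega>)\<^sup>2 * (1 - (?u \<bullet> \<omega>)\<^sup>2)"
    using AE_K[OF u]
  proof eventually_elim
    case (elim \<omega>)
    then have "(?u \<bullet> \<omega>)\<^sup>2 < 1" by (simp add: abs_square_less_1)
    then show ?case using elim by simp
  qed
  have "\<kappa> \<noteq> 0"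
  proof
    assume "\<kappa> = 0"
    then have "AE \<omega> in K ?u. (?u \<bullet> \<omega>)\<^sup>2 * (1 - (?u \<bullet> \<omega>)\<^sup>2) = 0"
      unfolding \<kappa>_def using pos by (subst (asm) integral_nonneg_eq_0_iff_AE[OF i]) (auto elim!: eventually_mono)
    with pos have "AE \<omega> in K ?u. False" by eventually_elim simp
    then show False by (simp add: AE_False)
  qed
  moreover have "\<kappa> \<ge> 0"
    unfolding \<kappa>_def using pos by (intro integral_nonneg_AE) (auto elim!: eventually_mono)
  ultimately show ?thesis by simp
qed

end

section \<open>The averaging operator on quadratic and quartic functions\<close>

lemma exp_minus_taylor:
  assumes "0 \<le> a" "0 \<le> (b::real)"
  shows "\<bar>exp (- a) - exp (- b) + (a - b) * exp (- b)\<bar> \<le> (a - b)\<^sup>2"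
proof -
  define d where "d = a - b"
  have eq: "exp (- a) - exp (- b) + (a - b) * exp (- b) = exp (- b) * (exp (- d) - 1 + d)"
    by (simp add: d_def algebra_simps flip: exp_add)
  have nn: "exp (- d) - 1 + d \<ge> 0" using exp_ge_add_one_self[of "- d"] by linarith
  have "exp (- b) * (exp (- d) - 1 + d) \<le> d\<^sup>2"
  proof (cases "d \<ge> 0")
    case True
    have "1 + d + d\<^sup>2 / 2 \<le> exp d" using exp_lower_Taylor_quadratic[OF True] .
    moreover have "(1 - d + d\<^sup>2) * (1 + d + d\<^sup>2 / 2) \<ge> 1"
    proof -
      have "(1 - d + d\<^sup>2) * (1 + d + d\<^sup>2 / 2) = 1 + d\<^sup>2 / 2 + d ^ 3 / 2 + d ^ 4 / 2"
        by (simp add: power2_eq_square power3_eq_cube power4_eq_xxxx field_simps)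
      also have "\<dots> \<ge> 1" using True by simp
      finally show ?thesis .
    qed
    moreover have "1 - d + d\<^sup>2 \<ge> 0"
      using sum_power2_ge_zero[of "d - 1 / 2" 0] by (simp add: power2_eq_square algebra_simps)
    ultimately have "(1 - d + d\<^sup>2) * exp d \<ge> 1" by (meson mult_left_mono order_trans)
    then have "exp (- d) - 1 + d \<le> d\<^sup>2" by (simp add: exp_minus field_simps)
    moreover have "exp (- b) * (exp (- d) - 1 + d) \<le> 1 * (exp (- d) - 1 + d)"
      using assms nn by (intro mult_right_mono) auto
    ultimately show ?thesis unfolding mult_1 by (rule order_trans[rotated])
  next
    case False
    have "(1 + d) * (1 - d) \<le> exp d * (1 - d)"
      using False exp_ge_add_one_self[of d] by (intro mult_right_mono) auto
    then have "1 - exp d * (1 - d) \<le> d\<^sup>2" by (simp add: power2_eq_square algebra_simps)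
    moreover have "exp (- b) * (exp (- d) - 1 + d) = exp (- a) * (1 - exp d * (1 - d))"
      by (simp add: d_def algebra_simps flip: exp_add)
    moreover have "1 - exp d * (1 - d) = exp d * (exp (- d) - 1 + d)" by (simp add: algebra_simps flip: exp_add)
    then have "1 - exp d * (1 - d) \<ge> 0" using nn by simp
    then have "exp (- a) * (1 - exp d * (1 - d)) \<le> 1 * (1 - exp d * (1 - d))"
      using assms by (intro mult_right_mono) auto
    ultimately show ?thesis unfolding mult_1 by simp
  qed
  then show ?thesis unfolding eq using nn by (simp add: d_def)
qed

lemma norm_le_of_relaxation:
  fixes y :: "real \<Rightarrow> 'a::real_normed_vector"
  assumes "continuous_on {0..} y" "\<And>t. t > 0 \<Longrightarrow> (y has_vector_derivative (q t - y t)) (at t)"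
    and "continuous_on {0..} B" "\<And>t. t > 0 \<Longrightarrow> (B has_real_derivative B' t) (at t)"
    and q: "\<And>t. t > 0 \<Longrightarrow> norm (q t) \<le> B t + B' t" and 0: "norm (y 0) \<le> B 0" and t: "t \<ge> 0"
  shows "norm (y t) \<le> B t"
proof (cases "t = 0")
  case False
  then have t: "0 < t" using t by simp
  have "norm (exp t *\<^sub>R y t - exp 0 *\<^sub>R y 0) \<le> exp t * B t - exp 0 * B 0"
  proof (rule differentiable_bound_general[OF t, where f' = "\<lambda>s. exp s *\<^sub>R q s" and \<phi>' = "\<lambda>s. exp s * (B s + B' s)"])
    show "continuous_on {0..t} (\<lambda>t. exp t *\<^sub>R y t)" "continuous_on {0..t} (\<lambda>t. exp t * B t)"
      using assms by (auto intro!: continuous_intros intro: continuous_on_subset)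
    fix s assume s: "0 < s" "s < t"
    have "((\<lambda>s. exp s *\<^sub>R y s) has_vector_derivative (exp s *\<^sub>R (q s - y s) + exp s *\<^sub>R y s)) (at s)"
      by (rule has_vector_derivative_scaleR[OF DERIV_exp assms(2)[OF s(1)]])
    then show "((\<lambda>s. exp s *\<^sub>R y s) has_vector_derivative exp s *\<^sub>R q s) (at s)"
      by (simp add: algebra_simps)
    have "((\<lambda>s. exp s * B s) has_real_derivative (exp s * B s + B' s * exp s)) (at s)"
      by (rule DERIV_mult[OF DERIV_exp assms(4)[OF s(1)]])
    then show "((\<lambda>s. exp s * B s) has_vector_derivative exp s * (B s + B' s)) (at s)"
      by (simp add: has_real_derivative_iff_has_vector_derivative algebra_simps)
    show "norm (exp s *\<^sub>R q s) \<le> exp s * (B s + B' s)"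
      using q[OF s(1)] by simp
  qed
  moreover have "norm (exp t *\<^sub>R y t) - norm (y 0) \<le> norm (exp t *\<^sub>R y t - y 0)"
    by (rule norm_triangle_ineq2)
  ultimately have "norm (exp t *\<^sub>R y t) \<le> exp t * B t"
    using 0 by (simp del: norm_scaleR)
  then show ?thesis by simp
qed (use 0 in simp)

definition dir :: "vec3 \<Rightarrow> vec3" where "dir \<xi> = coll_dir 0 \<xi>"

lemma norm_dir [simp]: "norm (dir \<xi>) = 1"
  by (simp add: dir_def coll_dir_def)

lemma dir_eq: "\<xi> = norm \<xi> *\<^sub>R dir \<xi>"
  by (simp add: dir_def coll_dir_def)

definition xi1 :: "vec3 \<Rightarrow> vec3 \<Rightarrow> vec3" where "xi1 \<xi> \<omega> = \<xi> - (\<xi> \<bullet> \<omega>) *\<^sub>R \<omega>"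
definition xi2 :: "vec3 \<Rightarrow> vec3 \<Rightarrow> vec3" where "xi2 \<xi> \<omega> = (\<xi> \<bullet> \<omega>) *\<^sub>R \<omega>"

lemma xi_measurable [measurable]: "xi1 \<xi> \<in> borel_measurable borel" "xi2 \<xi> \<in> borel_measurable borel"
  unfolding xi1_def xi2_def by measurable

lemma norm_xi:
  assumes "norm \<omega> = 1"
  shows "(norm (xi1 \<xi> \<omega>))\<^sup>2 = (norm \<xi>)\<^sup>2 * (1 - (dir \<xi> \<bullet> \<omega>)\<^sup>2)"
    and "(norm (xi2 \<xi> \<omega>))\<^sup>2 = (norm \<xi>)\<^sup>2 * (dir \<xi> \<bullet> \<omega>)\<^sup>2"
proof -
  have w: "\<omega> \<bullet> \<omega> = 1" using assms by (simp add: norm_eq_1)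
  have x: "(\<xi> \<bullet> \<omega>)\<^sup>2 = (norm \<xi>)\<^sup>2 * (dir \<xi> \<bullet> \<omega>)\<^sup>2"
    by (subst dir_eq) (simp add: power_mult_distrib)
  have "(norm (xi1 \<xi> \<omega>))\<^sup>2 = (norm \<xi>)\<^sup>2 - (\<xi> \<bullet> \<omega>)\<^sup>2"
    unfolding power2_norm_eq_inner xi1_def by (simp add: inner_simps w inner_commute power2_eq_square)
  then show "(norm (xi1 \<xi> \<omega>))\<^sup>2 = (norm \<xi>)\<^sup>2 * (1 - (dir \<xi> \<bullet> \<omega>)\<^sup>2)"
    unfolding x by (simp add: algebra_simps)
  show "(norm (xi2 \<xi> \<omega>))\<^sup>2 = (norm \<xi>)\<^sup>2 * (dir \<xi> \<bullet> \<omega>)\<^sup>2"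
    using assms by (simp add: xi2_def power_mult_distrib x)
qed

lemma norm_xi_add: "norm \<omega> = 1 \<Longrightarrow> (norm (xi1 \<xi> \<omega>))\<^sup>2 + (norm (xi2 \<xi> \<omega>))\<^sup>2 = (norm \<xi>)\<^sup>2"
  by (simp add: norm_xi algebra_simps)

context normalized_kernel
begin

lemma integral_K_quartic:
  "integrable (K (dir \<xi>)) (\<lambda>\<omega>. norm (xi1 \<xi> \<omega>) ^ 4 + norm (xi2 \<xi> \<omega>) ^ 4)"
  "(\<integral>\<omega>. norm (xi1 \<xi> \<omega>) ^ 4 + norm (xi2 \<xi> \<omega>) ^ 4 \<partial>K (dir \<xi>)) = (1 - 2 * \<kappa>) * norm \<xi> ^ 4"
proof -
  let ?u = "dir \<xi>"
  interpret prob_space "K ?u" by (rule prob_space_K) simp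
  have ae: "AE \<omega> in K ?u. norm (xi1 \<xi> \<omega>) ^ 4 + norm (xi2 \<xi> \<omega>) ^ 4 = norm \<xi> ^ 4 * (1 - 2 * ((?u \<bullet> \<omega>)\<^sup>2 * (1 - (?u \<bullet> \<omega>)\<^sup>2)))"
    using AE_K[OF norm_dir]
  proof eventually_elim
    case (elim \<omega>)
    have p4: "a ^ 4 = (a\<^sup>2)\<^sup>2" for a :: real by simp
    show ?case unfolding p4 norm_xi[OF conjunct1[OF elim]] by (simp add: power2_eq_square algebra_simps)
  qed
  have i: "integrable (K ?u) (\<lambda>\<omega>. (?u \<bullet> \<omega>)\<^sup>2 * (1 - (?u \<bullet> \<omega>)\<^sup>2))"
    by (rule integrable_K_polynomial[where h="\<lambda>x. x\<^sup>2 * (1 - x\<^sup>2)"]) (auto intro!: continuous_intros)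
  show "integrable (K (dir \<xi>)) (\<lambda>\<omega>. norm (xi1 \<xi> \<omega>) ^ 4 + norm (xi2 \<xi> \<omega>) ^ 4)"
    by (subst integrable_cong_AE[OF _ _ ae]) (auto intro!: integrable_mult_right Bochner_Integration.integrable_diff i)
  have "(\<integral>\<omega>. norm (xi1 \<xi> \<omega>) ^ 4 + norm (xi2 \<xi> \<omega>) ^ 4 \<partial>K ?u)
      = (\<integral>\<omega>. norm \<xi> ^ 4 * (1 - 2 * ((?u \<bullet> \<omega>)\<^sup>2 * (1 - (?u \<bullet> \<omega>)\<^sup>2))) \<partial>K ?u)"
    by (rule integral_cong_AE[OF _ _ ae]) measurable
  also have "\<dots> = norm \<xi> ^ 4 * (1 - 2 * (\<integral>\<omega>. (?u \<bullet> \<omega>)\<^sup>2 * (1 - (?u \<bullet> \<omega>)\<^sup>2) \<partial>K ?u))"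
    using i prob_space by (simp add: Bochner_Integration.integral_diff)
  finally show "(\<integral>\<omega>. norm (xi1 \<xi> \<omega>) ^ 4 + norm (xi2 \<xi> \<omega>) ^ 4 \<partial>K ?u) = (1 - 2 * \<kappa>) * norm \<xi> ^ 4"
    by (simp add: \<kappa>_eq)
qed

lemma integral_K_quadratic:
  "integrable (K (dir \<xi>)) (\<lambda>\<omega>. (norm (xi1 \<xi> \<omega>))\<^sup>2 + (norm (xi2 \<xi> \<omega>))\<^sup>2)"
  "(\<integral>\<omega>. (norm (xi1 \<xi> \<omega>))\<^sup>2 + (norm (xi2 \<xi> \<omega>))\<^sup>2 \<partial>K (dir \<xi>)) = (norm \<xi>)\<^sup>2"
proof -
  interpret prob_space "K (dir \<xi>)" by (rule prob_space_K) simp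
  have ae: "AE \<omega> in K (dir \<xi>). (norm (xi1 \<xi> \<omega>))\<^sup>2 + (norm (xi2 \<xi> \<omega>))\<^sup>2 = (norm \<xi>)\<^sup>2"
    using AE_K[OF norm_dir] by eventually_elim (simp add: norm_xi_add)
  show "integrable (K (dir \<xi>)) (\<lambda>\<omega>. (norm (xi1 \<xi> \<omega>))\<^sup>2 + (norm (xi2 \<xi> \<omega>))\<^sup>2)"
    by (subst integrable_cong_AE[OF _ _ ae]) auto
  have "(\<integral>\<omega>. (norm (xi1 \<xi> \<omega>))\<^sup>2 + (norm (xi2 \<xi> \<omega>))\<^sup>2 \<partial>K (dir \<xi>)) = (\<integral>\<omega>. (norm \<xi>)\<^sup>2 \<partial>K (dir \<xi>))"
    by (rule integral_cong_AE[OF _ _ ae]) auto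
  then show "(\<integral>\<omega>. (norm (xi1 \<xi> \<omega>))\<^sup>2 + (norm (xi2 \<xi> \<omega>))\<^sup>2 \<partial>K (dir \<xi>)) = (norm \<xi>)\<^sup>2"
    using prob_space by simp
qed

lemma integral_K_rank_one:
  "(\<integral>\<omega>. (v \<bullet> xi1 \<xi> \<omega>)\<^sup>2 + (v \<bullet> xi2 \<xi> \<omega>)\<^sup>2 \<partial>K (dir \<xi>))
     = (1 - 3 * \<kappa>) * (v \<bullet> \<xi>)\<^sup>2 + \<kappa> * (norm \<xi>)\<^sup>2 * (norm v)\<^sup>2"
proof -
  define u where "u = dir \<xi>"
  define r where "r = norm \<xi>"
  define a where "a = u \<bullet> v"
  define w where "w = v - a *\<^sub>R u"
  have u: "norm u = 1" "u \<bullet> u = 1" by (simp_all add: u_def flip: norm_eq_1)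
  have uw: "u \<bullet> w = 0" by (simp add: w_def inner_simps u a_def)
  have \<xi>: "\<xi> = r *\<^sub>R u" unfolding r_def u_def by (rule dir_eq)
  have v: "v = a *\<^sub>R u + w" by (simp add: w_def)
  have nv: "(norm v)\<^sup>2 = a\<^sup>2 + (norm w)\<^sup>2"
    unfolding power2_norm_eq_inner by (subst (1 2) v) (simp add: inner_simps u uw inner_commute power2_eq_square)
  interpret prob_space "K u" using u(1) by (rule prob_space_K)
  let ?x = "\<lambda>\<omega>. u \<bullet> \<omega>"
  have pt: "(v \<bullet> xi1 \<xi> \<omega>)\<^sup>2 + (v \<bullet> xi2 \<xi> \<omega>)\<^sup>2 = r\<^sup>2 * (a\<^sup>2 * (1 - 2 * ((?x \<omega>)\<^sup>2 * (1 - (?x \<omega>)\<^sup>2)))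
      + (w \<bullet> \<omega>) * (2 * a * (?x \<omega>) ^ 3 - 2 * a * ?x \<omega> * (1 - (?x \<omega>)\<^sup>2)) + (w \<bullet> \<omega>)\<^sup>2 * (2 * (?x \<omega>)\<^sup>2))" for \<omega>
  proof -
    have 1: "v \<bullet> xi1 \<xi> \<omega> = r * (a - ?x \<omega> * (a * ?x \<omega> + w \<bullet> \<omega>))"
      unfolding xi1_def \<xi> by (subst v) (simp add: inner_simps u uw inner_commute algebra_simps)
    have 2: "v \<bullet> xi2 \<xi> \<omega> = r * (?x \<omega> * (a * ?x \<omega> + w \<bullet> \<omega>))"
      unfolding xi2_def \<xi> by (subst v) (simp add: inner_simps inner_commute algebra_simps)
    show ?thesis unfolding 1 2 by (simp add: power2_eq_square power3_eq_cube algebra_simps)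
  qed
  have i1: "integrable (K u) (\<lambda>\<omega>. (?x \<omega>)\<^sup>2 * (1 - (?x \<omega>)\<^sup>2))"
    by (rule integrable_K_polynomial[OF u(1), where h="\<lambda>x. x\<^sup>2 * (1 - x\<^sup>2)"]) (auto intro!: continuous_intros)
  have cs: "\<bar>?x \<omega>\<bar> \<le> 1" "\<bar>w \<bullet> \<omega>\<bar> \<le> norm w" if "norm \<omega> = 1" for \<omega>
    using Cauchy_Schwarz_ineq2[of u \<omega>] Cauchy_Schwarz_ineq2[of w \<omega>] that u by auto
  have i2: "integrable (K u) (\<lambda>\<omega>. (w \<bullet> \<omega>) * (2 * a * (?x \<omega>) ^ 3 - 2 * a * ?x \<omega> * (1 - (?x \<omega>)\<^sup>2)))"
  proof (rule integrable_K_bounded[OF u(1), where B="norm w * (4 * \<bar>a\<bar>)"])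
    fix \<omega> :: vec3 assume w: "norm \<omega> = 1"
    have x2: "(?x \<omega>)\<^sup>2 \<le> 1" using cs(1)[OF w] by (simp add: abs_square_le_1)
    have "2 * a * (?x \<omega>) ^ 3 - 2 * a * ?x \<omega> * (1 - (?x \<omega>)\<^sup>2) = 2 * a * (?x \<omega> * (2 * (?x \<omega>)\<^sup>2 - 1))"
      by (simp add: power2_eq_square power3_eq_cube algebra_simps)
    then have "\<bar>2 * a * (?x \<omega>) ^ 3 - 2 * a * ?x \<omega> * (1 - (?x \<omega>)\<^sup>2)\<bar> = 2 * \<bar>a\<bar> * (\<bar>?x \<omega>\<bar> * \<bar>2 * (?x \<omega>)\<^sup>2 - 1\<bar>)"
      by (simp add: abs_mult)
    also have "\<dots> \<le> 2 * \<bar>a\<bar> * (1 * 1)"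
      using cs(1)[OF w] x2 zero_le_power2[of "?x \<omega>"]
      by (intro mult_mono mult_left_mono) (auto simp: abs_le_iff simp del: zero_le_power2)
    finally have "\<bar>2 * a * (?x \<omega>) ^ 3 - 2 * a * ?x \<omega> * (1 - (?x \<omega>)\<^sup>2)\<bar> \<le> 4 * \<bar>a\<bar>" by simp
    then show "norm ((w \<bullet> \<omega>) * (2 * a * (?x \<omega>) ^ 3 - 2 * a * ?x \<omega> * (1 - (?x \<omega>)\<^sup>2))) \<le> norm w * (4 * \<bar>a\<bar>)"
      using cs(2)[OF w] unfolding real_norm_def abs_mult[of "w \<bullet> \<omega>"] by (intro mult_mono) auto
  qed measurable
  have i3: "integrable (K u) (\<lambda>\<omega>. (w \<bullet> \<omega>)\<^sup>2 * (2 * (?x \<omega>)\<^sup>2))"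
  proof (rule integrable_K_bounded[OF u(1), where B="(norm w)\<^sup>2 * 2"])
    fix \<omega> :: vec3 assume w: "norm \<omega> = 1"
    have "(?x \<omega>)\<^sup>2 \<le> 1" "(w \<bullet> \<omega>)\<^sup>2 \<le> (norm w)\<^sup>2"
      using cs[OF w] by (auto simp: abs_square_le_1 abs_le_square_iff[symmetric])
    then show "norm ((w \<bullet> \<omega>)\<^sup>2 * (2 * (?x \<omega>)\<^sup>2)) \<le> (norm w)\<^sup>2 * 2"
      unfolding real_norm_def abs_mult by (intro mult_mono) auto
  qed measurable
  have "(\<integral>\<omega>. (v \<bullet> xi1 \<xi> \<omega>)\<^sup>2 + (v \<bullet> xi2 \<xi> \<omega>)\<^sup>2 \<partial>K u) = r\<^sup>2 * (a\<^sup>2 * (1 - 2 * (\<integral>\<omega>. (?x \<omega>)\<^sup>2 * (1 - (?x \<omega>)\<^sup>2) \<partial>K u))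
      + (\<integral>\<omega>. (w \<bullet> \<omega>) * (2 * a * (?x \<omega>) ^ 3 - 2 * a * ?x \<omega> * (1 - (?x \<omega>)\<^sup>2)) \<partial>K u)
      + (\<integral>\<omega>. (w \<bullet> \<omega>)\<^sup>2 * (2 * (?x \<omega>)\<^sup>2) \<partial>K u))"
    unfolding pt using i1 i2 i3 prob_space by simp
  also have "(\<integral>\<omega>. (w \<bullet> \<omega>) * (2 * a * (?x \<omega>) ^ 3 - 2 * a * ?x \<omega> * (1 - (?x \<omega>)\<^sup>2)) \<partial>K u) = 0"
    using integral_K_odd[OF _ uw, of "\<lambda>x. 2 * a * x ^ 3 - 2 * a * x * (1 - x\<^sup>2)"] by simp
  also have "(\<integral>\<omega>. (w \<bullet> \<omega>)\<^sup>2 * (2 * (?x \<omega>)\<^sup>2) \<partial>K u) = (norm w)\<^sup>2 / 2 * (\<integral>\<omega>. (1 - (?x \<omega>)\<^sup>2) * (2 * (?x \<omega>)\<^sup>2) \<partial>K u)"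
    by (rule integral_K_square[OF _ _ u(1) uw, where h="\<lambda>x. 2 * x\<^sup>2" and B=2]) (auto simp: abs_square_le_1)
  also have "(\<integral>\<omega>. (1 - (?x \<omega>)\<^sup>2) * (2 * (?x \<omega>)\<^sup>2) \<partial>K u) = 2 * (\<integral>\<omega>. (?x \<omega>)\<^sup>2 * (1 - (?x \<omega>)\<^sup>2) \<partial>K u)"
    by (simp add: mult.commute mult.left_commute flip: Bochner_Integration.integral_mult_right_zero)
  also have "(\<integral>\<omega>. (?x \<omega>)\<^sup>2 * (1 - (?x \<omega>)\<^sup>2) \<partial>K u) = \<kappa>" by (rule \<kappa>_eq[OF u(1)])
  finally have "(\<integral>\<omega>. (v \<bullet> xi1 \<xi> \<omega>)\<^sup>2 + (v \<bullet> xi2 \<xi> \<omega>)\<^sup>2 \<partial>K u)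
     = r\<^sup>2 * (a\<^sup>2 * (1 - 2 * \<kappa>) + (norm w)\<^sup>2 * \<kappa>)" by simp
  moreover have "v \<bullet> \<xi> = r * a" by (simp add: \<xi> a_def inner_commute)
  moreover have "(norm w)\<^sup>2 = (norm v)\<^sup>2 - a\<^sup>2" using nv by simp
  ultimately show ?thesis
    unfolding u_def[symmetric] r_def[symmetric] by (simp add: power_mult_distrib algebra_simps)
qed

end

section \<open>Comparison with Gaussian profiles\<close>

text \<open>Replaces Gronwall's inequality for \<open>sup\<^sub>\<xi> X \<xi> t\<close>, whose measurability in \<open>t\<close> is not available.\<close>

lemma le_of_factorial_iteration:
  fixes X B :: "'x \<Rightarrow> real \<Rightarrow> real"
  assumes X: "\<And>\<xi> t. t \<ge> 0 \<Longrightarrow> X \<xi> t \<le> 2" and B: "\<And>\<xi> t. 0 \<le> B \<xi> t"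
    and step: "\<And>n \<xi> t. (\<And>\<xi> t. t \<ge> 0 \<Longrightarrow> X \<xi> t \<le> B \<xi> t + 2 * ((2 * t) ^ n / fact n)) \<Longrightarrow> t \<ge> 0 \<Longrightarrow>
       X \<xi> t \<le> B \<xi> t + 2 * ((2 * t) ^ Suc n / fact (Suc n))"
    and t: "t \<ge> 0"
  shows "X \<xi> t \<le> B \<xi> t"
proof -
  have "X \<xi> t \<le> B \<xi> t + 2 * ((2 * t) ^ n / fact n)" if "t \<ge> 0" for n \<xi> t
    using that
  proof (induction n arbitrary: \<xi> t)
    case 0
    then show ?case using X[of t \<xi>] B[of \<xi> t] by simp
  next
    case (Suc n)
    then show ?case by (intro step) auto
  qed
  then have "X \<xi> t \<le> B \<xi> t + 2 * ((2 * t) ^ n / fact n)" for n using t by blast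
  moreover have "(\<lambda>n. (2 * t) ^ n / fact n) \<longlonglongrightarrow> 0"
    using summable_LIMSEQ_zero[OF summable_exp[of "2 * t"]] by (simp add: divide_inverse mult.commute)
  then have "(\<lambda>n. B \<xi> t + 2 * ((2 * t) ^ n / fact n)) \<longlonglongrightarrow> B \<xi> t + 2 * 0"
    by (intro tendsto_intros)
  then have "(\<lambda>n. B \<xi> t + 2 * ((2 * t) ^ n / fact n)) \<longlonglongrightarrow> B \<xi> t" by simp
  ultimately show ?thesis by (meson LIMSEQ_le_const)
qed

context normalized_kernel
begin

definition gain :: "(vec3 \<Rightarrow> 'b::{banach,second_countable_topology,real_normed_algebra}) \<Rightarrow> vec3 \<Rightarrow> 'b" where
  "gain f \<xi> = (\<integral>\<omega>. f (xi1 \<xi> \<omega>) * f (xi2 \<xi> \<omega>) \<partial>K (dir \<xi>))"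

definition fourier_solution :: "(vec3 \<Rightarrow> real \<Rightarrow> complex) \<Rightarrow> bool" where
  "fourier_solution f \<longleftrightarrow>
     (\<forall>t\<ge>0. (\<lambda>\<xi>. f \<xi> t) \<in> borel_measurable borel) \<and> (\<forall>\<xi>. \<forall>t\<ge>0. cmod (f \<xi> t) \<le> 1) \<and>
     (\<forall>\<xi>. continuous_on {0..} (f \<xi>)) \<and>
     (\<forall>\<xi>. \<forall>t>0. (f \<xi> has_vector_derivative gain (\<lambda>\<zeta>. f \<zeta> t) \<xi> - f \<xi> t) (at t))"

lemma integrable_gain:
  fixes f :: "vec3 \<Rightarrow> 'b::{banach,second_countable_topology,real_normed_algebra}"
  assumes [measurable]: "f \<in> borel_measurable borel" and f: "\<And>\<xi>. norm (f \<xi>) \<le> 1"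
  shows "integrable (K (dir \<xi>)) (\<lambda>\<omega>. f (xi1 \<xi> \<omega>) * f (xi2 \<xi> \<omega>))"
proof (rule integrable_K_bounded[OF norm_dir, where B=1])
  fix \<omega>
  have "norm (f (xi1 \<xi> \<omega>) * f (xi2 \<xi> \<omega>)) \<le> norm (f (xi1 \<xi> \<omega>)) * norm (f (xi2 \<xi> \<omega>))"
    by (rule norm_mult_ineq)
  also have "\<dots> \<le> 1 * 1" by (intro mult_mono f) auto
  finally show "norm (f (xi1 \<xi> \<omega>) * f (xi2 \<xi> \<omega>)) \<le> 1" by simp
qed measurable

definition quadratic_profile :: "(vec3 \<Rightarrow> real) \<Rightarrow> real \<Rightarrow> bool" where
  "quadratic_profile p s \<longleftrightarrow> p \<in> borel_measurable borel \<and>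
    (\<forall>\<xi>. 0 \<le> p \<xi> \<and> p \<xi> \<le> 3 * s * (norm \<xi>)\<^sup>2) \<and>
    (\<forall>\<xi>. (\<integral>\<omega>. p (xi1 \<xi> \<omega>) + p (xi2 \<xi> \<omega>) \<partial>K (dir \<xi>)) = (1 - 3 * \<kappa>) * p \<xi> + 3 * \<kappa> * s * (norm \<xi>)\<^sup>2)"

lemma quadratic_profile_second_moment:
  fixes g :: "'m \<Rightarrow> vec3"
  assumes "prob_space M" and g[measurable]: "g \<in> borel_measurable M" and int: "integrable M (\<lambda>x. (norm (g x))\<^sup>2)"
  shows "quadratic_profile (\<lambda>\<xi>. \<integral>x. (g x \<bullet> \<xi>)\<^sup>2 \<partial>M) ((\<integral>x. (norm (g x))\<^sup>2 \<partial>M) / 3)"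
proof -
  interpret M: prob_space M by fact
  define E where "E = (\<integral>x. (norm (g x))\<^sup>2 \<partial>M)"
  have E0: "E \<ge> 0" unfolding E_def by simp
  have cs: "(g x \<bullet> \<xi>)\<^sup>2 \<le> (norm (g x))\<^sup>2 * (norm \<xi>)\<^sup>2" for x \<xi>
    using Cauchy_Schwarz_ineq[of "g x" \<xi>] by (simp add: power2_norm_eq_inner)
  have i: "integrable M (\<lambda>x. (g x \<bullet> \<xi>)\<^sup>2)" for \<xi>
    by (rule Bochner_Integration.integrable_bound[OF integrable_mult_left[OF int, of "(norm \<xi>)\<^sup>2"]]) (auto simp: cs)
  define p where "p \<xi> = (\<integral>x. (g x \<bullet> \<xi>)\<^sup>2 \<partial>M)" for \<xi>
  have pm[measurable]: "p \<in> borel_measurable borel" unfolding p_def by measurable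
  have p0: "0 \<le> p \<xi>" for \<xi> unfolding p_def by simp
  have pE: "p \<xi> \<le> E * (norm \<xi>)\<^sup>2" for \<xi>
  proof -
    have "p \<xi> \<le> (\<integral>x. (norm (g x))\<^sup>2 * (norm \<xi>)\<^sup>2 \<partial>M)"
      unfolding p_def by (rule integral_mono[OF i integrable_mult_left[OF int]]) (rule cs)
    then show ?thesis by (simp add: E_def)
  qed
  have "(\<integral>\<omega>. p (xi1 \<xi> \<omega>) + p (xi2 \<xi> \<omega>) \<partial>K (dir \<xi>)) = (1 - 3 * \<kappa>) * p \<xi> + \<kappa> * E * (norm \<xi>)\<^sup>2" for \<xi>
  proof -
    interpret K: prob_space "K (dir \<xi>)" by (rule prob_space_K) simp
    interpret P: pair_sigma_finite "K (dir \<xi>)" M ..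
    let ?F = "\<lambda>\<omega> x. (g x \<bullet> xi1 \<xi> \<omega>)\<^sup>2 + (g x \<bullet> xi2 \<xi> \<omega>)\<^sup>2"
    have "(\<integral>\<omega>. p (xi1 \<xi> \<omega>) + p (xi2 \<xi> \<omega>) \<partial>K (dir \<xi>)) = (\<integral>\<omega>. \<integral>x. ?F \<omega> x \<partial>M \<partial>K (dir \<xi>))"
      unfolding p_def by (simp add: i)
    also have "\<dots> = (\<integral>x. \<integral>\<omega>. ?F \<omega> x \<partial>K (dir \<xi>) \<partial>M)"
    proof (rule P.Fubini_integral[symmetric], rule P.Fubini_integrable)
      show "integrable (K (dir \<xi>)) (\<lambda>\<omega>. \<integral>x. norm (case (\<omega>, x) of (\<omega>, x) \<Rightarrow> ?F \<omega> x) \<partial>M)"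
      proof (rule integrable_K_bounded[OF norm_dir, where B="E * (norm \<xi>)\<^sup>2"])
        fix \<omega> :: vec3 assume w: "norm \<omega> = 1"
        have "(\<integral>x. ?F \<omega> x \<partial>M) = p (xi1 \<xi> \<omega>) + p (xi2 \<xi> \<omega>)" by (simp add: p_def i)
        also have "\<dots> \<le> E * (norm (xi1 \<xi> \<omega>))\<^sup>2 + E * (norm (xi2 \<xi> \<omega>))\<^sup>2" by (intro add_mono pE)
        also have "\<dots> = E * (norm \<xi>)\<^sup>2" by (simp add: norm_xi_add[OF w] flip: distrib_left)
        finally show "norm (\<integral>x. norm (case (\<omega>, x) of (\<omega>, x) \<Rightarrow> ?F \<omega> x) \<partial>M) \<le> E * (norm \<xi>)\<^sup>2"
          by (simp add: p_def i)
      qed measurable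
      show "AE \<omega> in K (dir \<xi>). integrable M (\<lambda>x. case (\<omega>, x) of (\<omega>, x) \<Rightarrow> ?F \<omega> x)"
        by (simp add: i)
    qed (unfold xi1_def xi2_def, measurable)
    also have "\<dots> = (\<integral>x. (1 - 3 * \<kappa>) * (g x \<bullet> \<xi>)\<^sup>2 + \<kappa> * (norm \<xi>)\<^sup>2 * (norm (g x))\<^sup>2 \<partial>M)"
      by (simp add: integral_K_rank_one)
    also have "\<dots> = (1 - 3 * \<kappa>) * p \<xi> + \<kappa> * E * (norm \<xi>)\<^sup>2"
      using i int by (simp add: p_def E_def)
    finally show ?thesis .
  qed
  then show ?thesis
    unfolding quadratic_profile_def E_def[symmetric] p_def[symmetric] using pm p0 pE by simp
qed

definition barrier :: "real \<Rightarrow> real \<Rightarrow> vec3 \<Rightarrow> real \<Rightarrow> real" where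
  "barrier \<epsilon> C \<xi> t = \<epsilon> * (norm \<xi>)\<^sup>2 + C * exp (- \<kappa> * t) * norm \<xi> ^ 4"

lemma barrier_measurable [measurable]: "(\<lambda>\<xi>. barrier \<epsilon> C \<xi> t) \<in> borel_measurable borel"
  unfolding barrier_def by measurable

lemma barrier_avg:
  shows "integrable (K (dir \<xi>)) (\<lambda>\<omega>. (barrier \<epsilon> C (xi1 \<xi> \<omega>) t + a) + (barrier \<epsilon> C (xi2 \<xi> \<omega>) t + a))"
    and "(\<integral>\<omega>. (barrier \<epsilon> C (xi1 \<xi> \<omega>) t + a) + (barrier \<epsilon> C (xi2 \<xi> \<omega>) t + a) \<partial>K (dir \<xi>))
      = \<epsilon> * (norm \<xi>)\<^sup>2 + (1 - 2 * \<kappa>) * (C * exp (- \<kappa> * t) * norm \<xi> ^ 4) + 2 * a"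
proof -
  interpret prob_space "K (dir \<xi>)" by (rule prob_space_K) simp
  have eq: "(barrier \<epsilon> C (xi1 \<xi> \<omega>) t + a) + (barrier \<epsilon> C (xi2 \<xi> \<omega>) t + a)
      = \<epsilon> * ((norm (xi1 \<xi> \<omega>))\<^sup>2 + (norm (xi2 \<xi> \<omega>))\<^sup>2)
        + (C * exp (- \<kappa> * t)) * (norm (xi1 \<xi> \<omega>) ^ 4 + norm (xi2 \<xi> \<omega>) ^ 4) + 2 * a" for \<omega>
    by (simp add: barrier_def algebra_simps)
  show "integrable (K (dir \<xi>)) (\<lambda>\<omega>. (barrier \<epsilon> C (xi1 \<xi> \<omega>) t + a) + (barrier \<epsilon> C (xi2 \<xi> \<omega>) t + a))"
    unfolding eq by (intro Bochner_Integration.integrable_add integrable_mult_right integral_K_quadratic integral_K_quartic) simp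
  have "(\<integral>\<omega>. (barrier \<epsilon> C (xi1 \<xi> \<omega>) t + a) + (barrier \<epsilon> C (xi2 \<xi> \<omega>) t + a) \<partial>K (dir \<xi>))
    = \<epsilon> * (\<integral>\<omega>. (norm (xi1 \<xi> \<omega>))\<^sup>2 + (norm (xi2 \<xi> \<omega>))\<^sup>2 \<partial>K (dir \<xi>))
        + (C * exp (- \<kappa> * t)) * (\<integral>\<omega>. norm (xi1 \<xi> \<omega>) ^ 4 + norm (xi2 \<xi> \<omega>) ^ 4 \<partial>K (dir \<xi>)) + 2 * a"
    unfolding eq
    by (subst Bochner_Integration.integral_add,
        (intro Bochner_Integration.integrable_add integrable_mult_right integral_K_quadratic integral_K_quartic; simp),
        simp, subst Bochner_Integration.integral_add,
        (intro integrable_mult_right integral_K_quadratic integral_K_quartic)+)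
       (simp only: Bochner_Integration.integral_mult_right_zero, simp add: prob_space[unfolded space_K])
  then show "(\<integral>\<omega>. (barrier \<epsilon> C (xi1 \<xi> \<omega>) t + a) + (barrier \<epsilon> C (xi2 \<xi> \<omega>) t + a) \<partial>K (dir \<xi>))
      = \<epsilon> * (norm \<xi>)\<^sup>2 + (1 - 2 * \<kappa>) * (C * exp (- \<kappa> * t) * norm \<xi> ^ 4) + 2 * a"
    unfolding integral_K_quadratic integral_K_quartic by simp
qed

lemma barrier_supersolution:
  assumes C: "9 / 4 * s\<^sup>2 \<le> \<kappa> * C"
  shows "(\<integral>\<omega>. (barrier \<epsilon> C (xi1 \<xi> \<omega>) t + a) + (barrier \<epsilon> C (xi2 \<xi> \<omega>) t + a) \<partial>K (dir \<xi>))
      + 9 / 4 * s\<^sup>2 * exp (- \<kappa> * t) * norm \<xi> ^ 4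
    \<le> barrier \<epsilon> C \<xi> t + (- \<kappa> * C * exp (- \<kappa> * t) * norm \<xi> ^ 4 + 2 * a)"
proof -
  have "9 / 4 * s\<^sup>2 * (exp (- \<kappa> * t) * norm \<xi> ^ 4) \<le> \<kappa> * C * (exp (- \<kappa> * t) * norm \<xi> ^ 4)"
    using C by (intro mult_right_mono) auto
  then show ?thesis unfolding barrier_avg by (simp add: barrier_def algebra_simps)
qed

lemma barrier_deriv:
  "((\<lambda>t. barrier \<epsilon> C \<xi> t + 2 * ((2 * t) ^ Suc n / fact (Suc n))) has_real_derivative
     (- \<kappa> * C * exp (- \<kappa> * t) * norm \<xi> ^ 4 + 2 * (2 * ((2 * t) ^ n / fact n)))) (at t)"
proof -
  have "((\<lambda>t. (2 * t) ^ Suc n / fact (Suc n)) has_real_derivative (real (Suc n) * (2 * t) ^ n * 2 / fact (Suc n))) (at t)"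
    by (rule derivative_eq_intros refl | simp)+
  moreover have "real (Suc n) * (2 * t) ^ n * 2 / fact (Suc n) = 2 * ((2 * t) ^ n / fact n)"
    by (simp add: fact_Suc del: of_nat_Suc)
  ultimately have 1: "((\<lambda>t. (2 * t) ^ Suc n / fact (Suc n)) has_real_derivative 2 * ((2 * t) ^ n / fact n)) (at t)"
    by metis
  have "((\<lambda>t. barrier \<epsilon> C \<xi> t) has_real_derivative (- \<kappa> * C * exp (- \<kappa> * t) * norm \<xi> ^ 4)) (at t)"
    unfolding barrier_def by (auto intro!: derivative_eq_intros)
  from DERIV_add[OF this DERIV_cmult[OF 1, of 2]] show ?thesis .
qed

lemma barrier_continuous:
  "continuous_on A (\<lambda>t. barrier \<epsilon> C \<xi> t + 2 * ((2 * t) ^ Suc n / fact (Suc n)))"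
  unfolding barrier_def by (intro continuous_intros) auto

context
  fixes p :: "vec3 \<Rightarrow> real" and s :: real
  assumes p: "quadratic_profile p s"
begin

definition pt :: "vec3 \<Rightarrow> real \<Rightarrow> real" where
  "pt \<xi> t = exp (- 3 * \<kappa> * t) * p \<xi> + (1 - exp (- 3 * \<kappa> * t)) * (s * (norm \<xi>)\<^sup>2)"

definition N :: "vec3 \<Rightarrow> real \<Rightarrow> real" where
  "N \<xi> t = exp (- (pt \<xi> t / 2))"

definition N' :: "vec3 \<Rightarrow> real \<Rightarrow> real" where
  "N' \<xi> t = 3 * \<kappa> / 2 * exp (- 3 * \<kappa> * t) * (p \<xi> - s * (norm \<xi>)\<^sup>2) * N \<xi> t"

lemma p_facts:
  shows p_measurable [measurable]: "p \<in> borel_measurable borel"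
    and p_nonneg: "0 \<le> p \<xi>" and p_le: "p \<xi> \<le> 3 * s * (norm \<xi>)\<^sup>2"
    and p_avg: "(\<integral>\<omega>. p (xi1 \<xi> \<omega>) + p (xi2 \<xi> \<omega>) \<partial>K (dir \<xi>)) = (1 - 3 * \<kappa>) * p \<xi> + 3 * \<kappa> * s * (norm \<xi>)\<^sup>2"
  using p unfolding quadratic_profile_def by auto

lemma s_nonneg: "s \<ge> 0"
proof -
  have "0 \<le> 3 * s * (norm (axis 1 1 :: vec3))\<^sup>2"
    using p_nonneg p_le order_trans by blast
  then show ?thesis by simp
qed

lemma pt_measurable [measurable]: "(\<lambda>\<xi>. pt \<xi> t) \<in> borel_measurable borel"
  unfolding pt_def by measurable

lemma N_measurable [measurable]: "(\<lambda>\<xi>. N \<xi> t) \<in> borel_measurable borel"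
  unfolding N_def by measurable

lemma pt_nonneg: "t \<ge> 0 \<Longrightarrow> pt \<xi> t \<ge> 0"
  unfolding pt_def using p_nonneg s_nonneg \<kappa>_pos by (intro add_nonneg_nonneg mult_nonneg_nonneg) auto

lemma N_pos: "0 < N \<xi> t" by (simp add: N_def)

lemma N_le_1: "t \<ge> 0 \<Longrightarrow> N \<xi> t \<le> 1"
  using pt_nonneg by (simp add: N_def)

lemma N_deriv: "(N \<xi> has_real_derivative N' \<xi> t) (at t)"
  unfolding N_def[abs_def] N'_def pt_def by (auto intro!: derivative_eq_intros simp: field_simps)

lemma N_continuous: "continuous_on A (N \<xi>)"
  using N_deriv by (intro DERIV_atLeastAtMost_imp_continuous_on[THEN continuous_on_subset] continuous_at_imp_continuous_on ballI)
     (blast intro: DERIV_isCont)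

lemma N_residual:
  assumes t: "t \<ge> 0"
  shows "\<bar>gain (\<lambda>\<zeta>. N \<zeta> t) \<xi> - N \<xi> t - N' \<xi> t\<bar> \<le> 9 / 4 * s\<^sup>2 * exp (- \<kappa> * t) * norm \<xi> ^ 4"
proof -
  interpret prob_space "K (dir \<xi>)" by (rule prob_space_K) simp
  define E where "E = exp (- 3 * \<kappa> * t)"
  define r where "r = 3 * s * (norm \<xi>)\<^sup>2"
  let ?q = "\<lambda>\<omega>. pt (xi1 \<xi> \<omega>) t + pt (xi2 \<xi> \<omega>) t"
  let ?g = "\<lambda>\<omega>. p (xi1 \<xi> \<omega>) + p (xi2 \<xi> \<omega>)"
  have pr: "0 \<le> ?g \<omega>" "?g \<omega> \<le> r" if "norm \<omega> = 1" for \<omega>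
  proof -
    show "0 \<le> ?g \<omega>" by (simp add: p_nonneg)
    have "?g \<omega> \<le> 3 * s * (norm (xi1 \<xi> \<omega>))\<^sup>2 + 3 * s * (norm (xi2 \<xi> \<omega>))\<^sup>2" by (intro add_mono p_le)
    also have "\<dots> = r" by (simp add: r_def norm_xi_add[OF that] flip: distrib_left)
    finally show "?g \<omega> \<le> r" .
  qed
  have qp: "?q \<omega> - pt \<xi> t = E * (?g \<omega> - p \<xi>)" if "norm \<omega> = 1" for \<omega>
  proof -
    have "?q \<omega> = E * ?g \<omega> + (1 - E) * (s * ((norm (xi1 \<xi> \<omega>))\<^sup>2 + (norm (xi2 \<xi> \<omega>))\<^sup>2))"
      by (simp add: pt_def E_def algebra_simps)
    then show ?thesis unfolding norm_xi_add[OF that] by (simp add: pt_def E_def algebra_simps)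
  qed
  have ig: "integrable (K (dir \<xi>)) ?g"
    by (rule integrable_K_bounded[OF norm_dir, where B=r]) (use pr in auto)
  have iN: "integrable (K (dir \<xi>)) (\<lambda>\<omega>. N (xi1 \<xi> \<omega>) t * N (xi2 \<xi> \<omega>) t)"
    by (rule integrable_gain) (use N_le_1[OF t] N_pos in \<open>auto simp: less_imp_le\<close>)
  let ?h = "\<lambda>\<omega>. N (xi1 \<xi> \<omega>) t * N (xi2 \<xi> \<omega>) t - N \<xi> t + E * (?g \<omega> - p \<xi>) / 2 * N \<xi> t"
  have avg: "(\<integral>\<omega>. ?g \<omega> \<partial>K (dir \<xi>)) - p \<xi> = 3 * \<kappa> * (s * (norm \<xi>)\<^sup>2 - p \<xi>)"
    unfolding p_avg by (simp add: algebra_simps)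
  have "(\<integral>\<omega>. ?h \<omega> \<partial>K (dir \<xi>)) = gain (\<lambda>\<zeta>. N \<zeta> t) \<xi> - N \<xi> t + E * ((\<integral>\<omega>. ?g \<omega> \<partial>K (dir \<xi>)) - p \<xi>) / 2 * N \<xi> t"
    unfolding gain_def using ig iN prob_space by (simp add: Bochner_Integration.integral_diff)
  also have "\<dots> = gain (\<lambda>\<zeta>. N \<zeta> t) \<xi> - N \<xi> t - N' \<xi> t"
    unfolding avg by (simp add: N'_def E_def field_simps)
  finally have eq: "gain (\<lambda>\<zeta>. N \<zeta> t) \<xi> - N \<xi> t - N' \<xi> t = (\<integral>\<omega>. ?h \<omega> \<partial>K (dir \<xi>))" ..
  have "AE \<omega> in K (dir \<xi>). \<bar>?h \<omega>\<bar> \<le> (E * r / 2)\<^sup>2"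
    using AE_K[OF norm_dir]
  proof eventually_elim
    case (elim \<omega>)
    then have w: "norm \<omega> = 1" by simp
    have e1: "N (xi1 \<xi> \<omega>) t * N (xi2 \<xi> \<omega>) t = exp (- (?q \<omega> / 2))"
      unfolding N_def by (simp add: add_divide_distrib flip: exp_add)
    have e2: "E * (?g \<omega> - p \<xi>) / 2 = ?q \<omega> / 2 - pt \<xi> t / 2"
      by (simp only: qp[OF w, symmetric] diff_divide_distrib)
    have e3: "N \<xi> t = exp (- (pt \<xi> t / 2))" by (rule N_def)
    have "\<bar>?h \<omega>\<bar> \<le> (?q \<omega> / 2 - pt \<xi> t / 2)\<^sup>2"
      unfolding e1 e2 e3 by (rule exp_minus_taylor) (use pt_nonneg[OF t] in auto)
    also have "\<dots> = (E * (?g \<omega> - p \<xi>) / 2)\<^sup>2" by (simp only: qp[OF w, symmetric] diff_divide_distrib)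
    also have "\<dots> \<le> (E * r / 2)\<^sup>2"
    proof -
      have "\<bar>?g \<omega> - p \<xi>\<bar> \<le> r" using pr[OF w] p_nonneg[of \<xi>] p_le[of \<xi>] unfolding r_def by linarith
      then have "\<bar>E * (?g \<omega> - p \<xi>) / 2\<bar> \<le> E * r / 2" by (simp add: abs_mult E_def)
      then show ?thesis by (metis abs_ge_zero power2_abs power_mono)
    qed
    finally show ?case .
  qed
  then have "\<bar>\<integral>\<omega>. ?h \<omega> \<partial>K (dir \<xi>)\<bar> \<le> (\<integral>\<omega>. (E * r / 2)\<^sup>2 \<partial>K (dir \<xi>))"
    using integral_norm_bound[of "K (dir \<xi>)" ?h] ig iN
    by (intro order_trans[OF integral_abs_bound] integral_mono_AE) auto
  also have "\<dots> = (E * r / 2)\<^sup>2" using prob_space by simp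
  also have "\<dots> = 9 / 4 * s\<^sup>2 * (exp (- \<kappa> * t)) ^ 6 * norm \<xi> ^ 4"
  proof -
    have "E\<^sup>2 = (exp (- \<kappa> * t)) ^ 6" unfolding E_def by (simp add: exp_of_nat_mult[symmetric])
    then show ?thesis by (simp add: r_def power_mult_distrib power_divide flip: power_mult)
  qed
  also have "\<dots> \<le> 9 / 4 * s\<^sup>2 * exp (- \<kappa> * t) * norm \<xi> ^ 4"
  proof -
    have "(exp (- \<kappa> * t)) ^ 6 \<le> (exp (- \<kappa> * t)) ^ 1"
      using t \<kappa>_pos by (intro power_decreasing) auto
    then show ?thesis by (intro mult_right_mono mult_left_mono) auto
  qed
  finally show ?thesis unfolding eq .
qed

context
  fixes f :: "vec3 \<Rightarrow> real \<Rightarrow> complex" and \<epsilon> C :: real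
  assumes f: "fourier_solution f" and \<epsilon>: "\<epsilon> \<ge> 0" and C: "C \<ge> 0" "9 / 4 * s\<^sup>2 \<le> \<kappa> * C"
begin

lemma f_facts:
  shows f_measurable: "t \<ge> 0 \<Longrightarrow> (\<lambda>\<xi>. f \<xi> t) \<in> borel_measurable borel"
    and f_le_1: "t \<ge> 0 \<Longrightarrow> cmod (f \<xi> t) \<le> 1"
    and f_continuous: "continuous_on {0..} (f \<xi>)"
    and f_deriv: "t > 0 \<Longrightarrow> (f \<xi> has_vector_derivative gain (\<lambda>\<zeta>. f \<zeta> t) \<xi> - f \<xi> t) (at t)"
  using f unfolding fourier_solution_def by auto

lemma integrable_N_gain: "t \<ge> 0 \<Longrightarrow> integrable (K (dir \<xi>)) (\<lambda>\<omega>. N (xi1 \<xi> \<omega>) t * N (xi2 \<xi> \<omega>) t)"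
  by (rule integrable_gain) (use N_le_1 N_pos in \<open>auto simp: less_imp_le\<close>)

lemma two_sided_comparison:
  assumes init: "\<And>\<xi>. cmod (f \<xi> 0 - N \<xi> 0) \<le> barrier \<epsilon> C \<xi> 0" and t: "t \<ge> 0"
  shows "cmod (f \<xi> t - N \<xi> t) \<le> barrier \<epsilon> C \<xi> t"
proof (rule le_of_factorial_iteration[OF _ _ _ t, where X="\<lambda>\<xi> t. cmod (f \<xi> t - N \<xi> t)"])
  show "cmod (f \<xi> t - N \<xi> t) \<le> 2" if "t \<ge> 0" for \<xi> t
    using norm_triangle_ineq4[of "f \<xi> t" "complex_of_real (N \<xi> t)"] f_le_1[OF that, of \<xi>] N_le_1[OF that, of \<xi>] N_pos[of \<xi> t]
    by simp
  show "0 \<le> barrier \<epsilon> C \<xi> t" for \<xi> t using \<epsilon> C by (simp add: barrier_def)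
  fix n \<xi> and t :: real
  assume IH: "\<And>\<xi> t. t \<ge> 0 \<Longrightarrow> cmod (f \<xi> t - N \<xi> t) \<le> barrier \<epsilon> C \<xi> t + 2 * ((2 * t) ^ n / fact n)" and t: "t \<ge> 0"
  show "cmod (f \<xi> t - N \<xi> t) \<le> barrier \<epsilon> C \<xi> t + 2 * ((2 * t) ^ Suc n / fact (Suc n))"
  proof (rule norm_le_of_relaxation[where q="\<lambda>t. gain (\<lambda>\<zeta>. f \<zeta> t) \<xi> - of_real (N \<xi> t) - of_real (N' \<xi> t)", OF _ _ barrier_continuous barrier_deriv _ _ t])
    show "continuous_on {0..} (\<lambda>t. f \<xi> t - complex_of_real (N \<xi> t))"
      by (intro continuous_intros f_continuous N_continuous)
    show "cmod (f \<xi> 0 - N \<xi> 0) \<le> barrier \<epsilon> C \<xi> 0 + 2 * ((2 * 0) ^ Suc n / fact (Suc n))"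
      using init by simp
    fix t :: real assume t: "t > 0"
    then have t0: "t \<ge> 0" by simp
    have "((\<lambda>t. complex_of_real (N \<xi> t)) has_vector_derivative of_real (N' \<xi> t)) (at t)"
      by (rule has_vector_derivative_of_real[OF N_deriv])
    from has_vector_derivative_diff[OF f_deriv[OF t] this]
    show "((\<lambda>t. f \<xi> t - complex_of_real (N \<xi> t)) has_vector_derivative
        gain (\<lambda>\<zeta>. f \<zeta> t) \<xi> - of_real (N \<xi> t) - of_real (N' \<xi> t) - (f \<xi> t - of_real (N \<xi> t))) (at t)"
      by (simp add: algebra_simps)
    define a where "a = 2 * ((2 * t) ^ n / fact n)"
    let ?L = "\<integral>\<omega>. (barrier \<epsilon> C (xi1 \<xi> \<omega>) t + a) + (barrier \<epsilon> C (xi2 \<xi> \<omega>) t + a) \<partial>K (dir \<xi>)"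
    let ?Qf = "gain (\<lambda>\<zeta>. f \<zeta> t) \<xi>" and ?QN = "gain (\<lambda>\<zeta>. N \<zeta> t) \<xi>"
    have [measurable]: "(\<lambda>\<xi>. f \<xi> t) \<in> borel_measurable borel" using f_measurable[OF t0] .
    have fi: "integrable (K (dir \<xi>)) (\<lambda>\<omega>. f (xi1 \<xi> \<omega>) t * f (xi2 \<xi> \<omega>) t)"
      by (rule integrable_gain) (use f_le_1[OF t0] in auto)
    have diff: "?Qf - complex_of_real (?QN)
       = (\<integral>\<omega>. f (xi1 \<xi> \<omega>) t * f (xi2 \<xi> \<omega>) t - complex_of_real (N (xi1 \<xi> \<omega>) t * N (xi2 \<xi> \<omega>) t) \<partial>K (dir \<xi>))"
      unfolding gain_def using fi integrable_N_gain[OF t0, of \<xi>]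
      by (subst Bochner_Integration.integral_diff) (auto simp del: of_real_mult)
    have 1: "cmod (?Qf - complex_of_real (?QN)) \<le> ?L"
      unfolding diff
    proof (rule Bochner_Integration.integral_norm_bound_integral[OF _ barrier_avg(1)])
      show "integrable (K (dir \<xi>)) (\<lambda>\<omega>. f (xi1 \<xi> \<omega>) t * f (xi2 \<xi> \<omega>) t - complex_of_real (N (xi1 \<xi> \<omega>) t * N (xi2 \<xi> \<omega>) t))"
        using fi integrable_N_gain[OF t0, of \<xi>] by (intro Bochner_Integration.integrable_diff integrable_of_real)
      fix \<omega>
      let ?a = "xi1 \<xi> \<omega>" and ?b = "xi2 \<xi> \<omega>"
      have eq: "f ?a t * f ?b t - complex_of_real (N ?a t * N ?b t)
         = (f ?a t - N ?a t) * f ?b t + N ?a t * (f ?b t - N ?b t)" by (simp add: algebra_simps)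
      have "cmod (f ?a t * f ?b t - complex_of_real (N ?a t * N ?b t))
         \<le> cmod (f ?a t - N ?a t) * cmod (f ?b t) + N ?a t * cmod (f ?b t - N ?b t)"
        unfolding eq using N_pos[of ?a t] by (intro order_trans[OF norm_triangle_ineq]) (simp add: norm_mult)
      also have "\<dots> \<le> cmod (f ?a t - N ?a t) * 1 + 1 * cmod (f ?b t - N ?b t)"
        using f_le_1[OF t0] N_le_1[OF t0] by (intro add_mono mult_left_mono mult_right_mono) auto
      also have "\<dots> \<le> (barrier \<epsilon> C ?a t + a) + (barrier \<epsilon> C ?b t + a)"
        unfolding mult_1 mult_1_right a_def by (rule add_mono[OF IH[OF t0] IH[OF t0]])
      finally show "cmod (f ?a t * f ?b t - complex_of_real (N ?a t * N ?b t)) \<le> (barrier \<epsilon> C ?a t + a) + (barrier \<epsilon> C ?b t + a)" .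
    qed
    have split: "?Qf - of_real (N \<xi> t) - of_real (N' \<xi> t)
       = (?Qf - complex_of_real (?QN)) + of_real (?QN - N \<xi> t - N' \<xi> t)"
      by simp
    have "cmod (?Qf - of_real (N \<xi> t) - of_real (N' \<xi> t))
       \<le> cmod (?Qf - complex_of_real (?QN)) + \<bar>?QN - N \<xi> t - N' \<xi> t\<bar>"
      unfolding split by (rule order_trans[OF norm_triangle_ineq]) (simp only: norm_of_real order_refl)
    also have "\<dots> \<le> ?L + 9 / 4 * s\<^sup>2 * exp (- \<kappa> * t) * norm \<xi> ^ 4"
      by (intro add_mono 1 N_residual[OF t0])
    also have "\<dots> \<le> barrier \<epsilon> C \<xi> t + (- \<kappa> * C * exp (- \<kappa> * t) * norm \<xi> ^ 4 + 2 * a)"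
      by (rule barrier_supersolution[OF C(2)])
    also have "\<dots> \<le> barrier \<epsilon> C \<xi> t + 2 * ((2 * t) ^ Suc n / fact (Suc n)) + (- \<kappa> * C * exp (- \<kappa> * t) * norm \<xi> ^ 4 + 2 * a)"
      using t by simp
    finally show "cmod (?Qf - of_real (N \<xi> t) - of_real (N' \<xi> t))
       \<le> barrier \<epsilon> C \<xi> t + 2 * ((2 * t) ^ Suc n / fact (Suc n)) + (- \<kappa> * C * exp (- \<kappa> * t) * norm \<xi> ^ 4 + 2 * (2 * ((2 * t) ^ n / fact n)))"
      unfolding a_def .
  qed
qed

lemma one_sided_comparison:
  assumes init: "\<And>\<xi>. cmod (f \<xi> 0) \<le> N \<xi> 0 + barrier \<epsilon> C \<xi> 0" and t: "t \<ge> 0"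
  shows "cmod (f \<xi> t) \<le> N \<xi> t + barrier \<epsilon> C \<xi> t"
proof -
  have "cmod (f \<xi> t) - N \<xi> t \<le> barrier \<epsilon> C \<xi> t"
  proof (rule le_of_factorial_iteration[OF _ _ _ t, where X="\<lambda>\<xi> t. cmod (f \<xi> t) - N \<xi> t"])
    show "cmod (f \<xi> t) - N \<xi> t \<le> 2" if "t \<ge> 0" for \<xi> t
      using f_le_1[OF that, of \<xi>] N_pos[of \<xi> t] by simp
    show "0 \<le> barrier \<epsilon> C \<xi> t" for \<xi> t using \<epsilon> C by (simp add: barrier_def)
    fix n \<xi> and t :: real
    assume IH: "\<And>\<xi> t. t \<ge> 0 \<Longrightarrow> cmod (f \<xi> t) - N \<xi> t \<le> barrier \<epsilon> C \<xi> t + 2 * ((2 * t) ^ n / fact n)" and t: "t \<ge> 0"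
    have "cmod (f \<xi> t) \<le> N \<xi> t + (barrier \<epsilon> C \<xi> t + 2 * ((2 * t) ^ Suc n / fact (Suc n)))"
    proof (rule norm_le_of_relaxation[where q="\<lambda>t. gain (\<lambda>\<zeta>. f \<zeta> t) \<xi>", OF f_continuous f_deriv
          continuous_on_add[OF N_continuous barrier_continuous] DERIV_add[OF N_deriv barrier_deriv] _ _ t])
      show "cmod (f \<xi> 0) \<le> N \<xi> 0 + (barrier \<epsilon> C \<xi> 0 + 2 * ((2 * 0) ^ Suc n / fact (Suc n)))"
        using init by simp
      fix t :: real assume t: "t > 0"
      then have t0: "t \<ge> 0" by simp
      define a where "a = 2 * ((2 * t) ^ n / fact n)"
    let ?L = "\<integral>\<omega>. (barrier \<epsilon> C (xi1 \<xi> \<omega>) t + a) + (barrier \<epsilon> C (xi2 \<xi> \<omega>) t + a) \<partial>K (dir \<xi>)"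
    let ?Qf = "gain (\<lambda>\<zeta>. f \<zeta> t) \<xi>" and ?QN = "gain (\<lambda>\<zeta>. N \<zeta> t) \<xi>"
      have [measurable]: "(\<lambda>\<xi>. f \<xi> t) \<in> borel_measurable borel" using f_measurable[OF t0] .
      have fi: "integrable (K (dir \<xi>)) (\<lambda>\<omega>. f (xi1 \<xi> \<omega>) t * f (xi2 \<xi> \<omega>) t)"
        by (rule integrable_gain) (use f_le_1[OF t0] in auto)
      have "cmod (?Qf) \<le> (\<integral>\<omega>. N (xi1 \<xi> \<omega>) t * N (xi2 \<xi> \<omega>) t
         + ((barrier \<epsilon> C (xi1 \<xi> \<omega>) t + a) + (barrier \<epsilon> C (xi2 \<xi> \<omega>) t + a)) \<partial>K (dir \<xi>))"
        unfolding gain_def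
      proof (rule Bochner_Integration.integral_norm_bound_integral[OF fi Bochner_Integration.integrable_add[OF integrable_N_gain[OF t0] barrier_avg(1)]])
        fix \<omega>
        let ?a = "xi1 \<xi> \<omega>" and ?b = "xi2 \<xi> \<omega>"
        let ?A = "barrier \<epsilon> C ?a t + a" and ?B = "barrier \<epsilon> C ?b t + a"
        have nn: "0 \<le> ?A" "0 \<le> ?B" using \<epsilon> C t by (auto simp: barrier_def a_def)
        have "cmod (f ?a t * f ?b t) = cmod (f ?a t) * cmod (f ?b t)" by (rule norm_mult)
        also have "\<dots> = N ?a t * N ?b t + ((cmod (f ?a t) - N ?a t) * cmod (f ?b t) + N ?a t * (cmod (f ?b t) - N ?b t))"
          by (simp add: algebra_simps)
        also have "(cmod (f ?a t) - N ?a t) * cmod (f ?b t) \<le> ?A * cmod (f ?b t)"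
          using IH[OF t0, of ?a] unfolding a_def by (intro mult_right_mono) auto
        also have "\<dots> \<le> ?A * 1" using nn f_le_1[OF t0] by (intro mult_left_mono) auto
        also have "N ?a t * (cmod (f ?b t) - N ?b t) \<le> N ?a t * ?B"
          using IH[OF t0, of ?b] N_pos[of ?a t] unfolding a_def by (intro mult_left_mono) auto
        also have "\<dots> \<le> 1 * ?B" using nn N_le_1[OF t0] by (intro mult_right_mono) auto
        finally show "cmod (f ?a t * f ?b t) \<le> N ?a t * N ?b t + (?A + ?B)" by simp
      qed
      also have "\<dots> = ?QN + ?L"
        unfolding gain_def by (rule Bochner_Integration.integral_add[OF integrable_N_gain[OF t0] barrier_avg(1)])
      also have "\<dots> \<le> N \<xi> t + N' \<xi> t + 9 / 4 * s\<^sup>2 * exp (- \<kappa> * t) * norm \<xi> ^ 4 + ?L"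
        using N_residual[OF t0, of \<xi>] by (intro add_right_mono) linarith
      also have "\<dots> \<le> N \<xi> t + N' \<xi> t + (barrier \<epsilon> C \<xi> t + (- \<kappa> * C * exp (- \<kappa> * t) * norm \<xi> ^ 4 + 2 * a))"
        using barrier_supersolution[OF C(2), where \<epsilon>=\<epsilon> and \<xi>=\<xi> and t=t and a=a] by linarith
      also have "\<dots> \<le> N \<xi> t + (barrier \<epsilon> C \<xi> t + 2 * ((2 * t) ^ Suc n / fact (Suc n))) + (N' \<xi> t + (- \<kappa> * C * exp (- \<kappa> * t) * norm \<xi> ^ 4 + 2 * a))"
        using t by simp
      finally show "cmod (?Qf) \<le> N \<xi> t + (barrier \<epsilon> C \<xi> t + 2 * ((2 * t) ^ Suc n / fact (Suc n)))
         + (N' \<xi> t + (- \<kappa> * C * exp (- \<kappa> * t) * norm \<xi> ^ 4 + 2 * (2 * ((2 * t) ^ n / fact n))))"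
        unfolding a_def .
    qed
    then show "cmod (f \<xi> t) - N \<xi> t \<le> barrier \<epsilon> C \<xi> t + 2 * ((2 * t) ^ Suc n / fact (Suc n))" by simp
  qed
  then show ?thesis by simp
qed

end

end

end

section \<open>From the weak formulation to the Bobylev equation\<close>

lemma tendsto_integral_of_setwise:
  fixes M :: "'i \<Rightarrow> 'a measure" and g :: "'a \<Rightarrow> real"
  assumes M: "\<forall>\<^sub>F i in F. prob_space (M i) \<and> sets (M i) = sets N" and N: "prob_space N"
    and lim: "\<And>A. A \<in> sets N \<Longrightarrow> ((\<lambda>i. measure (M i) A) \<longlongrightarrow> measure N A) F"
    and g[measurable]: "g \<in> borel_measurable N" and B: "\<And>x. \<bar>g x\<bar> \<le> B"
  shows "((\<lambda>i. \<integral>x. g x \<partial>M i) \<longlongrightarrow> (\<integral>x. g x \<partial>N)) F"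
proof (rule tendstoI)
  fix e :: real assume e: "e > 0"
  interpret N: prob_space N by fact
  obtain k :: nat where k: "4 / e < real k" using reals_Archimedean2 by blast
  then have k0: "real k > 0" using e by (smt (verit) divide_pos_pos)
  define m where "m = \<lceil>real k * B\<rceil> + 1"
  define A where "A j = {x \<in> space N. \<lfloor>real k * g x\<rfloor> = j}" for j :: int
  define h where "h x = (\<Sum>j\<in>{-m..m}. (of_int j / real k) * indicator (A j) x)" for x
  have A[measurable]: "A j \<in> sets N" for j unfolding A_def by measurable
  have hg: "\<bar>h x - g x\<bar> \<le> e / 4" if x: "x \<in> space N" for x
  proof -
    have "\<bar>real k * g x\<bar> \<le> real k * B" using B[of x] k0 by (simp add: abs_mult)
    then have in_m: "\<lfloor>real k * g x\<rfloor> \<in> {-m..m}" unfolding m_def by (auto simp: abs_le_iff) linarith+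
    have "h x = (\<Sum>j\<in>{-m..m}. if j = \<lfloor>real k * g x\<rfloor> then of_int j / real k else 0)"
      unfolding h_def using x by (intro sum.cong) (auto simp: A_def)
    also have "\<dots> = of_int \<lfloor>real k * g x\<rfloor> / real k" using in_m by (simp add: sum.delta)
    finally have "h x - g x = (of_int \<lfloor>real k * g x\<rfloor> - real k * g x) / real k"
      using k0 by (simp add: diff_divide_distrib)
    moreover have "\<bar>of_int \<lfloor>real k * g x\<rfloor> - real k * g x\<bar> \<le> 1" by linarith
    ultimately have "\<bar>h x - g x\<bar> \<le> 1 / real k" using k0 by (simp add: divide_right_mono)
    also have "\<dots> \<le> e / 4" using k k0 e by (simp add: field_simps)
    finally show ?thesis .
  qed
  have hint: "(\<integral>x. h x \<partial>L) = (\<Sum>j\<in>{-m..m}. (of_int j / real k) * measure L (A j))"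
    and hclose: "\<bar>(\<integral>x. h x \<partial>L) - (\<integral>x. g x \<partial>L)\<bar> \<le> e / 4"
    if L: "prob_space L" "sets L = sets N" for L
  proof -
    interpret L: prob_space L by fact
    note [measurable_cong] = L(2)
    have sp: "space L = space N" using L(2) by (rule sets_eq_imp_space_eq)
    have AL: "A j \<in> sets L" for j using A L(2) by simp
    have iA: "integrable L (indicator (A j) :: _ \<Rightarrow> real)" for j
      using AL by (intro integrable_real_indicator) (auto simp: L.emeasure_finite less_top[symmetric])
    show "(\<integral>x. h x \<partial>L) = (\<Sum>j\<in>{-m..m}. (of_int j / real k) * measure L (A j))"
      unfolding h_def using iA AL
      by (subst Bochner_Integration.integral_sum) (auto simp: Int_absorb2 sets.sets_into_space)
    have ih: "integrable L h" unfolding h_def[abs_def]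
      by (intro Bochner_Integration.integrable_sum integrable_mult_right iA)
    have ig: "integrable L g" by (rule L.integrable_const_bound[where B=B]) (auto simp: B)
    have "\<bar>\<integral>x. h x - g x \<partial>L\<bar> \<le> (\<integral>x. \<bar>h x - g x\<bar> \<partial>L)" by (rule integral_abs_bound)
    also have "\<dots> \<le> (\<integral>x. e / 4 \<partial>L)" using ih ig hg by (intro integral_mono) (auto simp: sp)
    finally show "\<bar>(\<integral>x. h x \<partial>L) - (\<integral>x. g x \<partial>L)\<bar> \<le> e / 4"
      using ih ig L.prob_space by simp
  qed
  have "((\<lambda>i. \<Sum>j\<in>{-m..m}. (of_int j / real k) * measure (M i) (A j)) \<longlongrightarrow> (\<Sum>j\<in>{-m..m}. (of_int j / real k) * measure N (A j))) F"
    by (intro tendsto_sum tendsto_mult_left lim A)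
  then have "\<forall>\<^sub>F i in F. dist (\<Sum>j\<in>{-m..m}. (of_int j / real k) * measure (M i) (A j)) (\<Sum>j\<in>{-m..m}. (of_int j / real k) * measure N (A j)) < e / 4"
    using e by (intro tendstoD) auto
  with M show "\<forall>\<^sub>F i in F. dist (\<integral>x. g x \<partial>M i) (\<integral>x. g x \<partial>N) < e"
  proof eventually_elim
    case (elim i)
    from elim(2) have "dist (\<integral>x. h x \<partial>M i) (\<integral>x. h x \<partial>N) < e / 4"
      using elim(1) N by (simp only: hint)
    moreover have "\<bar>(\<integral>x. h x \<partial>M i) - (\<integral>x. g x \<partial>M i)\<bar> \<le> e / 4" "\<bar>(\<integral>x. h x \<partial>N) - (\<integral>x. g x \<partial>N)\<bar> \<le> e / 4"
      by (rule hclose; use elim(1) N in simp)+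
    ultimately show ?case using e unfolding dist_real_def by linarith
  qed
qed

lemma measure_diff_le_tv_dist:
  assumes "is_prob_borel M" "is_prob_borel N" "A \<in> sets borel"
  shows "\<bar>measure M A - measure N A\<bar> \<le> tv_dist M N"
proof -
  interpret M: prob_space M using assms(1) by (simp add: is_prob_borel_def)
  interpret N: prob_space N using assms(2) by (simp add: is_prob_borel_def)
  have "\<bar>measure M B - measure N B\<bar> \<le> 1" for B
    using M.prob_le_1[of B] N.prob_le_1[of B] measure_nonneg[of M B] measure_nonneg[of N B] by linarith
  then have "bdd_above ((\<lambda>B. \<bar>measure M B - measure N B\<bar>) ` sets borel)" by (intro bdd_aboveI[of _ 1]) auto
  then show ?thesis unfolding tv_dist_def tv_norm_def using assms(3) by (intro cSUP_upper) auto
qed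

lemma measure_solution_continuous:
  fixes g :: "vec3 \<Rightarrow> real"
  assumes sol: "measure_solution b \<mu>0 \<mu>" and t: "t \<ge> 0"
    and g: "g \<in> borel_measurable borel" "\<And>x. \<bar>g x\<bar> \<le> B"
  shows "((\<lambda>s. \<integral>x. g x \<partial>\<mu> s) \<longlongrightarrow> (\<integral>x. g x \<partial>\<mu> t)) (at t within {0..})"
proof (rule tendsto_integral_of_setwise)
  have P: "is_prob_borel (\<mu> s)" if "s \<ge> 0" for s using sol that by (simp add: measure_solution_def)
  have ev: "\<forall>\<^sub>F s in at t within {0..}. s \<ge> 0" by (simp add: eventually_at_filter)
  then show "\<forall>\<^sub>F s in at t within {0..}. prob_space (\<mu> s) \<and> sets (\<mu> s) = sets (\<mu> t)"
    using P t by (auto elim!: eventually_mono simp: is_prob_borel_def)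
  show "prob_space (\<mu> t)" "g \<in> borel_measurable (\<mu> t)"
    using P[OF t] g measurable_cong_sets[of "\<mu> t" borel] by (auto simp: is_prob_borel_def)
  show "\<bar>g x\<bar> \<le> B" for x by fact
  fix A assume "A \<in> sets (\<mu> t)"
  then have A: "A \<in> sets borel" using P[OF t] by (simp add: is_prob_borel_def)
  have "((\<lambda>s. tv_dist (\<mu> s) (\<mu> t)) \<longlongrightarrow> 0) (at t within {0..})"
    using sol t by (simp add: measure_solution_def)
  then have "((\<lambda>s. measure (\<mu> s) A - measure (\<mu> t) A) \<longlongrightarrow> 0) (at t within {0..})"
    by (rule Lim_null_comparison[rotated])
       (use ev measure_diff_le_tv_dist[OF P P[OF t] A] in \<open>auto elim!: eventually_mono\<close>)
  then show "((\<lambda>s. measure (\<mu> s) A) \<longlongrightarrow> measure (\<mu> t) A) (at t within {0..})"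
    by (simp add: LIM_zero_iff)
qed

lemma char_eq_cos_sin:
  fixes \<xi> :: vec3
  assumes M: "is_prob_borel M"
  shows "(\<integral>x. iexp (\<xi> \<bullet> x) \<partial>M) = of_real (\<integral>x. cos (\<xi> \<bullet> x) \<partial>M) + \<i> * of_real (\<integral>x. sin (\<xi> \<bullet> x) \<partial>M)"
proof -
  interpret prob_space M using M by (simp add: is_prob_borel_def)
  have [measurable_cong]: "sets M = sets borel" using M by (simp add: is_prob_borel_def)
  have i: "integrable M (\<lambda>x. iexp (\<xi> \<bullet> x))" by (rule integrable_const_bound[where B=1]) auto
  show ?thesis
    using integral_Re[OF i] integral_Im[OF i] by (simp add: complex_eq_iff Re_exp Im_exp)
qed

lemma integral_usphere_zonal:
  fixes b :: "real \<Rightarrow> real"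
  assumes [measurable]: "b \<in> borel_measurable borel" and "norm u = 1" "norm v = 1"
  shows "(\<integral>\<omega>. b (u \<bullet> \<omega>) \<partial>usphere) = (\<integral>\<omega>. b (v \<bullet> \<omega>) \<partial>usphere)"
proof -
  let ?T = "reflect (u - v)"
  have T: "orthogonal_transformation ?T" by (rule orthogonal_transformation_reflect)
  have [measurable]: "?T \<in> borel_measurable borel" using T by (rule orthogonal_transformation_measurable)
  have Tu: "?T u = v" using assms by (simp add: reflect_diff)
  have "(\<integral>\<omega>. b (u \<bullet> \<omega>) \<partial>usphere) = (\<integral>\<omega>. b (u \<bullet> \<omega>) \<partial>distr usphere borel ?T)"
    by (simp add: distr_usphere_orthogonal[OF T])
  also have "\<dots> = (\<integral>\<omega>. b (u \<bullet> ?T \<omega>) \<partial>usphere)" by (subst integral_distr) auto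
  also have "\<dots> = (\<integral>\<omega>. b (v \<bullet> \<omega>) \<partial>usphere)"
    by (simp add: Tu flip: reflect_adjoint)
  finally show ?thesis .
qed

lemma norm_coll_dir [simp]: "norm (coll_dir v w) = 1"
  by (simp add: coll_dir_def)

lemma coll_dir_eq: "w - v = norm (w - v) *\<^sub>R coll_dir v w"
  by (simp add: coll_dir_def)

definition cut_kernel :: "(real \<Rightarrow> real) \<Rightarrow> real \<Rightarrow> real" where
  "cut_kernel b x = (if \<bar>x\<bar> < 1 then b x else 0)"

text \<open>Testing the weak equation with the constant 1 forces the angular integral of b to be 1;
  if b were not Borel outside (-1,1), that Bochner integral would take the junk value 0.\<close>

lemma measure_solution_kernel:
  assumes b: "angular_kernel b" and sol: "measure_solution b \<mu>0 \<mu>"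
  shows "b \<in> borel_measurable borel" and "normalized_kernel (cut_kernel b)"
proof -
  have P: "prob_space (\<mu> t)" if "t \<ge> 0" for t
    using sol that by (simp add: measure_solution_def is_prob_borel_def)
  interpret prob_space "\<mu> 1" by (rule P) simp
  let ?W = "\<lambda>u. \<integral>\<omega>. b (u \<bullet> \<omega>) \<partial>usphere"
  have "((\<lambda>s. \<integral>x. 1 \<partial>\<mu> s) has_real_derivative
      (\<integral>v. \<integral>w. \<integral>\<omega>. 1 * b (coll_dir v w \<bullet> \<omega>) \<partial>usphere \<partial>\<mu> 1 \<partial>\<mu> 1) - (\<integral>x. 1 \<partial>\<mu> 1)) (at 1)"
    using sol unfolding measure_solution_def
    by (elim conjE allE[of _ "\<lambda>_. 1"] allE[of _ 1]) (auto simp: bounded_continuous_def)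
  then have d1: "((\<lambda>s. \<integral>x. 1 \<partial>\<mu> s) has_real_derivative (\<integral>v. \<integral>w. ?W (coll_dir v w) \<partial>\<mu> 1 \<partial>\<mu> 1) - 1) (at 1)"
    using prob_space by simp
  have d2: "((\<lambda>s. \<integral>x. 1 \<partial>\<mu> s) has_real_derivative 0) (at 1)"
  proof (rule DERIV_cong_ev[THEN iffD1, OF refl _ refl DERIV_const])
    have "\<forall>\<^sub>F s in nhds 1. (s::real) \<in> {0<..}" by (rule eventually_nhds_in_open) auto
    then show "\<forall>\<^sub>F s in nhds 1. (1::real) = (\<integral>x. 1 \<partial>\<mu> s)"
    proof eventually_elim
      case (elim s)
      then show ?case using prob_space.prob_space[OF P[of s]] by simp
    qed
  qed
  have W: "(\<integral>v. \<integral>w. ?W (coll_dir v w) \<partial>\<mu> 1 \<partial>\<mu> 1) = 1"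
    using DERIV_unique[OF d1 d2] by simp
  obtain u where u: "norm u = 1" "?W u \<noteq> 0"
  proof (rule ccontr)
    assume "\<not> thesis"
    then have "?W (coll_dir v w) = 0" for v w using that norm_coll_dir by blast
    with W show False by simp
  qed
  have "(\<lambda>\<omega>. b (u \<bullet> \<omega>)) \<in> borel_measurable usphere"
    using u(2) not_integrable_integral_eq borel_measurable_integrable by blast
  then have "(\<lambda>\<omega>. b (u \<bullet> \<omega>)) \<in> borel_measurable borel" by simp
  then have "(\<lambda>s. b (u \<bullet> (s *\<^sub>R u))) \<in> borel_measurable borel" by measurable
  moreover have "u \<bullet> u = 1" using u by (simp add: norm_eq_1)
  ultimately show bm[measurable]: "b \<in> borel_measurable borel" by simp
  have "?W u = (\<integral>v. \<integral>w. ?W (coll_dir v w) \<partial>\<mu> 1 \<partial>\<mu> 1)"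
    using integral_usphere_zonal[OF bm norm_coll_dir u(1)] prob_space by simp
  with W have W1: "?W u = 1" by simp
  show "normalized_kernel (cut_kernel b)"
  proof
    show "cut_kernel b \<in> borel_measurable borel" unfolding cut_kernel_def[abs_def] by measurable
    show "0 \<le> cut_kernel b x" for x
    proof -
      have "0 \<le> b x" if "\<bar>x\<bar> < 1"
      proof -
        have "x \<in> {-1<..<1}" using that by (auto simp: abs_less_iff)
        with b show ?thesis unfolding angular_kernel_def by blast
      qed
      then show ?thesis by (simp add: cut_kernel_def)
    qed
    have "(0::real) \<in> {-1<..<1}" by simp
    then have "b 0 = b (sqrt (1 - 0\<^sup>2)) * \<bar>0\<bar> / sqrt (1 - 0\<^sup>2)"
      using b unfolding angular_kernel_def by blast
    then have "b 0 = 0" by simp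
    then show "cut_kernel b x = 0" if "x = 0 \<or> 1 \<le> \<bar>x\<bar>" for x using that by (auto simp: cut_kernel_def)
    show "(\<integral>\<omega>. cut_kernel b (v \<bullet> \<omega>) \<partial>usphere) = 1" if v: "norm v = 1" for v
    proof -
      have "(\<integral>\<omega>. cut_kernel b (v \<bullet> \<omega>) \<partial>usphere) = ?W v"
      proof (rule integral_cong_AE)
        show "AE \<omega> in usphere. cut_kernel b (v \<bullet> \<omega>) = b (v \<bullet> \<omega>)"
          using AE_usphere[OF v] by eventually_elim (simp add: cut_kernel_def)
      qed (unfold cut_kernel_def, measurable)
      then show ?thesis using integral_usphere_zonal[OF bm v u(1)] W1 by simp
    qed
  qed
qed

context normalized_kernel
begin

lemma bobylev_pointwise:
  "(\<integral>\<omega>. iexp (\<xi> \<bullet> post_vel v w \<omega>) \<partial>K (coll_dir v w)) = (\<integral>\<omega>. iexp (v \<bullet> xi1 \<xi> \<omega>) * iexp (w \<bullet> xi2 \<xi> \<omega>) \<partial>K (dir \<xi>))"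
proof -
  define u where "u = coll_dir v w"
  define e where "e = dir \<xi>"
  let ?T = "reflect (u - e)"
  let ?g = "\<lambda>\<omega>. iexp (\<xi> \<bullet> v + ((w - v) \<bullet> \<omega>) * (\<xi> \<bullet> \<omega>))"
  have n: "norm u = 1" "norm e = 1" by (simp_all add: u_def e_def)
  have Tu: "?T u = e" "?T e = u" using n by (simp_all add: reflect_diff reflect_diff')
  have wv: "w - v = norm (w - v) *\<^sub>R u" unfolding u_def by (rule coll_dir_eq)
  have xe: "\<xi> = norm \<xi> *\<^sub>R e" unfolding e_def by (rule dir_eq)
  have "((w - v) \<bullet> ?T \<omega>) * (\<xi> \<bullet> ?T \<omega>) = ((w - v) \<bullet> \<omega>) * (\<xi> \<bullet> \<omega>)" for \<omega>
  proof -
    have T: "u \<bullet> ?T \<omega> = e \<bullet> \<omega>" "e \<bullet> ?T \<omega> = u \<bullet> \<omega>" by (metis reflect_adjoint Tu)+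
    have "(w - v) \<bullet> ?T \<omega> = norm (w - v) * (e \<bullet> \<omega>)" by (subst wv) (simp add: T)
    moreover have "\<xi> \<bullet> ?T \<omega> = norm \<xi> * (u \<bullet> \<omega>)" by (subst xe) (simp add: T)
    moreover have "(w - v) \<bullet> \<omega> = norm (w - v) * (u \<bullet> \<omega>)" by (subst wv) simp
    moreover have "\<xi> \<bullet> \<omega> = norm \<xi> * (e \<bullet> \<omega>)" by (subst xe) simp
    ultimately show ?thesis by simp
  qed
  then have "(\<integral>\<omega>. ?g \<omega> \<partial>K u) = (\<integral>\<omega>. ?g (?T \<omega>) \<partial>K u)" by simp
  also have "\<dots> = (\<integral>\<omega>. ?g \<omega> \<partial>K (?T u))"
    by (rule integral_K_orthogonal[OF _ orthogonal_transformation_reflect]) measurable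
  finally have "(\<integral>\<omega>. ?g \<omega> \<partial>K u) = (\<integral>\<omega>. ?g \<omega> \<partial>K e)" unfolding Tu .
  moreover have "\<xi> \<bullet> post_vel v w \<omega> = \<xi> \<bullet> v + ((w - v) \<bullet> \<omega>) * (\<xi> \<bullet> \<omega>)" for \<omega>
    by (simp add: post_vel_def inner_simps)
  moreover have "iexp (v \<bullet> xi1 \<xi> \<omega>) * iexp (w \<bullet> xi2 \<xi> \<omega>) = ?g \<omega>" for \<omega>
  proof -
    have "v \<bullet> xi1 \<xi> \<omega> + w \<bullet> xi2 \<xi> \<omega> = \<xi> \<bullet> v + ((w - v) \<bullet> \<omega>) * (\<xi> \<bullet> \<omega>)"
      by (simp add: xi1_def xi2_def inner_simps inner_commute algebra_simps)
    then show ?thesis by (simp only: exp_add[symmetric] distrib_left[symmetric] of_real_add[symmetric])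
  qed
  ultimately show ?thesis unfolding u_def e_def by simp
qed

lemma bobylev:
  assumes M: "is_prob_borel M"
  defines "f \<equiv> \<lambda>\<xi>. \<integral>x. iexp (\<xi> \<bullet> x) \<partial>M"
  shows "(\<integral>v. \<integral>w. \<integral>\<omega>. cos (\<xi> \<bullet> post_vel v w \<omega>) \<partial>K (coll_dir v w) \<partial>M \<partial>M) = Re (\<integral>\<omega>. f (xi1 \<xi> \<omega>) * f (xi2 \<xi> \<omega>) \<partial>K (dir \<xi>))"
    and "(\<integral>v. \<integral>w. \<integral>\<omega>. sin (\<xi> \<bullet> post_vel v w \<omega>) \<partial>K (coll_dir v w) \<partial>M \<partial>M) = Im (\<integral>\<omega>. f (xi1 \<xi> \<omega>) * f (xi2 \<xi> \<omega>) \<partial>K (dir \<xi>))"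
proof -
  interpret M: prob_space M using M by (simp add: is_prob_borel_def)
  have [measurable_cong]: "sets M = sets borel" using M by (simp add: is_prob_borel_def)
  interpret K: prob_space "K (dir \<xi>)" by (rule prob_space_K) simp
  interpret P: pair_sigma_finite M "K (dir \<xi>)" ..
  let ?F = "\<lambda>v w \<omega>. iexp (v \<bullet> xi1 \<xi> \<omega>) * iexp (w \<bullet> xi2 \<xi> \<omega>)"
  define G where "G v w = (\<integral>\<omega>. ?F v w \<omega> \<partial>K (dir \<xi>))" for v w
  have [measurable]: "(\<lambda>x. xi1 \<xi> (h x)) \<in> borel_measurable L" "(\<lambda>x. xi2 \<xi> (h x)) \<in> borel_measurable L"
    if "h \<in> borel_measurable L" for h and L :: "'z measure"
    using that by (auto intro: measurable_compose[OF _ xi_measurable(1)] measurable_compose[OF _ xi_measurable(2)])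
  have fm[measurable]: "f \<in> borel_measurable borel" unfolding f_def by measurable
  have f1: "cmod (f \<zeta>) \<le> 1" for \<zeta> unfolding f_def by (rule M.cmod_char_le_1)
  have Gm1[measurable]: "(\<lambda>w. G v w) \<in> borel_measurable borel" for v
    unfolding G_def by measurable
  have G1: "cmod (G v w) \<le> 1" for v w
  proof -
    have "cmod (G v w) \<le> (\<integral>\<omega>. cmod (?F v w \<omega>) \<partial>K (dir \<xi>))" unfolding G_def by (rule integral_norm_bound)
    then show ?thesis using K.prob_space by (simp add: norm_mult)
  qed
  have Gi: "integrable M (G v)" for v
    by (rule M.integrable_const_bound[where B=1]) (auto simp: G1)
  define H where "H v = (\<integral>w. G v w \<partial>M)" for v
  have Hm[measurable]: "H \<in> borel_measurable borel"
    unfolding H_def G_def by measurable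
  have H_eq: "H v = (\<integral>\<omega>. iexp (v \<bullet> xi1 \<xi> \<omega>) * f (xi2 \<xi> \<omega>) \<partial>K (dir \<xi>))" for v
  proof -
    have "H v = (\<integral>\<omega>. \<integral>w. ?F v w \<omega> \<partial>M \<partial>K (dir \<xi>))"
      unfolding H_def G_def
    proof (rule P.Fubini_integral[symmetric], rule P.Fubini_integrable)
      show "AE x in M. integrable (K (dir \<xi>)) (\<lambda>y. case (x, y) of (w, \<omega>) \<Rightarrow> ?F v w \<omega>)"
        by (intro AE_I2 K.integrable_const_bound[where B=1]) (auto simp: norm_mult)
    qed (measurable, simp add: norm_mult K.prob_space[unfolded space_K])
    then show ?thesis by (simp add: f_def inner_commute)
  qed
  have H1: "cmod (H v) \<le> 1" for v
  proof -
    have "cmod (H v) \<le> (\<integral>\<omega>. cmod (G v \<omega>) \<partial>M)" unfolding H_def by (rule integral_norm_bound)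
    also have "\<dots> \<le> (\<integral>\<omega>. 1 \<partial>M)" using Gi by (intro integral_mono) (auto simp: G1)
    finally show ?thesis using M.prob_space by simp
  qed
  have Hi: "integrable M H" by (rule M.integrable_const_bound[where B=1]) (auto simp: H1)
  have "(\<integral>v. H v \<partial>M) = (\<integral>\<omega>. \<integral>v. iexp (v \<bullet> xi1 \<xi> \<omega>) * f (xi2 \<xi> \<omega>) \<partial>M \<partial>K (dir \<xi>))"
    unfolding H_eq
  proof (rule P.Fubini_integral[symmetric], rule P.Fubini_integrable)
    show "AE x in M. integrable (K (dir \<xi>)) (\<lambda>y. case (x, y) of (v, \<omega>) \<Rightarrow> iexp (v \<bullet> xi1 \<xi> \<omega>) * f (xi2 \<xi> \<omega>))"
      by (intro AE_I2 K.integrable_const_bound[where B=1]) (auto simp: norm_mult f1)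
  qed (measurable, simp add: norm_mult)
  also have "\<dots> = (\<integral>\<omega>. f (xi1 \<xi> \<omega>) * f (xi2 \<xi> \<omega>) \<partial>K (dir \<xi>))"
    by (simp add: f_def inner_commute)
  finally have main: "(\<integral>v. H v \<partial>M) = (\<integral>\<omega>. f (xi1 \<xi> \<omega>) * f (xi2 \<xi> \<omega>) \<partial>K (dir \<xi>))" .
  have Gcol: "G v w = (\<integral>\<omega>. iexp (\<xi> \<bullet> post_vel v w \<omega>) \<partial>K (coll_dir v w))" for v w
    unfolding G_def bobylev_pointwise ..
  have pm: "(\<lambda>\<omega>. post_vel v w \<omega>) \<in> borel_measurable borel" for v w unfolding post_vel_def by measurable
  have ci: "integrable (K (coll_dir v w)) (\<lambda>\<omega>. iexp (\<xi> \<bullet> post_vel v w \<omega>))" for v w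
    using pm by (intro integrable_K_bounded[where B=1]) auto
  have re: "Re (G v w) = (\<integral>\<omega>. cos (\<xi> \<bullet> post_vel v w \<omega>) \<partial>K (coll_dir v w))"
    and im: "Im (G v w) = (\<integral>\<omega>. sin (\<xi> \<bullet> post_vel v w \<omega>) \<partial>K (coll_dir v w))" for v w
    unfolding Gcol using integral_Re[OF ci, of v w] integral_Im[OF ci, of v w]
    by (simp_all add: Re_exp Im_exp)
  show "(\<integral>v. \<integral>w. \<integral>\<omega>. cos (\<xi> \<bullet> post_vel v w \<omega>) \<partial>K (coll_dir v w) \<partial>M \<partial>M) = Re (\<integral>\<omega>. f (xi1 \<xi> \<omega>) * f (xi2 \<xi> \<omega>) \<partial>K (dir \<xi>))"
    unfolding main[symmetric] re[symmetric] integral_Re[OF Hi, symmetric] by (simp add: H_def Gi)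
  show "(\<integral>v. \<integral>w. \<integral>\<omega>. sin (\<xi> \<bullet> post_vel v w \<omega>) \<partial>K (coll_dir v w) \<partial>M \<partial>M) = Im (\<integral>\<omega>. f (xi1 \<xi> \<omega>) * f (xi2 \<xi> \<omega>) \<partial>K (dir \<xi>))"
    unfolding main[symmetric] im[symmetric] integral_Im[OF Hi, symmetric] by (simp add: H_def Gi)
qed

end

section \<open>Convergence of characteristic functions\<close>

lemma exp_decay_tendsto: "a > 0 \<Longrightarrow> ((\<lambda>t::real. exp (- a * t)) \<longlongrightarrow> 0) at_top"
  by real_asymp

context normalized_kernel
begin

lemma fourier_solution_translate:
  assumes f: "fourier_solution f"
  shows "fourier_solution (\<lambda>\<xi> t. iexp (- (\<xi> \<bullet> a)) * f \<xi> t)"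
  unfolding fourier_solution_def gain_def
proof (intro conjI allI impI)
  fix t :: real assume t: "t \<ge> 0"
  have [measurable]: "(\<lambda>\<xi>. f \<xi> t) \<in> borel_measurable borel" using f t unfolding fourier_solution_def by blast
  show "(\<lambda>\<xi>. iexp (- (\<xi> \<bullet> a)) * f \<xi> t) \<in> borel_measurable borel" by measurable
  fix \<xi>
  show "cmod (iexp (- (\<xi> \<bullet> a)) * f \<xi> t) \<le> 1" using f t unfolding fourier_solution_def by (simp add: norm_mult)
next
  fix \<xi>
  show "continuous_on {0..} (\<lambda>t. iexp (- (\<xi> \<bullet> a)) * f \<xi> t)"
    using f unfolding fourier_solution_def by (intro continuous_intros) auto
  fix t :: real assume t: "t > 0"
  have d: "(f \<xi> has_vector_derivative (\<integral>\<omega>. f (xi1 \<xi> \<omega>) t * f (xi2 \<xi> \<omega>) t \<partial>K (dir \<xi>)) - f \<xi> t) (at t)"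
    using f t unfolding fourier_solution_def gain_def by blast
  have eq: "iexp (- (xi1 \<xi> \<omega> \<bullet> a)) * f (xi1 \<xi> \<omega>) t * (iexp (- (xi2 \<xi> \<omega> \<bullet> a)) * f (xi2 \<xi> \<omega>) t)
     = iexp (- (\<xi> \<bullet> a)) * (f (xi1 \<xi> \<omega>) t * f (xi2 \<xi> \<omega>) t)" for \<omega>
  proof -
    have "- (xi1 \<xi> \<omega> \<bullet> a) + - (xi2 \<xi> \<omega> \<bullet> a) = - (\<xi> \<bullet> a)" by (simp add: xi1_def xi2_def inner_simps)
    then have "iexp (- (\<xi> \<bullet> a)) = iexp (- (xi1 \<xi> \<omega> \<bullet> a)) * iexp (- (xi2 \<xi> \<omega> \<bullet> a))"
      by (simp only: exp_add[symmetric] distrib_left[symmetric] of_real_add[symmetric])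
    then show ?thesis by (simp only: ac_simps)
  qed
  show "((\<lambda>t. iexp (- (\<xi> \<bullet> a)) * f \<xi> t) has_vector_derivative
     (\<integral>\<omega>. iexp (- (xi1 \<xi> \<omega> \<bullet> a)) * f (xi1 \<xi> \<omega>) t * (iexp (- (xi2 \<xi> \<omega> \<bullet> a)) * f (xi2 \<xi> \<omega>) t) \<partial>K (dir \<xi>))
       - iexp (- (\<xi> \<bullet> a)) * f \<xi> t) (at t)"
    using has_vector_derivative_mult_right[OF d, of "iexp (- (\<xi> \<bullet> a))"]
    unfolding eq by (simp only: Bochner_Integration.integral_mult_right_zero right_diff_distrib)
qed

lemma pt_0: "pt p s \<xi> 0 = p \<xi>" if "quadratic_profile p s"
  by (simp add: pt_def[OF that])

lemma N_tendsto:
  assumes "quadratic_profile p s"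
  shows "((\<lambda>t. N p s \<xi> t) \<longlongrightarrow> exp (- (s * (norm \<xi>)\<^sup>2) / 2)) at_top"
proof -
  have "((\<lambda>t. exp (- 3 * \<kappa> * t)) \<longlongrightarrow> 0) at_top"
    using exp_decay_tendsto[of "3 * \<kappa>"] \<kappa>_pos by simp
  then have "((\<lambda>t. exp (- ((exp (- 3 * \<kappa> * t) * p \<xi> + (1 - exp (- 3 * \<kappa> * t)) * (s * (norm \<xi>)\<^sup>2)) / 2)))
     \<longlongrightarrow> exp (- ((0 * p \<xi> + (1 - 0) * (s * (norm \<xi>)\<^sup>2)) / 2))) at_top"
    by (intro tendsto_intros) auto
  then show ?thesis unfolding N_def[OF assms] pt_def[OF assms] by simp
qed

lemma barrier_tendsto: "((\<lambda>t. barrier \<epsilon> C \<xi> t) \<longlongrightarrow> \<epsilon> * (norm \<xi>)\<^sup>2) at_top"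
proof -
  have "((\<lambda>t. exp (- \<kappa> * t)) \<longlongrightarrow> 0) at_top" by (rule exp_decay_tendsto[OF \<kappa>_pos])
  then have "((\<lambda>t. \<epsilon> * (norm \<xi>)\<^sup>2 + C * exp (- \<kappa> * t) * norm \<xi> ^ 4) \<longlongrightarrow> \<epsilon> * (norm \<xi>)\<^sup>2 + C * 0 * norm \<xi> ^ 4) at_top"
    by (intro tendsto_intros)
  then show ?thesis unfolding barrier_def[abs_def] by simp
qed

lemma fourier_solution_tendsto_gaussian:
  assumes f: "fourier_solution f" and p: "quadratic_profile p s"
    and init: "\<And>\<epsilon>. \<epsilon> > 0 \<Longrightarrow> \<exists>C. \<forall>\<xi>. cmod (f \<xi> 0 - exp (- (p \<xi> / 2))) \<le> \<epsilon> * (norm \<xi>)\<^sup>2 + C * norm \<xi> ^ 4"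
  shows "(f \<xi> \<longlongrightarrow> of_real (exp (- (s * (norm \<xi>)\<^sup>2) / 2))) at_top"
proof (rule tendstoI)
  fix e :: real assume e: "e > 0"
  define \<epsilon> where "\<epsilon> = (e / 4) / ((norm \<xi>)\<^sup>2 + 1)"
  have pos: "(norm \<xi>)\<^sup>2 + 1 > 0" by (simp add: add_nonneg_pos)
  have \<epsilon>: "\<epsilon> > 0" unfolding \<epsilon>_def using e pos by simp
  have "\<epsilon> * (norm \<xi>)\<^sup>2 \<le> \<epsilon> * ((norm \<xi>)\<^sup>2 + 1)" using \<epsilon> by simp
  also have "\<dots> = e / 4" unfolding \<epsilon>_def using pos by (metis less_irrefl nonzero_eq_divide_eq)
  finally have \<epsilon>4: "\<epsilon> * (norm \<xi>)\<^sup>2 < e / 2" using e by linarith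
  obtain C0 where C0: "\<And>\<xi>. cmod (f \<xi> 0 - exp (- (p \<xi> / 2))) \<le> \<epsilon> * (norm \<xi>)\<^sup>2 + C0 * norm \<xi> ^ 4"
    using init[OF \<epsilon>] by blast
  define C where "C = max 0 (max C0 (9 / 4 * s\<^sup>2 / \<kappa>))"
  have "9 / 4 * s\<^sup>2 / \<kappa> \<le> C" by (simp add: C_def)
  then have C: "C \<ge> 0" "C0 \<le> C" "9 / 4 * s\<^sup>2 \<le> \<kappa> * C"
    using \<kappa>_pos by (auto simp: C_def field_simps)
  have bound: "cmod (f \<xi> t - N p s \<xi> t) \<le> barrier \<epsilon> C \<xi> t" if "t \<ge> 0" for t
  proof (rule two_sided_comparison[OF p f less_imp_le[OF \<epsilon>] C(1,3) _ that])
    fix \<xi> :: vec3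
    have "C0 * norm \<xi> ^ 4 \<le> C * norm \<xi> ^ 4" using C by (intro mult_right_mono) auto
    then show "cmod (f \<xi> 0 - N p s \<xi> 0) \<le> barrier \<epsilon> C \<xi> 0"
      using C0[of \<xi>] by (simp add: N_def[OF p] pt_0[OF p] barrier_def)
  qed
  have "\<forall>\<^sub>F t in at_top. barrier \<epsilon> C \<xi> t < e / 2"
    by (rule order_tendstoD(2)[OF barrier_tendsto \<epsilon>4])
  moreover have "\<forall>\<^sub>F t in at_top. dist (N p s \<xi> t) (exp (- (s * (norm \<xi>)\<^sup>2) / 2)) < e / 2"
    using e by (intro tendstoD[OF N_tendsto[OF p]]) simp
  moreover have "\<forall>\<^sub>F t in at_top. (t::real) \<ge> 0" by (rule eventually_ge_at_top)
  ultimately show "\<forall>\<^sub>F t in at_top. dist (f \<xi> t) (of_real (exp (- (s * (norm \<xi>)\<^sup>2) / 2))) < e"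
  proof eventually_elim
    case (elim t)
    have "dist (f \<xi> t) (of_real (N p s \<xi> t)) < e / 2"
      using bound[OF elim(3)] elim(1) by (simp add: dist_norm)
    moreover have "dist (complex_of_real (N p s \<xi> t)) (of_real (exp (- (s * (norm \<xi>)\<^sup>2) / 2))) < e / 2"
      using elim(2) by (simp only: dist_of_real)
    ultimately show ?case
      using dist_triangle[of "f \<xi> t" "of_real (exp (- (s * (norm \<xi>)\<^sup>2) / 2))" "of_real (N p s \<xi> t)"] by linarith
  qed
qed

lemma fourier_solution_limit_le_gaussian:
  assumes f: "fourier_solution f" and p: "quadratic_profile p s"
    and init: "\<And>\<xi>. cmod (f \<xi> 0) \<le> exp (- (p \<xi> / 2)) + C0 * norm \<xi> ^ 4"
    and lim: "(f \<xi> \<longlongrightarrow> l) at_top"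
  shows "cmod l \<le> exp (- (s * (norm \<xi>)\<^sup>2) / 2)"
proof -
  define C where "C = max 0 (max C0 (9 / 4 * s\<^sup>2 / \<kappa>))"
  have "9 / 4 * s\<^sup>2 / \<kappa> \<le> C" by (simp add: C_def)
  then have C: "C \<ge> 0" "C0 \<le> C" "9 / 4 * s\<^sup>2 \<le> \<kappa> * C"
    using \<kappa>_pos by (auto simp: C_def field_simps)
  have bound: "cmod (f \<xi> t) \<le> N p s \<xi> t + barrier 0 C \<xi> t" if "t \<ge> 0" for t
  proof (rule one_sided_comparison[OF p f order_refl C(1,3) _ that])
    fix \<xi> :: vec3
    have "C0 * norm \<xi> ^ 4 \<le> C * norm \<xi> ^ 4" using C by (intro mult_right_mono) auto
    then show "cmod (f \<xi> 0) \<le> N p s \<xi> 0 + barrier 0 C \<xi> 0"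
      using init[of \<xi>] by (simp add: N_def[OF p] pt_0[OF p] barrier_def)
  qed
  have "((\<lambda>t. N p s \<xi> t + barrier 0 C \<xi> t) \<longlongrightarrow> exp (- (s * (norm \<xi>)\<^sup>2) / 2) + 0 * (norm \<xi>)\<^sup>2) at_top"
    by (intro tendsto_add N_tendsto[OF p] barrier_tendsto)
  moreover have "\<forall>\<^sub>F t in at_top. cmod (f \<xi> t) \<le> N p s \<xi> t + barrier 0 C \<xi> t"
    using eventually_ge_at_top[of 0] by eventually_elim (rule bound)
  ultimately have "cmod l \<le> exp (- (s * (norm \<xi>)\<^sup>2) / 2) + 0 * (norm \<xi>)\<^sup>2"
    using tendsto_norm[OF lim] by (intro tendsto_le[OF trivial_limit_at_top_linorder])
  then show ?thesis by simp
qed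

end

lemma measure_solution_fourier:
  assumes b: "angular_kernel b" and sol: "measure_solution b \<mu>0 \<mu>"
  shows "normalized_kernel.fourier_solution (cut_kernel b) (\<lambda>\<xi> t. \<integral>x. iexp (\<xi> \<bullet> x) \<partial>\<mu> t)"
proof -
  have bm[measurable]: "b \<in> borel_measurable borel" using measure_solution_kernel[OF b sol] by simp
  interpret normalized_kernel "cut_kernel b" using measure_solution_kernel[OF b sol] by simp
  have P: "is_prob_borel (\<mu> t)" if "t \<ge> 0" for t using sol that by (simp add: measure_solution_def)
  have split: "(\<integral>x. iexp (\<xi> \<bullet> x) \<partial>\<mu> t) = of_real (\<integral>x. cos (\<xi> \<bullet> x) \<partial>\<mu> t) + \<i> * of_real (\<integral>x. sin (\<xi> \<bullet> x) \<partial>\<mu> t)"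
    if "t \<ge> 0" for \<xi> t
    by (rule char_eq_cos_sin[OF P[OF that]])
  have K_eq: "(\<integral>\<omega>. \<phi> (post_vel v w \<omega>) * b (coll_dir v w \<bullet> \<omega>) \<partial>usphere) = (\<integral>\<omega>. \<phi> (post_vel v w \<omega>) \<partial>K (coll_dir v w))"
    if [measurable]: "\<phi> \<in> borel_measurable borel" for \<phi> :: "vec3 \<Rightarrow> real" and v w
  proof -
    have [measurable]: "(\<lambda>\<omega>. \<phi> (post_vel v w \<omega>)) \<in> borel_measurable borel" unfolding post_vel_def by measurable
    have "(\<integral>\<omega>. \<phi> (post_vel v w \<omega>) \<partial>K (coll_dir v w)) = (\<integral>\<omega>. cut_kernel b (coll_dir v w \<bullet> \<omega>) * \<phi> (post_vel v w \<omega>) \<partial>usphere)"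
      by (subst integral_K) auto
    also have "\<dots> = (\<integral>\<omega>. \<phi> (post_vel v w \<omega>) * b (coll_dir v w \<bullet> \<omega>) \<partial>usphere)"
    proof (rule integral_cong_AE)
      show "AE \<omega> in usphere. cut_kernel b (coll_dir v w \<bullet> \<omega>) * \<phi> (post_vel v w \<omega>) = \<phi> (post_vel v w \<omega>) * b (coll_dir v w \<bullet> \<omega>)"
        using AE_usphere[OF norm_coll_dir[of v w]] by eventually_elim (simp add: cut_kernel_def)
    qed measurable
    finally show ?thesis ..
  qed
  have weak: "((\<lambda>s. \<integral>x. \<phi> x \<partial>\<mu> s) has_real_derivative
      ((\<integral>v. \<integral>w. \<integral>\<omega>. \<phi> (post_vel v w \<omega>) \<partial>K (coll_dir v w) \<partial>\<mu> t \<partial>\<mu> t) - (\<integral>x. \<phi> x \<partial>\<mu> t))) (at t)"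
    if t: "t > 0" and \<phi>: "continuous_on UNIV \<phi>" "bounded (range \<phi>)" for t and \<phi> :: "vec3 \<Rightarrow> real"
  proof -
    have "((\<lambda>s. \<integral>x. \<phi> x \<partial>\<mu> s) has_real_derivative
      ((\<integral>v. \<integral>w. \<integral>\<omega>. \<phi> (post_vel v w \<omega>) * b (coll_dir v w \<bullet> \<omega>) \<partial>usphere \<partial>\<mu> t \<partial>\<mu> t) - (\<integral>x. \<phi> x \<partial>\<mu> t))) (at t)"
      using sol t \<phi> unfolding measure_solution_def bounded_continuous_def by blast
    then show ?thesis unfolding K_eq[OF borel_measurable_continuous_onI[OF \<phi>(1)]] .
  qed
  show ?thesis
    unfolding fourier_solution_def gain_def
  proof (intro conjI allI impI)
    fix t :: real assume t: "t \<ge> 0"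
    interpret M: prob_space "\<mu> t" using P[OF t] by (simp add: is_prob_borel_def)
    have [measurable_cong]: "sets (\<mu> t) = sets borel" using P[OF t] by (simp add: is_prob_borel_def)
    show "(\<lambda>\<xi>. \<integral>x. iexp (\<xi> \<bullet> x) \<partial>\<mu> t) \<in> borel_measurable borel" by measurable
    show "cmod (\<integral>x. iexp (\<xi> \<bullet> x) \<partial>\<mu> t) \<le> 1" for \<xi> by (rule M.cmod_char_le_1)
  next
    fix \<xi>
    have "continuous_on {0..} (\<lambda>t. of_real (\<integral>x. cos (\<xi> \<bullet> x) \<partial>\<mu> t) + \<i> * complex_of_real (\<integral>x. sin (\<xi> \<bullet> x) \<partial>\<mu> t))"
      unfolding continuous_on_def
      by (intro ballI tendsto_intros measure_solution_continuous[OF sol, where B=1]) auto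
    then show "continuous_on {0..} (\<lambda>t. \<integral>x. iexp (\<xi> \<bullet> x) \<partial>\<mu> t)"
      by (rule continuous_on_cong[THEN iffD1, rotated -1]) (auto simp: split)
    fix t :: real assume t: "t > 0"
    define G where "G = (\<integral>\<omega>. (\<integral>x. iexp (xi1 \<xi> \<omega> \<bullet> x) \<partial>\<mu> t) * (\<integral>x. iexp (xi2 \<xi> \<omega> \<bullet> x) \<partial>\<mu> t) \<partial>K (dir \<xi>))"
    have Pt: "is_prob_borel (\<mu> t)" using P t by simp
    have c: "((\<lambda>s. \<integral>x. cos (\<xi> \<bullet> x) \<partial>\<mu> s) has_real_derivative Re G - (\<integral>x. cos (\<xi> \<bullet> x) \<partial>\<mu> t)) (at t)"
      unfolding G_def bobylev(1)[OF Pt, symmetric]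
      by (rule weak[OF t]) (auto intro!: continuous_intros boundedI[where B=1])
    have s: "((\<lambda>s. \<integral>x. sin (\<xi> \<bullet> x) \<partial>\<mu> s) has_real_derivative Im G - (\<integral>x. sin (\<xi> \<bullet> x) \<partial>\<mu> t)) (at t)"
      unfolding G_def bobylev(2)[OF Pt, symmetric]
      by (rule weak[OF t]) (auto intro!: continuous_intros boundedI[where B=1])
    have "((\<lambda>s. of_real (\<integral>x. cos (\<xi> \<bullet> x) \<partial>\<mu> s) + \<i> * complex_of_real (\<integral>x. sin (\<xi> \<bullet> x) \<partial>\<mu> s)) has_vector_derivative
       of_real (Re G - (\<integral>x. cos (\<xi> \<bullet> x) \<partial>\<mu> t)) + \<i> * of_real (Im G - (\<integral>x. sin (\<xi> \<bullet> x) \<partial>\<mu> t))) (at t)"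
      by (intro has_vector_derivative_add has_vector_derivative_mult_right has_vector_derivative_of_real c s)
    moreover have "of_real (Re G - (\<integral>x. cos (\<xi> \<bullet> x) \<partial>\<mu> t)) + \<i> * of_real (Im G - (\<integral>x. sin (\<xi> \<bullet> x) \<partial>\<mu> t))
       = G - (\<integral>x. iexp (\<xi> \<bullet> x) \<partial>\<mu> t)"
      unfolding split[OF less_imp_le[OF t]] by (simp add: complex_eq_iff)
    ultimately have d: "((\<lambda>s. of_real (\<integral>x. cos (\<xi> \<bullet> x) \<partial>\<mu> s) + \<i> * complex_of_real (\<integral>x. sin (\<xi> \<bullet> x) \<partial>\<mu> s)) has_vector_derivative
       G - (\<integral>x. iexp (\<xi> \<bullet> x) \<partial>\<mu> t)) (at t)" by simp
    show "((\<lambda>t. \<integral>x. iexp (\<xi> \<bullet> x) \<partial>\<mu> t) has_vector_derivative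
       (\<integral>\<omega>. (\<integral>x. iexp (xi1 \<xi> \<omega> \<bullet> x) \<partial>\<mu> t) * (\<integral>x. iexp (xi2 \<xi> \<omega> \<bullet> x) \<partial>\<mu> t) \<partial>K (dir \<xi>)) - (\<integral>x. iexp (\<xi> \<bullet> x) \<partial>\<mu> t)) (at t)"
      unfolding G_def[symmetric]
      by (rule has_vector_derivative_transform_within_open[OF d, of "{0<..}"]) (use t split in auto)
  qed
qed

section \<open>Initial data\<close>

lemma iexp_taylor2:
  shows "cmod (iexp y - (1 + \<i> * y - y\<^sup>2 / 2)) \<le> y\<^sup>2"
    and "cmod (iexp y - (1 + \<i> * y - y\<^sup>2 / 2)) \<le> \<bar>y\<bar> ^ 3 / 6"
proof -
  have sum: "(\<Sum>k\<le>2. (\<i> * complex_of_real y) ^ k / fact k) = 1 + \<i> * y - y\<^sup>2 / 2"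
    by (simp add: eval_nat_numeral power2_eq_square algebra_simps)
  show "cmod (iexp y - (1 + \<i> * y - y\<^sup>2 / 2)) \<le> y\<^sup>2"
    using iexp_approx2[of y 2] unfolding sum by simp
  show "cmod (iexp y - (1 + \<i> * y - y\<^sup>2 / 2)) \<le> \<bar>y\<bar> ^ 3 / 6"
    using iexp_approx1[of y 2] unfolding sum by (simp add: eval_nat_numeral)
qed

lemma cos_le_taylor4: "cos y \<le> 1 - y\<^sup>2 / 2 + y ^ 4" for y :: real
proof -
  have sum: "(\<Sum>k\<le>3. (\<i> * complex_of_real y) ^ k / fact k) = complex_of_real (1 - y\<^sup>2 / 2) + \<i> * complex_of_real (y - y ^ 3 / 6)"
    by (simp add: eval_nat_numeral algebra_simps)
  have "cmod (iexp y - (complex_of_real (1 - y\<^sup>2 / 2) + \<i> * complex_of_real (y - y ^ 3 / 6))) \<le> y ^ 4 / 24"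
    using iexp_approx1[of y 3] unfolding sum by (simp add: eval_nat_numeral)
  moreover have "Re (iexp y - (complex_of_real (1 - y\<^sup>2 / 2) + \<i> * complex_of_real (y - y ^ 3 / 6))) = cos y - (1 - y\<^sup>2 / 2)"
    by (simp only: minus_complex.sel plus_complex.sel times_complex.sel Re_complex_of_real Im_complex_of_real Re_exp imaginary_unit.sel) simp
  ultimately have "cos y - (1 - y\<^sup>2 / 2) \<le> y ^ 4 / 24"
    using complex_Re_le_cmod[of "iexp y - (complex_of_real (1 - y\<^sup>2 / 2) + \<i> * complex_of_real (y - y ^ 3 / 6))"]
    by linarith
  moreover have "0 \<le> y ^ 4" by simp
  ultimately show ?thesis by linarith
qed

lemma (in prob_space) integrable_of_square_integrable:
  fixes g :: "'a \<Rightarrow> 'b::{banach, second_countable_topology}"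
  assumes [measurable]: "g \<in> borel_measurable M" and int: "integrable M (\<lambda>x. (norm (g x))\<^sup>2)"
  shows "integrable M g"
proof (rule Bochner_Integration.integrable_bound)
  show "integrable M (\<lambda>x. 1 + (norm (g x))\<^sup>2)" using int by simp
  have "norm (g x) \<le> 1 + (norm (g x))\<^sup>2" for x
    using sum_squares_bound[of "norm (g x)" 1] norm_ge_zero[of "g x"] unfolding power_one by linarith
  then show "AE x in M. norm (g x) \<le> norm (1 + (norm (g x))\<^sup>2)" by simp
qed simp

lemma char_second_order:
  fixes g :: "'m \<Rightarrow> vec3"
  assumes "prob_space M" and g[measurable]: "g \<in> borel_measurable M" and int: "integrable M (\<lambda>x. (norm (g x))\<^sup>2)"
    and mean: "(\<integral>x. g x \<partial>M) = 0" and \<epsilon>: "\<epsilon> > 0"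
  shows "\<exists>C. \<forall>\<xi>. cmod ((\<integral>x. iexp (\<xi> \<bullet> g x) \<partial>M) - exp (- ((\<integral>x. (g x \<bullet> \<xi>)\<^sup>2 \<partial>M) / 2))) \<le> \<epsilon> * (norm \<xi>)\<^sup>2 + C * norm \<xi> ^ 4"
proof -
  interpret M: prob_space M by fact
  define E where "E = (\<integral>x. (norm (g x))\<^sup>2 \<partial>M)"
  have E0: "E \<ge> 0" unfolding E_def by simp
  have gi: "integrable M g" by (rule M.integrable_of_square_integrable[OF g int])
  define \<delta> where "\<delta> = \<epsilon> / (2 * (E + 1))"
  have \<delta>: "\<delta> > 0" unfolding \<delta>_def using \<epsilon> E0 by simp
  have \<delta>E: "\<delta> * E \<le> \<epsilon> / 2" unfolding \<delta>_def using \<epsilon> E0 by (simp add: field_simps)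
  let ?tail = "\<lambda>R::real. \<lambda>x. (norm (g x))\<^sup>2 * indicator {x. norm (g x) > R} x"
  have "(\<lambda>n. \<integral>x. ?tail (real n) x \<partial>M) \<longlonglongrightarrow> (\<integral>x. 0 \<partial>M)"
  proof (rule integral_dominated_convergence[OF _ _ int])
    show "AE x in M. (\<lambda>n. ?tail (real n) x) \<longlonglongrightarrow> 0"
    proof (intro AE_I2 tendsto_eventually)
      fix x
      obtain n0 :: nat where "norm (g x) \<le> real n0" using real_arch_simple by blast
      then have "?tail (real n) x = 0" if "n \<ge> n0" for n using that by (auto simp: indicator_def)
      then show "\<forall>\<^sub>F n in sequentially. ?tail (real n) x = 0" by (auto simp: eventually_sequentially)
    qed
  qed (auto simp: indicator_def)
  then have "\<forall>\<^sub>F n in sequentially. (\<integral>x. ?tail (real n) x \<partial>M) < \<epsilon> / 2"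
    using \<epsilon> by (intro order_tendstoD(2)) auto
  then obtain n where n: "(\<integral>x. ?tail (real n) x \<partial>M) < \<epsilon> / 2" by (auto simp: eventually_sequentially)
  define R where "R = real n"
  have ti: "integrable M (?tail R)"
    by (rule Bochner_Integration.integrable_bound[OF int]) (auto simp: indicator_def)
  have cs: "(g x \<bullet> \<xi>)\<^sup>2 \<le> (norm (g x))\<^sup>2 * (norm \<xi>)\<^sup>2" for x \<xi>
    using Cauchy_Schwarz_ineq[of "g x" \<xi>] by (simp add: power2_norm_eq_inner)
  have i: "integrable M (\<lambda>x. (g x \<bullet> \<xi>)\<^sup>2)" for \<xi>
    by (rule Bochner_Integration.integrable_bound[OF integrable_mult_left[OF int, of "(norm \<xi>)\<^sup>2"]]) (auto simp: cs)
  define p where "p \<xi> = (\<integral>x. (g x \<bullet> \<xi>)\<^sup>2 \<partial>M)" for \<xi>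
  have p0: "0 \<le> p \<xi>" for \<xi> unfolding p_def by simp
  have pE: "p \<xi> \<le> E * (norm \<xi>)\<^sup>2" for \<xi>
  proof -
    have "p \<xi> \<le> (\<integral>x. (norm (g x))\<^sup>2 * (norm \<xi>)\<^sup>2 \<partial>M)"
      unfolding p_def by (rule integral_mono[OF i integrable_mult_left[OF int]]) (rule cs)
    then show ?thesis by (simp add: E_def)
  qed
  have pt: "cmod (iexp (\<xi> \<bullet> g x) - (1 + \<i> * (\<xi> \<bullet> g x) - (\<xi> \<bullet> g x)\<^sup>2 / 2))
      \<le> (norm \<xi>)\<^sup>2 * ?tail R x + (\<delta> * (norm \<xi>)\<^sup>2) * (norm (g x))\<^sup>2 + R ^ 4 / \<delta> * norm \<xi> ^ 4" for \<xi> x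
  proof -
    define y where "y = \<xi> \<bullet> g x"
    have y2: "y\<^sup>2 \<le> (norm \<xi>)\<^sup>2 * (norm (g x))\<^sup>2" using cs[of x \<xi>] by (simp add: y_def inner_commute mult.commute)
    have nn: "0 \<le> (\<delta> * (norm \<xi>)\<^sup>2) * (norm (g x))\<^sup>2" "0 \<le> R ^ 4 / \<delta> * norm \<xi> ^ 4" using \<delta> by auto
    show ?thesis
    proof (cases "norm (g x) > R")
      case True
      then show ?thesis using iexp_taylor2(1)[of y] y2 nn unfolding y_def[symmetric] by simp
    next
      case False
      have "\<bar>y\<bar> \<le> \<delta> + y\<^sup>2 / \<delta>"
      proof -
        have "0 \<le> (\<bar>y\<bar> - \<delta>)\<^sup>2" by simp
        then have "2 * \<bar>y\<bar> * \<delta> \<le> y\<^sup>2 + \<delta>\<^sup>2" by (simp add: power2_diff)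
        moreover have "0 \<le> \<bar>y\<bar> * \<delta>" using \<delta> by simp
        ultimately have "\<bar>y\<bar> * \<delta> \<le> y\<^sup>2 + \<delta>\<^sup>2" by linarith
        then show ?thesis using \<delta> by (simp add: field_simps power2_eq_square)
      qed
      then have "y\<^sup>2 * \<bar>y\<bar> \<le> y\<^sup>2 * (\<delta> + y\<^sup>2 / \<delta>)" by (intro mult_left_mono) auto
      then have "\<bar>y\<bar> ^ 3 \<le> \<delta> * y\<^sup>2 + (y\<^sup>2)\<^sup>2 / \<delta>"
        by (simp add: power3_eq_cube power2_eq_square algebra_simps abs_mult_self_eq flip: abs_mult)
      moreover have "0 \<le> \<bar>y\<bar> ^ 3" by simp
      ultimately have "\<bar>y\<bar> ^ 3 / 6 \<le> \<delta> * y\<^sup>2 + (y\<^sup>2)\<^sup>2 / \<delta>" by linarith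
      also have "\<delta> * y\<^sup>2 \<le> (\<delta> * (norm \<xi>)\<^sup>2) * (norm (g x))\<^sup>2" using y2 \<delta> by (simp add: mult.assoc)
      also have "(y\<^sup>2)\<^sup>2 / \<delta> \<le> R ^ 4 / \<delta> * norm \<xi> ^ 4"
      proof -
        have "(norm (g x))\<^sup>2 \<le> R\<^sup>2" using False by (intro power_mono) auto
        then have "(norm \<xi>)\<^sup>2 * (norm (g x))\<^sup>2 \<le> (norm \<xi>)\<^sup>2 * R\<^sup>2" by (intro mult_left_mono) auto
        with y2 have "y\<^sup>2 \<le> (norm \<xi>)\<^sup>2 * R\<^sup>2" by (rule order_trans)
        then have "(y\<^sup>2)\<^sup>2 \<le> ((norm \<xi>)\<^sup>2 * R\<^sup>2)\<^sup>2" by (intro power_mono) auto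
        also have "\<dots> = R ^ 4 * norm \<xi> ^ 4" by (simp add: power_mult_distrib flip: power_mult)
        finally show ?thesis using \<delta> by (simp add: divide_right_mono)
      qed
      finally have "\<bar>y\<bar> ^ 3 / 6 \<le> (\<delta> * (norm \<xi>)\<^sup>2) * (norm (g x))\<^sup>2 + R ^ 4 / \<delta> * norm \<xi> ^ 4" by simp
      then have "cmod (iexp y - (1 + \<i> * y - y\<^sup>2 / 2)) \<le> (\<delta> * (norm \<xi>)\<^sup>2) * (norm (g x))\<^sup>2 + R ^ 4 / \<delta> * norm \<xi> ^ 4"
        by (rule order_trans[OF iexp_taylor2(2)])
      then show ?thesis using False unfolding y_def[symmetric] by simp
    qed
  qed
  define C where "C = R ^ 4 / \<delta> + E\<^sup>2 / 4"
  have "cmod ((\<integral>x. iexp (\<xi> \<bullet> g x) \<partial>M) - exp (- (p \<xi> / 2))) \<le> \<epsilon> * (norm \<xi>)\<^sup>2 + C * norm \<xi> ^ 4" for \<xi>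
  proof -
    let ?T = "\<lambda>x. cmod (iexp (\<xi> \<bullet> g x) - (1 + \<i> * (\<xi> \<bullet> g x) - complex_of_real ((\<xi> \<bullet> g x)\<^sup>2) / 2))"
    let ?B = "\<lambda>x. (norm \<xi>)\<^sup>2 * ?tail R x + (\<delta> * (norm \<xi>)\<^sup>2) * (norm (g x))\<^sup>2 + R ^ 4 / \<delta> * norm \<xi> ^ 4"
    have yi: "integrable M (\<lambda>x. \<xi> \<bullet> g x)" using gi by simp
    have y0: "(\<integral>x. \<xi> \<bullet> g x \<partial>M) = 0" using gi mean by simp
    have y2i: "integrable M (\<lambda>x. (\<xi> \<bullet> g x)\<^sup>2)" using i[of \<xi>] by (simp add: inner_commute)
    have ei: "integrable M (\<lambda>x. iexp (\<xi> \<bullet> g x))" by (rule M.integrable_const_bound[where B=1]) auto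
    have ti2: "integrable M (\<lambda>x. 1 + \<i> * (\<xi> \<bullet> g x) - complex_of_real ((\<xi> \<bullet> g x)\<^sup>2) / 2)"
      using yi y2i by (intro Bochner_Integration.integrable_add Bochner_Integration.integrable_diff
          integrable_mult_right integrable_divide integrable_of_real) auto
    have "(\<integral>x. 1 + \<i> * (\<xi> \<bullet> g x) - complex_of_real ((\<xi> \<bullet> g x)\<^sup>2) / 2 \<partial>M) = 1 + \<i> * of_real (\<integral>x. \<xi> \<bullet> g x \<partial>M) - of_real (\<integral>x. (\<xi> \<bullet> g x)\<^sup>2 \<partial>M) / 2"
      using yi y2i M.prob_space
      by (simp add: Bochner_Integration.integral_diff Bochner_Integration.integral_add integrable_of_real del: of_real_power)
    also have "\<dots> = of_real (1 - p \<xi> / 2)" unfolding y0 p_def by (simp add: inner_commute)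
    finally have "(\<integral>x. iexp (\<xi> \<bullet> g x) \<partial>M) - of_real (1 - p \<xi> / 2)
       = (\<integral>x. iexp (\<xi> \<bullet> g x) - (1 + \<i> * (\<xi> \<bullet> g x) - complex_of_real ((\<xi> \<bullet> g x)\<^sup>2) / 2) \<partial>M)"
      using ei ti2 by simp
    also have "cmod \<dots> \<le> (\<integral>x. ?T x \<partial>M)"
      by (rule integral_norm_bound)
    also have "\<dots> \<le> (\<integral>x. ?B x \<partial>M)"
    proof (rule integral_mono)
      show "integrable M ?T"
        by (intro integrable_norm Bochner_Integration.integrable_diff ei ti2)
      show "integrable M ?B"
        by (intro Bochner_Integration.integrable_add integrable_mult_right ti int M.integrable_const)
      show "?T x \<le>
         ?B x" for x
        using pt[of \<xi> x] by simp
    qed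
    also have "\<dots> = (norm \<xi>)\<^sup>2 * (\<integral>x. ?tail R x \<partial>M) + (\<delta> * (norm \<xi>)\<^sup>2) * E + R ^ 4 / \<delta> * norm \<xi> ^ 4"
      using ti int M.prob_space unfolding E_def
      by (subst Bochner_Integration.integral_add, (auto)[2], subst Bochner_Integration.integral_add) auto
    also have "\<dots> \<le> (norm \<xi>)\<^sup>2 * (\<epsilon> / 2) + (norm \<xi>)\<^sup>2 * (\<epsilon> / 2) + R ^ 4 / \<delta> * norm \<xi> ^ 4"
    proof (intro add_mono order_refl)
      show "(norm \<xi>)\<^sup>2 * (\<integral>x. ?tail R x \<partial>M) \<le> (norm \<xi>)\<^sup>2 * (\<epsilon> / 2)" using n by (intro mult_left_mono) (auto simp: R_def)
      have "(norm \<xi>)\<^sup>2 * (\<delta> * E) \<le> (norm \<xi>)\<^sup>2 * (\<epsilon> / 2)" using \<delta>E by (intro mult_left_mono) auto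
      then show "(\<delta> * (norm \<xi>)\<^sup>2) * E \<le> (norm \<xi>)\<^sup>2 * (\<epsilon> / 2)" by (simp add: mult_ac)
    qed
    also have "\<dots> = \<epsilon> * (norm \<xi>)\<^sup>2 + R ^ 4 / \<delta> * norm \<xi> ^ 4" by (simp add: field_simps)
    finally have 1: "cmod ((\<integral>x. iexp (\<xi> \<bullet> g x) \<partial>M) - of_real (1 - p \<xi> / 2)) \<le> \<epsilon> * (norm \<xi>)\<^sup>2 + R ^ 4 / \<delta> * norm \<xi> ^ 4" .
    have "\<bar>exp (- (p \<xi> / 2)) - (1 - p \<xi> / 2)\<bar> \<le> (p \<xi> / 2)\<^sup>2"
      using exp_minus_taylor[of "p \<xi> / 2" 0] p0[of \<xi>] by (simp add: algebra_simps)
    also have "\<dots> \<le> (E * (norm \<xi>)\<^sup>2 / 2)\<^sup>2" using p0[of \<xi>] pE[of \<xi>] by (intro power_mono) auto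
    also have "\<dots> = E\<^sup>2 / 4 * norm \<xi> ^ 4" by (simp add: power_mult_distrib power_divide flip: power_mult)
    finally have 2: "cmod (of_real (1 - p \<xi> / 2) - of_real (exp (- (p \<xi> / 2)))) \<le> E\<^sup>2 / 4 * norm \<xi> ^ 4"
      by (metis abs_minus_commute norm_of_real of_real_diff)
    have "cmod ((\<integral>x. iexp (\<xi> \<bullet> g x) \<partial>M) - exp (- (p \<xi> / 2))) \<le>
       cmod ((\<integral>x. iexp (\<xi> \<bullet> g x) \<partial>M) - of_real (1 - p \<xi> / 2)) + cmod (of_real (1 - p \<xi> / 2) - of_real (exp (- (p \<xi> / 2))))"
      using norm_triangle_ineq[of "(\<integral>x. iexp (\<xi> \<bullet> g x) \<partial>M) - of_real (1 - p \<xi> / 2)"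
          "of_real (1 - p \<xi> / 2) - complex_of_real (exp (- (p \<xi> / 2)))"] by (simp only: diff_add_cancel add_diff_eq)
    also have "\<dots> \<le> (\<epsilon> * (norm \<xi>)\<^sup>2 + R ^ 4 / \<delta> * norm \<xi> ^ 4) + E\<^sup>2 / 4 * norm \<xi> ^ 4" by (intro add_mono 1 2)
    also have "\<dots> = \<epsilon> * (norm \<xi>)\<^sup>2 + C * norm \<xi> ^ 4" by (simp add: C_def algebra_simps)
    finally show ?thesis .
  qed
  then show ?thesis unfolding p_def by blast
qed

lemma second_moment_truncation_bounded_imp_finite:
  fixes M :: "vec3 measure"
  assumes M: "is_prob_borel M"
    and B: "\<And>n. (\<integral>z. (norm (if norm (fst z - snd z) \<le> real n then fst z - snd z else 0))\<^sup>2 \<partial>(M \<Otimes>\<^sub>M M)) \<le> B"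
  shows "(\<integral>\<^sup>+ x. ennreal ((norm x)\<^sup>2) \<partial>M) < \<infinity>"
proof -
  interpret M: prob_space M using M by (simp add: is_prob_borel_def)
  have [measurable_cong]: "sets M = sets borel" using M by (simp add: is_prob_borel_def)
  interpret P: pair_prob_space M M ..
  let ?g = "\<lambda>n z. (norm (if norm (fst z - snd z :: vec3) \<le> real n then fst z - snd z else 0))\<^sup>2"
  have gb: "?g n z \<le> (real n)\<^sup>2" for n z by (auto intro: power_mono)
  have gi: "integrable (M \<Otimes>\<^sub>M M) (?g n)" for n
    by (rule P.integrable_const_bound[where B="(real n)\<^sup>2"]) (use gb in auto)
  have inc: "incseq (\<lambda>n z. ennreal (?g n z))"
    by (auto simp: incseq_def le_fun_def intro!: ennreal_leI)
  have sup: "(SUP n. ennreal (?g n z)) = ennreal ((norm (fst z - snd z))\<^sup>2)" for z :: "vec3 \<times> vec3"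
  proof (rule antisym)
    show "(SUP n. ennreal (?g n z)) \<le> ennreal ((norm (fst z - snd z))\<^sup>2)"
      by (intro SUP_least ennreal_leI) auto
    obtain n :: nat where "norm (fst z - snd z) \<le> real n" using real_arch_simple by blast
    then show "ennreal ((norm (fst z - snd z))\<^sup>2) \<le> (SUP n. ennreal (?g n z))"
      by (intro SUP_upper2[of n]) auto
  qed
  have "(\<integral>\<^sup>+ z. ennreal ((norm (fst z - snd z))\<^sup>2) \<partial>(M \<Otimes>\<^sub>M M)) = (SUP n. \<integral>\<^sup>+ z. ennreal (?g n z) \<partial>(M \<Otimes>\<^sub>M M))"
    unfolding sup[symmetric] by (rule nn_integral_monotone_convergence_SUP[OF inc]) measurable
  also have "\<dots> \<le> ennreal B"
    by (intro SUP_least) (simp add: nn_integral_eq_integral[OF gi] ennreal_leI B)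
  finally have "(\<integral>\<^sup>+ z. ennreal ((norm (fst z - snd z))\<^sup>2) \<partial>(M \<Otimes>\<^sub>M M)) < \<infinity>"
    by (simp add: le_less_trans)
  then have "(\<integral>\<^sup>+ v. \<integral>\<^sup>+ w. ennreal ((norm (v - w))\<^sup>2) \<partial>M \<partial>M) \<noteq> \<infinity>"
    using M.nn_integral_fst[of "\<lambda>z. ennreal ((norm (fst z - snd z))\<^sup>2)" M] by simp
  then have ae: "AE v in M. (\<integral>\<^sup>+ w. ennreal ((norm (v - w))\<^sup>2) \<partial>M) \<noteq> \<infinity>"
    by (intro nn_integral_noteq_infinite) auto
  obtain v where v: "(\<integral>\<^sup>+ w. ennreal ((norm (v - w))\<^sup>2) \<partial>M) \<noteq> \<infinity>"
  proof (rule ccontr)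
    assume "\<not> thesis"
    then have "(\<integral>\<^sup>+ w. ennreal ((norm (v - w))\<^sup>2) \<partial>M) = \<infinity>" for v using that by blast
    with ae show False by simp
  qed
  have "(\<integral>\<^sup>+ x. ennreal ((norm x)\<^sup>2) \<partial>M) \<le> (\<integral>\<^sup>+ x. (2 * ennreal ((norm (v - x))\<^sup>2) + ennreal (2 * (norm v)\<^sup>2)) \<partial>M)"
  proof (rule nn_integral_mono)
    fix x
    have "norm x \<le> norm (v - x) + norm v" using norm_triangle_ineq4[of v "v - x"] by simp
    then have "(norm x)\<^sup>2 \<le> (norm (v - x) + norm v)\<^sup>2" by (intro power_mono) auto
    also have "\<dots> \<le> 2 * (norm (v - x))\<^sup>2 + 2 * (norm v)\<^sup>2"
      using sum_squares_bound[of "norm (v - x)" "norm v"] by (simp add: power2_sum)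
    finally have "ennreal ((norm x)\<^sup>2) \<le> ennreal (2 * (norm (v - x))\<^sup>2 + 2 * (norm v)\<^sup>2)" by (rule ennreal_leI)
    then show "ennreal ((norm x)\<^sup>2) \<le> 2 * ennreal ((norm (v - x))\<^sup>2) + ennreal (2 * (norm v)\<^sup>2)"
      by (simp add: ennreal_mult)
  qed
  also have "\<dots> = 2 * (\<integral>\<^sup>+ x. ennreal ((norm (v - x))\<^sup>2) \<partial>M) + ennreal (2 * (norm v)\<^sup>2)"
    by (simp add: nn_integral_add nn_integral_cmult M.emeasure_space_1)
  also have "\<dots> < \<infinity>" using v by (simp add: ennreal_mult_less_top less_top)
  finally show ?thesis .
qed

lemma cmod_char_le_truncated_gaussian:
  fixes M :: "vec3 measure" and \<xi> :: vec3 and R :: real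
  assumes M: "is_prob_borel M"
  defines "g \<equiv> \<lambda>z. if norm (fst z - snd z) \<le> R then (1 / sqrt 2) *\<^sub>R (fst z - snd z) else (0 :: vec3)"
  shows "cmod (\<integral>x. iexp (\<xi> \<bullet> x) \<partial>M) \<le> exp (- ((\<integral>z. (g z \<bullet> \<xi>)\<^sup>2 \<partial>(M \<Otimes>\<^sub>M M)) / 2)) + R ^ 4 / 2 * norm \<xi> ^ 4"
proof -
  interpret M: prob_space M using M by (simp add: is_prob_borel_def)
  have [measurable_cong]: "sets M = sets borel" using M by (simp add: is_prob_borel_def)
  interpret P: pair_prob_space M M ..
  have [measurable]: "g \<in> borel_measurable (M \<Otimes>\<^sub>M M)" unfolding g_def by measurable
  define f where "f = (\<integral>x. iexp (\<xi> \<bullet> x) \<partial>M)"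
  define p where "p = (\<integral>z. (g z \<bullet> \<xi>)\<^sup>2 \<partial>(M \<Otimes>\<^sub>M M))"
  have gx: "(g z \<bullet> \<xi>)\<^sup>2 \<le> R\<^sup>2 * (norm \<xi>)\<^sup>2" for z
  proof -
    have "(norm (g z))\<^sup>2 \<le> R\<^sup>2"
    proof (cases "norm (fst z - snd z) \<le> R")
      case True
      then have "(norm (fst z - snd z))\<^sup>2 \<le> R\<^sup>2" by (intro power_mono) auto
      moreover have "(norm (g z))\<^sup>2 = (norm (fst z - snd z))\<^sup>2 / 2"
        unfolding g_def if_P[OF True] norm_scaleR by (simp add: power_divide)
      ultimately show ?thesis using zero_le_power2[of "norm (fst z - snd z)"] by linarith
    qed (simp add: g_def)
    then have "(norm (g z))\<^sup>2 * (norm \<xi>)\<^sup>2 \<le> R\<^sup>2 * (norm \<xi>)\<^sup>2" by (intro mult_right_mono) auto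
    moreover have "(g z \<bullet> \<xi>)\<^sup>2 \<le> (norm (g z))\<^sup>2 * (norm \<xi>)\<^sup>2"
      using Cauchy_Schwarz_ineq[of "g z" \<xi>] by (simp add: power2_norm_eq_inner)
    ultimately show ?thesis by linarith
  qed
  have zi: "integrable (M \<Otimes>\<^sub>M M) (\<lambda>z. iexp (\<xi> \<bullet> (fst z - snd z)))"
    by (rule P.integrable_const_bound[where B=1]) auto
  have "(\<integral>z. iexp (\<xi> \<bullet> (fst z - snd z)) \<partial>(M \<Otimes>\<^sub>M M)) = (\<integral>v. \<integral>w. iexp (\<xi> \<bullet> (v - w)) \<partial>M \<partial>M)"
    using P.integral_fst'[OF zi] by simp
  also have "\<dots> = (\<integral>v. iexp (\<xi> \<bullet> v) * (\<integral>w. cnj (iexp (\<xi> \<bullet> w)) \<partial>M) \<partial>M)"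
    by (simp add: inner_diff_right exp_cnj algebra_simps exp_diff exp_minus divide_inverse
        flip: Bochner_Integration.integral_mult_right_zero)
  also have "(\<integral>w. cnj (iexp (\<xi> \<bullet> w)) \<partial>M) = cnj f" unfolding f_def by simp
  also have "(\<integral>v. iexp (\<xi> \<bullet> v) * cnj f \<partial>M) = f * cnj f" by (simp add: f_def)
  also have "\<dots> = of_real ((cmod f)\<^sup>2)" by (rule complex_norm_square[symmetric])
  finally have "(cmod f)\<^sup>2 = Re (\<integral>z. iexp (\<xi> \<bullet> (fst z - snd z)) \<partial>(M \<Otimes>\<^sub>M M))"
    by (metis Re_complex_of_real)
  also have "\<dots> = (\<integral>z. cos (\<xi> \<bullet> (fst z - snd z)) \<partial>(M \<Otimes>\<^sub>M M))"
    using integral_Re[OF zi] by (simp add: Re_exp)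
  also have "\<dots> \<le> (\<integral>z. 1 - (g z \<bullet> \<xi>)\<^sup>2 + R ^ 4 * norm \<xi> ^ 4 \<partial>(M \<Otimes>\<^sub>M M))"
  proof (rule integral_mono)
    show "integrable (M \<Otimes>\<^sub>M M) (\<lambda>z. cos (\<xi> \<bullet> (fst z - snd z)))"
      by (rule P.integrable_const_bound[where B=1]) auto
    show "integrable (M \<Otimes>\<^sub>M M) (\<lambda>z. 1 - (g z \<bullet> \<xi>)\<^sup>2 + R ^ 4 * norm \<xi> ^ 4)"
    proof (rule P.integrable_const_bound[where B="1 + R\<^sup>2 * (norm \<xi>)\<^sup>2 + R ^ 4 * norm \<xi> ^ 4"])
      have "\<bar>1 - (g z \<bullet> \<xi>)\<^sup>2 + R ^ 4 * norm \<xi> ^ 4\<bar> \<le> 1 + R\<^sup>2 * (norm \<xi>)\<^sup>2 + R ^ 4 * norm \<xi> ^ 4" for z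
      proof -
        have "0 \<le> R ^ 4 * norm \<xi> ^ 4" by simp
        then show ?thesis using gx[of z] zero_le_power2[of "g z \<bullet> \<xi>"] by linarith
      qed
      then show "AE z in M \<Otimes>\<^sub>M M. norm (1 - (g z \<bullet> \<xi>)\<^sup>2 + R ^ 4 * norm \<xi> ^ 4) \<le> 1 + R\<^sup>2 * (norm \<xi>)\<^sup>2 + R ^ 4 * norm \<xi> ^ 4"
        by simp
    qed measurable
    show "cos (\<xi> \<bullet> (fst z - snd z)) \<le> 1 - (g z \<bullet> \<xi>)\<^sup>2 + R ^ 4 * norm \<xi> ^ 4" for z
    proof (cases "norm (fst z - snd z) \<le> R")
      case True
      define y where "y = \<xi> \<bullet> (fst z - snd z)"
      have "\<bar>y\<bar> \<le> norm \<xi> * norm (fst z - snd z)" unfolding y_def by (rule Cauchy_Schwarz_ineq2)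
      also have "\<dots> \<le> norm \<xi> * R" using True by (intro mult_left_mono) auto
      finally have "\<bar>y\<bar> ^ 4 \<le> (norm \<xi> * R) ^ 4" by (intro power_mono) auto
      then have "y ^ 4 \<le> R ^ 4 * norm \<xi> ^ 4" by (simp add: power_mult_distrib mult.commute)
      moreover have "(g z \<bullet> \<xi>)\<^sup>2 = y\<^sup>2 / 2"
        using True by (simp add: g_def y_def inner_commute power_divide)
      ultimately show ?thesis using cos_le_taylor4[of y] unfolding y_def by linarith
    next
      case False
      then have "(g z \<bullet> \<xi>)\<^sup>2 = 0" by (simp add: g_def)
      moreover have "0 \<le> R ^ 4 * norm \<xi> ^ 4" by simp
      ultimately show ?thesis using cos_le_one[of "\<xi> \<bullet> (fst z - snd z)"] by linarith
    qed
  qed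
  also have "\<dots> = 1 - p + R ^ 4 * norm \<xi> ^ 4"
  proof -
    have "integrable (M \<Otimes>\<^sub>M M) (\<lambda>z. (g z \<bullet> \<xi>)\<^sup>2)"
      by (rule P.integrable_const_bound[where B="R\<^sup>2 * (norm \<xi>)\<^sup>2"]) (use gx in auto)
    then show ?thesis unfolding p_def using P.prob_space by simp
  qed
  finally have f2: "(cmod f)\<^sup>2 \<le> 1 - p + R ^ 4 * norm \<xi> ^ 4" .
  have "2 * cmod f \<le> 1 + (cmod f)\<^sup>2" using sum_squares_bound[of 1 "cmod f"] by simp
  moreover have "1 - p / 2 \<le> exp (- (p / 2))" using exp_ge_add_one_self[of "- (p / 2)"] by simp
  ultimately show ?thesis using f2 unfolding f_def[symmetric] p_def[symmetric] by (simp add: field_simps)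
qed

section \<open>Weak convergence\<close>

lemma maxwellian_density:
  assumes s: "\<sigma> > 0"
  shows "maxwellian v0 \<sigma> = density lborel (\<lambda>v. ennreal (gauss_density \<sigma> (v - v0)))"
proof -
  have "(2 * pi * \<sigma>\<^sup>2) powr (-3/2) = (1 / sqrt (2 * pi * \<sigma>\<^sup>2)) ^ 3"
  proof -
    have a: "2 * pi * \<sigma>\<^sup>2 > 0" using s by simp
    have "(2 * pi * \<sigma>\<^sup>2) powr (-3/2) = ((2 * pi * \<sigma>\<^sup>2) powr (-1/2)) powr 3"
      by (simp add: powr_powr)
    also have "\<dots> = ((2 * pi * \<sigma>\<^sup>2) powr (-1/2)) ^ 3" using a by (subst powr_numeral) auto
    also have "(2 * pi * \<sigma>\<^sup>2) powr (-1/2) = 1 / sqrt (2 * pi * \<sigma>\<^sup>2)"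
      using a by (simp add: powr_minus powr_half_sqrt inverse_eq_divide flip: powr_half_sqrt)
    finally show ?thesis .
  qed
  then show ?thesis using s by (simp add: maxwellian_def gauss_density_eq)
qed

lemma is_prob_borel_maxwellian: "is_prob_borel (maxwellian v0 \<sigma>)"
proof (cases "\<sigma> > 0")
  case True
  have "(\<integral>\<^sup>+ v. ennreal (gauss_density \<sigma> (v - v0)) \<partial>lborel)
      = (\<integral>\<^sup>+ v. ennreal (gauss_density \<sigma> (v - v0)) \<partial>distr lborel borel ((+) v0))"
    by (simp only: lborel_distr_plus)
  also have "\<dots> = (\<integral>\<^sup>+ v. ennreal (gauss_density \<sigma> v) \<partial>(lborel :: vec3 measure))" by (subst nn_integral_distr) auto
  also have "\<dots> = 1" using True
    by (simp add: nn_integral_eq_integral integrable_gauss_density integral_gauss_density)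
  finally have "prob_space (maxwellian v0 \<sigma>)"
    unfolding maxwellian_density[OF True] by (intro prob_spaceI) (simp add: emeasure_density)
  then show ?thesis unfolding is_prob_borel_def by (simp add: maxwellian_def)
next
  case False
  then show ?thesis by (simp add: is_prob_borel_def maxwellian_def prob_space_return)
qed

lemma maxwellian_char:
  assumes "\<sigma> \<ge> 0"
  shows "(\<integral>x. iexp (\<xi> \<bullet> x) \<partial>maxwellian v0 \<sigma>) = iexp (\<xi> \<bullet> v0) * exp (- (\<sigma>\<^sup>2 * (norm \<xi>)\<^sup>2) / 2)"
proof (cases "\<sigma> > 0")
  case True
  have "(\<integral>x. iexp (\<xi> \<bullet> x) \<partial>maxwellian v0 \<sigma>) = (\<integral>x. gauss_density \<sigma> (x - v0) * iexp (\<xi> \<bullet> x) \<partial>lborel)"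
    unfolding maxwellian_density[OF True] by (subst integral_density) (auto simp: scaleR_conv_of_real)
  also have "\<dots> = (\<integral>x. gauss_density \<sigma> (x - v0) * iexp (\<xi> \<bullet> x) \<partial>distr lborel borel ((+) v0))"
    by (simp only: lborel_distr_plus)
  also have "\<dots> = (\<integral>x. iexp (\<xi> \<bullet> v0) * (gauss_density \<sigma> x * iexp (\<xi> \<bullet> x)) \<partial>lborel)"
    by (subst integral_distr) (auto simp: inner_simps distrib_left exp_add mult_ac)
  also have "\<dots> = iexp (\<xi> \<bullet> v0) * exp (- (\<sigma>\<^sup>2 * (norm \<xi>)\<^sup>2) / 2)"
    by (subst Bochner_Integration.integral_mult_right_zero, subst integral_gauss_iexp[OF True]) simp
  finally show ?thesis .
next
  case False
  then have "\<sigma> = 0" using assms by simp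
  then show ?thesis by (simp add: maxwellian_def integral_return)
qed

lemma weak_conv_at_top_of_char:
  assumes P: "\<And>t. t \<ge> 0 \<Longrightarrow> is_prob_borel (\<mu> t)" and \<nu>: "is_prob_borel \<nu>"
    and lim: "\<And>\<xi>. ((\<lambda>t. \<integral>x. iexp (\<xi> \<bullet> x) \<partial>\<mu> t) \<longlongrightarrow> (\<integral>x. iexp (\<xi> \<bullet> x) \<partial>\<nu>)) at_top"
  shows "weak_conv_at_top \<mu> \<nu>"
  unfolding weak_conv_at_top_def
proof (intro allI impI tendsto_at_topI_sequentially)
  fix \<phi> and X :: "nat \<Rightarrow> real"
  assume \<phi>: "bounded_continuous \<phi>" and X: "filterlim X at_top sequentially"
  have ev: "\<forall>\<^sub>F n in sequentially. max 0 (X n) = X n"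
    using X by (auto simp: filterlim_at_top elim!: eventually_mono dest: spec[of _ 0])
  then have mX: "filterlim (\<lambda>n. max 0 (X n)) at_top sequentially"
    using X filterlim_cong[OF refl refl ev] by simp
  have "(\<lambda>n. \<integral>x. \<phi> x \<partial>\<mu> (max 0 (X n))) \<longlonglongrightarrow> (\<integral>x. \<phi> x \<partial>\<nu>)"
    by (rule levy_continuity_euclidean)
       (use P \<nu> \<phi> filterlim_compose[OF lim mX] in \<open>auto simp: is_prob_borel_def bounded_continuous_def\<close>)
  then show "(\<lambda>n. \<integral>x. \<phi> x \<partial>\<mu> (X n)) \<longlonglongrightarrow> (\<integral>x. \<phi> x \<partial>\<nu>)"
    by (rule Lim_transform_eventually) (use ev in \<open>auto elim!: eventually_mono\<close>)
qed

lemma weak_conv_at_top_imp_char: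
  assumes w: "weak_conv_at_top \<mu> \<nu>" and P: "\<And>t. t \<ge> 0 \<Longrightarrow> is_prob_borel (\<mu> t)" and \<nu>: "is_prob_borel \<nu>"
  shows "((\<lambda>t. \<integral>x. iexp (\<xi> \<bullet> x) \<partial>\<mu> t) \<longlongrightarrow> (\<integral>x. iexp (\<xi> \<bullet> x) \<partial>\<nu>)) at_top"
proof -
  have "bounded_continuous (\<lambda>x. cos (\<xi> \<bullet> x))" "bounded_continuous (\<lambda>x. sin (\<xi> \<bullet> x))"
    unfolding bounded_continuous_def by (auto intro!: continuous_intros boundedI[where B=1])
  then have "((\<lambda>t. of_real (\<integral>x. cos (\<xi> \<bullet> x) \<partial>\<mu> t) + \<i> * complex_of_real (\<integral>x. sin (\<xi> \<bullet> x) \<partial>\<mu> t)) \<longlongrightarrow> (\<integral>x. iexp (\<xi> \<bullet> x) \<partial>\<nu>)) at_top"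
    unfolding char_eq_cos_sin[OF \<nu>] using w unfolding weak_conv_at_top_def by (intro tendsto_intros) auto
  then show ?thesis
  proof (rule Lim_transform_eventually)
    show "\<forall>\<^sub>F t in at_top. of_real (\<integral>x. cos (\<xi> \<bullet> x) \<partial>\<mu> t) + \<i> * complex_of_real (\<integral>x. sin (\<xi> \<bullet> x) \<partial>\<mu> t) = (\<integral>x. iexp (\<xi> \<bullet> x) \<partial>\<mu> t)"
      using eventually_ge_at_top[of 0] by eventually_elim (simp only: char_eq_cos_sin[OF P])
  qed
qed

lemma char_nonzero_near_0:
  assumes \<nu>: "is_prob_borel \<nu>"
  obtains \<xi> :: vec3 where "\<xi> \<noteq> 0" "(\<integral>x. iexp (\<xi> \<bullet> x) \<partial>\<nu>) \<noteq> 0"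
proof -
  interpret prob_space \<nu> using \<nu> by (simp add: is_prob_borel_def)
  have [measurable_cong]: "sets \<nu> = sets borel" using \<nu> by (simp add: is_prob_borel_def)
  define e where "e n = (1 / real (Suc n)) *\<^sub>R (axis 1 1 :: vec3)" for n
  have e0: "e \<longlonglongrightarrow> 0 *\<^sub>R (axis 1 1 :: vec3)" unfolding e_def
    by (intro tendsto_scaleR tendsto_const) (use LIMSEQ_inverse_real_of_nat in \<open>simp add: inverse_eq_divide\<close>)
  have "(\<lambda>n. \<integral>x. iexp (e n \<bullet> x) \<partial>\<nu>) \<longlonglongrightarrow> (\<integral>x. iexp (0 \<bullet> x) \<partial>\<nu>)"
  proof (rule integral_dominated_convergence[where w="\<lambda>_. 1"])
    show "AE x in \<nu>. (\<lambda>n. iexp (e n \<bullet> x)) \<longlonglongrightarrow> iexp (0 \<bullet> x)"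
      using e0 by (intro AE_I2 tendsto_intros) simp
  qed auto
  then have "(\<lambda>n. \<integral>x. iexp (e n \<bullet> x) \<partial>\<nu>) \<longlonglongrightarrow> 1" using prob_space by simp
  then have "\<forall>\<^sub>F n in sequentially. (\<integral>x. iexp (e n \<bullet> x) \<partial>\<nu>) \<noteq> 0"
    by (rule tendsto_imp_eventually_ne) simp
  then obtain n where "(\<integral>x. iexp (e n \<bullet> x) \<partial>\<nu>) \<noteq> 0" by (auto simp: eventually_sequentially)
  moreover have "e n \<noteq> 0" by (simp add: e_def axis_eq_0_iff)
  ultimately show ?thesis using that by blast
qed

lemma measure_solution_convergent_imp_finite_energy:
  assumes b: "angular_kernel b" and sol: "measure_solution b \<mu>0 \<mu>"
    and \<nu>: "is_prob_borel \<nu>" and w: "weak_conv_at_top \<mu> \<nu>"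
  shows "(\<integral>\<^sup>+ x. ennreal ((norm x)\<^sup>2) \<partial>\<mu>0) < \<infinity>"
proof -
  interpret normalized_kernel "cut_kernel b" using measure_solution_kernel[OF b sol] by simp
  have P: "is_prob_borel (\<mu> t)" if "t \<ge> 0" for t using sol that by (simp add: measure_solution_def)
  have \<mu>0: "\<mu> 0 = \<mu>0" using sol by (simp add: measure_solution_def)
  have P0: "is_prob_borel \<mu>0" using P[of 0] \<mu>0 by simp
  interpret M: prob_space \<mu>0 using P0 by (simp add: is_prob_borel_def)
  have [measurable_cong]: "sets \<mu>0 = sets borel" using P0 by (simp add: is_prob_borel_def)
  interpret PP: pair_prob_space \<mu>0 \<mu>0 ..
  obtain \<xi> :: vec3 where \<xi>: "\<xi> \<noteq> 0" "(\<integral>x. iexp (\<xi> \<bullet> x) \<partial>\<nu>) \<noteq> 0" using char_nonzero_near_0[OF \<nu>] .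
  define l where "l = (\<integral>x. iexp (\<xi> \<bullet> x) \<partial>\<nu>)"
  have l0: "cmod l > 0" using \<xi> by (simp add: l_def)
  let ?h = "\<lambda>n z. if norm (fst z - snd z) \<le> real n then fst z - snd z else (0 :: vec3)"
  have "(\<integral>z. (norm (?h n z))\<^sup>2 \<partial>(\<mu>0 \<Otimes>\<^sub>M \<mu>0)) \<le> 12 * (- ln (cmod l) / (norm \<xi>)\<^sup>2)" for n
  proof -
    define g where "g z = (if norm (fst z - snd z) \<le> real n then (1 / sqrt 2) *\<^sub>R (fst z - snd z) else (0 :: vec3))" for z
    have gm: "g \<in> borel_measurable (\<mu>0 \<Otimes>\<^sub>M \<mu>0)" unfolding g_def by measurable
    have gh: "(norm (g z))\<^sup>2 = (norm (?h n z))\<^sup>2 / 2" for z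
      by (simp add: g_def power_divide flip: scaleR_right_diff_distrib)
    have gi: "integrable (\<mu>0 \<Otimes>\<^sub>M \<mu>0) (\<lambda>z. (norm (g z))\<^sup>2)"
    proof (rule PP.integrable_const_bound[where B="(real n)\<^sup>2"])
      have "(norm (?h n z))\<^sup>2 \<le> (real n)\<^sup>2" for z by (intro power_mono) auto
      then have "(norm (g z))\<^sup>2 \<le> (real n)\<^sup>2" for z unfolding gh using zero_le_power2[of "norm (?h n z)"] by (smt (verit) field_sum_of_halves)
      then show "AE z in \<mu>0 \<Otimes>\<^sub>M \<mu>0. norm ((norm (g z))\<^sup>2) \<le> (real n)\<^sup>2" by simp
    qed (use gm in measurable)
    define s where "s = (\<integral>z. (norm (g z))\<^sup>2 \<partial>(\<mu>0 \<Otimes>\<^sub>M \<mu>0)) / 3"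
    have prof: "quadratic_profile (\<lambda>\<xi>. \<integral>z. (g z \<bullet> \<xi>)\<^sup>2 \<partial>(\<mu>0 \<Otimes>\<^sub>M \<mu>0)) s"
      unfolding s_def by (rule quadratic_profile_second_moment[OF PP.prob_space_axioms gm gi])
    have "cmod l \<le> exp (- (s * (norm \<xi>)\<^sup>2) / 2)"
    proof (rule fourier_solution_limit_le_gaussian[OF measure_solution_fourier[OF b sol] prof])
      show "cmod (\<integral>x. iexp (\<xi> \<bullet> x) \<partial>\<mu> 0) \<le> exp (- ((\<integral>z. (g z \<bullet> \<xi>)\<^sup>2 \<partial>(\<mu>0 \<Otimes>\<^sub>M \<mu>0)) / 2)) + (real n) ^ 4 / 2 * norm \<xi> ^ 4" for \<xi>
        unfolding \<mu>0 g_def by (rule cmod_char_le_truncated_gaussian[OF P0])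
      show "((\<lambda>t. \<integral>x. iexp (\<xi> \<bullet> x) \<partial>\<mu> t) \<longlongrightarrow> l) at_top"
        unfolding l_def by (rule weak_conv_at_top_imp_char[OF w P \<nu>])
    qed
    then have "ln (cmod l) \<le> - (s * (norm \<xi>)\<^sup>2) / 2" using l0 by (metis ln_exp ln_mono exp_gt_zero)
    then have "s \<le> 2 * (- ln (cmod l) / (norm \<xi>)\<^sup>2)" using \<xi>(1) by (simp add: field_simps)
    moreover have "(\<integral>z. (norm (?h n z))\<^sup>2 \<partial>(\<mu>0 \<Otimes>\<^sub>M \<mu>0)) = 6 * s" unfolding s_def gh by simp
    ultimately show ?thesis by simp
  qed
  then show ?thesis by (rule second_moment_truncation_bounded_imp_finite[OF P0])
qed

lemma measure_solution_tendsto_maxwellian: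
  assumes b: "angular_kernel b" and sol: "measure_solution b \<mu>0 \<mu>"
    and fin: "(\<integral>\<^sup>+ x. ennreal ((norm x)\<^sup>2) \<partial>\<mu>0) < \<infinity>"
  defines "v0 \<equiv> \<integral>v. v \<partial>\<mu>0"
  shows "weak_conv_at_top \<mu> (maxwellian v0 (sqrt ((1/3) * (\<integral>v. (norm (v - v0))\<^sup>2 \<partial>\<mu>0))))"
proof -
  interpret normalized_kernel "cut_kernel b" using measure_solution_kernel[OF b sol] by simp
  have P: "is_prob_borel (\<mu> t)" if "t \<ge> 0" for t using sol that by (simp add: measure_solution_def)
  have \<mu>0: "\<mu> 0 = \<mu>0" using sol by (simp add: measure_solution_def)
  have P0: "is_prob_borel \<mu>0" using P[of 0] \<mu>0 by simp
  interpret M: prob_space \<mu>0 using P0 by (simp add: is_prob_borel_def)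
  have sets0[measurable_cong]: "sets \<mu>0 = sets borel" using P0 by (simp add: is_prob_borel_def)
  have i2: "integrable \<mu>0 (\<lambda>x. (norm x)\<^sup>2)"
    using fin by (intro integrableI_bounded) auto
  have i1: "integrable \<mu>0 (\<lambda>x. x)" by (rule M.integrable_of_square_integrable[OF _ i2]) simp
  define g where "g x = x - v0" for x
  have gm[measurable]: "g \<in> borel_measurable \<mu>0" unfolding g_def by measurable
  have gi: "integrable \<mu>0 (\<lambda>x. (norm (g x))\<^sup>2)"
  proof (rule Bochner_Integration.integrable_bound)
    show "integrable \<mu>0 (\<lambda>x. 2 * (norm x)\<^sup>2 + 2 * (norm v0)\<^sup>2)" using i2 by simp
    have "(norm (g x))\<^sup>2 \<le> 2 * (norm x)\<^sup>2 + 2 * (norm v0)\<^sup>2" for x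
    proof -
      have "(norm (g x))\<^sup>2 \<le> (norm x + norm v0)\<^sup>2" unfolding g_def by (intro power_mono norm_triangle_ineq4) auto
      also have "\<dots> \<le> 2 * (norm x)\<^sup>2 + 2 * (norm v0)\<^sup>2"
        using sum_squares_bound[of "norm x" "norm v0"] by (simp add: power2_sum)
      finally show ?thesis .
    qed
    then show "AE x in \<mu>0. norm ((norm (g x))\<^sup>2) \<le> norm (2 * (norm x)\<^sup>2 + 2 * (norm v0)\<^sup>2)" by simp
  qed simp
  have mean: "(\<integral>x. g x \<partial>\<mu>0) = 0" unfolding g_def using i1 M.prob_space by (simp add: v0_def)
  define s where "s = (\<integral>x. (norm (g x))\<^sup>2 \<partial>\<mu>0) / 3"
  have s0: "s \<ge> 0" by (simp add: s_def)
  have prof: "quadratic_profile (\<lambda>\<xi>. \<integral>x. (g x \<bullet> \<xi>)\<^sup>2 \<partial>\<mu>0) s"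
    unfolding s_def by (rule quadratic_profile_second_moment[OF M.prob_space_axioms gm gi])
  let ?f = "\<lambda>\<xi> t. iexp (- (\<xi> \<bullet> v0)) * (\<integral>x. iexp (\<xi> \<bullet> x) \<partial>\<mu> t)"
  have sol': "fourier_solution ?f"
    by (rule fourier_solution_translate[OF measure_solution_fourier[OF b sol]])
  have init: "?f \<xi> 0 = (\<integral>x. iexp (\<xi> \<bullet> g x) \<partial>\<mu>0)" for \<xi>
    unfolding \<mu>0 g_def
    by (simp add: inner_diff_right right_diff_distrib exp_diff exp_minus field_simps flip: Bochner_Integration.integral_mult_right_zero)
  have lim: "(?f \<xi> \<longlongrightarrow> of_real (exp (- (s * (norm \<xi>)\<^sup>2) / 2))) at_top" for \<xi>
  proof (rule fourier_solution_tendsto_gaussian[OF sol' prof])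
    fix \<epsilon> :: real assume "\<epsilon> > 0"
    from char_second_order[OF M.prob_space_axioms gm gi mean this]
    show "\<exists>C. \<forall>\<xi>. cmod (?f \<xi> 0 - exp (- ((\<integral>x. (g x \<bullet> \<xi>)\<^sup>2 \<partial>\<mu>0) / 2))) \<le> \<epsilon> * (norm \<xi>)\<^sup>2 + C * norm \<xi> ^ 4"
      unfolding init .
  qed
  have "weak_conv_at_top \<mu> (maxwellian v0 (sqrt s))"
  proof (rule weak_conv_at_top_of_char[OF P is_prob_borel_maxwellian])
    fix \<xi> :: vec3
    have "((\<lambda>t. iexp (\<xi> \<bullet> v0) * ?f \<xi> t) \<longlongrightarrow> iexp (\<xi> \<bullet> v0) * of_real (exp (- (s * (norm \<xi>)\<^sup>2) / 2))) at_top"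
      by (intro tendsto_mult_left lim)
    moreover have eq: "iexp (\<xi> \<bullet> v0) * ?f \<xi> t = (\<integral>x. iexp (\<xi> \<bullet> x) \<partial>\<mu> t)" for t
      by (simp add: exp_minus)
    moreover have "(\<integral>x. iexp (\<xi> \<bullet> x) \<partial>maxwellian v0 (sqrt s)) = iexp (\<xi> \<bullet> v0) * of_real (exp (- (s * (norm \<xi>)\<^sup>2) / 2))"
      using maxwellian_char[of "sqrt s" v0 \<xi>] s0 by simp
    ultimately show "((\<lambda>t. \<integral>x. iexp (\<xi> \<bullet> x) \<partial>\<mu> t) \<longlongrightarrow> (\<integral>x. iexp (\<xi> \<bullet> x) \<partial>maxwellian v0 (sqrt s))) at_top"
      by (simp only:)
  qed auto
  moreover have "sqrt ((1/3) * (\<integral>v. (norm (v - v0))\<^sup>2 \<partial>\<mu>0)) = sqrt s" by (simp add: s_def g_def)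
  ultimately show ?thesis by simp
qed

theorem theorem3:
  fixes b :: "real \<Rightarrow> real" and \<mu>0 :: "vec3 measure" and \<mu> :: "real \<Rightarrow> vec3 measure"
  assumes "angular_kernel b"
    and "is_prob_borel \<mu>0"
    and "measure_solution b \<mu>0 \<mu>"
  shows "((\<exists>\<nu>. is_prob_borel \<nu> \<and> weak_conv_at_top \<mu> \<nu>)
           \<longleftrightarrow> (\<integral>\<^sup>+ x. ennreal ((norm x)\<^sup>2) \<partial>\<mu>0) < \<infinity>) \<and>
         ((\<integral>\<^sup>+ x. ennreal ((norm x)\<^sup>2) \<partial>\<mu>0) < \<infinity> \<longrightarrow>
           weak_conv_at_top \<mu>
             (maxwellian (\<integral>v. v \<partial>\<mu>0) (sqrt ((1/3) * (\<integral>v. (norm (v - (\<integral>v. v \<partial>\<mu>0)))\<^sup>2 \<partial>\<mu>0)))))"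
  using measure_solution_convergent_imp_finite_energy[OF assms(1,3)]
    measure_solution_tendsto_maxwellian[OF assms(1,3)] is_prob_borel_maxwellian by blast

end
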